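(* Let $R_0=\{c_1,c_2,\dots,c_{2t-1},b_1,b_2,\dots,b_{t-1}\}$, $\mathbf{u}=(a_2,a_4,\dots,a_{2t-2})$ and $\mathbf{w}=(b_{t-1},b_{t-2},\dots,b_1)$. Then the map $\phi$ restricts to a bijection between the set of rooted $G(v,t)$-forests $F$ whose set of roots $R(F)$ equals $R_0$ and the set $\mathcal{P}(\mathbf{u},\mathbf{w})$ of $(t-1)$-paths in $\tilde N_{(v,t)}$ whose $i$-th path starts at $a_{2i}$ and ends at $b_{t-i}$ for $1\le i\le t-1$.
   Context: Let $\mathbb{P}_0=\{(i,j,k)\in\mathbb{Z}^3:i+j+k=0\}$ (a triangular lattice in the plane), $e_{12}=(1,-1,0)$, $e_{23}=(0,1,-1)$, $e_{31}=(-1,0,1)$; for $v=(i,j,k)$ its color $\epsilon_v\in\{0,1,2\}$ satisfies $\epsilon_v\equiv j-k\pmod3$ (colors $0,1,2$: red, green, blue). To each $u\in\mathbb{P}_0$ is attached an indeterminate $x_u$. Let $G$ be the planar graph on $\mathbb{P}_0$ with edges $(u,u+e_{12}),(u,u+e_{23}),(u,u+e_{31})$ for every $u$ with $\epsilon_u\neq0$; its bounded faces are lozenges, each with one red vertex $d_L$, one blue vertex $b_L$, two green vertices $a_L,c_L$, diagonals $\{b_L,d_L\}$, $\{a_L,c_L\}$, and center $e_L$. Fix $v\in\mathbb{P}_0$ and an integer $t\ge2$ with $t+1\equiv\epsilon_v\pmod 3$. Let $\Delta(v,t)$ be the convex hull of $v+te_{12},v+te_{23},v+te_{31}$, and $G(v,t)$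 the subgraph of $G$ formed by all lozenges of $G$ inside $\Delta(v,t)$, with vertex set $\mathrm{Vert}(v,t)$. Its outer-face vertices $\partial G(v,t)$ are listed counterclockwise as $a_1,\dots,a_{2t-1}=b_1,\dots,b_{2t-1}=c_1,\dots,c_{2t-1}=a_1$ where for $1\le i\le t-1$: $a_{2i}=v+(i,t-2i,i-t)$, $b_{2i}=v+(t-2i,i-t,i)$, $c_{2i}=v+(i-t,i,t-2i)$, and for $0\le i\le t-1$: $a_{2i+1}=v+(i,t-1-2i,i-t+1)$, $b_{2i+1}=v+(t-1-2i,i-t+1,i)$, $c_{2i+1}=v+(i-t+1,i,t-1-2i)$. A $G(v,t)$-forest is a forest with vertex set $\mathrm{Vert}(v,t)$ containing, for each lozenge of $G(v,t)$, exactly one of its two diagonals, and no other edges. A rooted $G(v,t)$-forest additionally has, for each connected component $C$, a chosen root $s_C\in C\cap\partial G(v,t)$; edges are oriented towards roots; $R(F)$ denotes the set of roots. The network $\tilde N_{(v,t)}$ has vertex set $\mathrm{Vert}(v,t)$ together with the lozenge centers, and for each lozenge $L$ of $G(v,t)$ edges $a_L\to e_L$, $c_L\to e_L$ (weight $x_{a_L}x_{c_L}/(x_{b_L}x_{d_L})$) and $b_L\to e_L$, $e_L\to d_L$ (weight $1$). An $r$-path is an $r$-tuple of pairwise vertex-disjoint directed paths, identified with its edge set. The map $\phi$: for a rooted $G(v,t)$-forest $F$ and each lozenge $L$ with oriented edge $u\to w$ of $F$ inside $L$, take no edges if $u=d_L$, and otherwise take $u\to e_L$ and $e_L\to d_L$;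 $\phi(F)$ is the set of all taken edges.
   Formalization: In Ñ and φ, b_L and d_L are the upper and lower ends of the more vertical diagonal of L, and a_L, c_L the other two vertices, instead of d_L red, b_L blue, a_L, c_L green: with the colour labels no arc leaves a red vertex, so P(u,w) is empty although forests with R(F)=R_0 exist. *)

theory Defs
  imports "HOL-Analysis.Analysis" "Graph_Theory.Pair_Digraph"
begin

section \<open>The lattice and the graph \<open>G\<close>\<close>

type_synonym lattice_point = "int \<times> int \<times> int"
type_synonym space_point = "real \<times> real \<times> real"

definition P0 :: "lattice_point set" where
  "P0 = {(i, j, k). i + j + k = 0}"

definition e12 :: lattice_point where "e12 = (1, -1, 0)"
definition e23 :: lattice_point where "e23 = (0, 1, -1)"
definition e31 :: lattice_point where "e31 = (-1, 0, 1)"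

text \<open>Colors: 0 is red, 1 is green, 2 is blue.\<close>

definition color :: "lattice_point \<Rightarrow> int" where
  "color = (\<lambda>(i, j, k). (j - k) mod 3)"

definition G_edges :: "lattice_point set set" where
  "G_edges = {{u, u + e} | u e. u \<in> P0 \<and> color u \<noteq> 0 \<and> e \<in> {e12, e23, e31}}"

definition plane :: "space_point set" where
  "plane = {(x, y, z). x + y + z = 0}"

definition embed :: "lattice_point \<Rightarrow> space_point" where
  "embed = (\<lambda>(i, j, k). (of_int i, of_int j, of_int k))"

definition drawing :: "space_point set" where
  "drawing = (\<Union>A\<in>G_edges. convex hull (embed ` A))"

text \<open>
  A lozenge is a bounded face of the straight-line drawing of \<open>G\<close>, represented by the
  corresponding open region of the plane.  The lemmas \<open>lozenges_eq\<close>,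
  \<open>loz_verts_rhombus12\<close>, etc. at the end of this theory determine these faces and their vertices.
\<close>

definition lozenges :: "space_point set set" where
  "lozenges = {L \<in> components (plane - drawing). bounded L}"

definition loz_verts :: "space_point set \<Rightarrow> lattice_point set" where
  "loz_verts L = {u \<in> P0. embed u \<in> closure L}"

definition red_vert :: "space_point set \<Rightarrow> lattice_point" where
  "red_vert L = (THE u. u \<in> loz_verts L \<and> color u = 0)"

definition blue_vert :: "space_point set \<Rightarrow> lattice_point" where
  "blue_vert L = (THE u. u \<in> loz_verts L \<and> color u = 2)"

definition green_verts :: "space_point set \<Rightarrow> lattice_point set" where
  "green_verts L = {u \<in> loz_verts L. color u = 1}"

definition diagonals :: "space_point set \<Rightarrow> lattice_point set set" where
  "diagonals L = {{red_vert L, blue_vert L}, green_verts L}"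


section \<open>The graph \<open>G(v,t)\<close>\<close>

definition Delta :: "lattice_point \<Rightarrow> nat \<Rightarrow> space_point set" where
  "Delta v t = convex hull ((\<lambda>e. embed v + real t *\<^sub>R embed e) ` {e12, e23, e31})"

definition lozenges_in :: "lattice_point \<Rightarrow> nat \<Rightarrow> space_point set set" where
  "lozenges_in v t = {L \<in> lozenges. L \<subseteq> Delta v t}"

definition Vert :: "lattice_point \<Rightarrow> nat \<Rightarrow> lattice_point set" where
  "Vert v t = (\<Union>L\<in>lozenges_in v t. loz_verts L)"

definition a_pt :: "lattice_point \<Rightarrow> nat \<Rightarrow> nat \<Rightarrow> lattice_point" where
  "a_pt v t n = v + (let T = int t; i = int (n div 2) in
     if even n then (i, T - 2 * i, i - T) else (i, T - 1 - 2 * i, i - T + 1))"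

definition b_pt :: "lattice_point \<Rightarrow> nat \<Rightarrow> nat \<Rightarrow> lattice_point" where
  "b_pt v t n = v + (let T = int t; i = int (n div 2) in
     if even n then (T - 2 * i, i - T, i) else (T - 1 - 2 * i, i - T + 1, i))"

definition c_pt :: "lattice_point \<Rightarrow> nat \<Rightarrow> nat \<Rightarrow> lattice_point" where
  "c_pt v t n = v + (let T = int t; i = int (n div 2) in
     if even n then (i - T, i, T - 2 * i) else (i - T + 1, i, T - 1 - 2 * i))"

text \<open>The vertices of \<open>G(v,t)\<close> on its outer face.\<close>

definition boundary :: "lattice_point \<Rightarrow> nat \<Rightarrow> lattice_point set" where
  "boundary v t = a_pt v t ` {1..2 * t - 1} \<union> b_pt v t ` {1..2 * t - 1} \<union> c_pt v t ` {1..2 * t - 1}"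


section \<open>Rooted forests\<close>

abbreviation is_path :: "'a pair_pre_digraph \<Rightarrow> 'a \<Rightarrow> ('a \<times> 'a) list \<Rightarrow> 'a \<Rightarrow> bool" where
  "is_path H \<equiv> pre_digraph.apath (with_proj H)"

abbreviation path_verts :: "'a pair_pre_digraph \<Rightarrow> 'a \<Rightarrow> ('a \<times> 'a) list \<Rightarrow> 'a set" where
  "path_verts H u p \<equiv> set (pre_digraph.awalk_verts (with_proj H) u p)"

text \<open>An undirected graph with two-element edge sets, viewed as a symmetric digraph.\<close>

definition ugraph :: "'a set \<Rightarrow> 'a set set \<Rightarrow> 'a pair_pre_digraph" where
  "ugraph V E = \<lparr>pverts = V, parcs = {(u, w). {u, w} \<in> E}\<rparr>"

text \<open>
  A cycle consists of a path with at least two edges and a further edge joining its ends.  (The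
  library's notion of cycle for digraphs would count \<open>u, w, u\<close> as a cycle.)
\<close>

definition acyclic_ugraph :: "'a set \<Rightarrow> 'a set set \<Rightarrow> bool" where
  "acyclic_ugraph V E \<longleftrightarrow>
     \<not> (\<exists>u p w. is_path (ugraph V E) u p w \<and> length p \<ge> 2 \<and> {w, u} \<in> E)"

definition comp_of :: "'a set \<Rightarrow> 'a set set \<Rightarrow> 'a \<Rightarrow> 'a set" where
  "comp_of V E u = {w. u \<rightarrow>\<^sup>*\<^bsub>with_proj (ugraph V E)\<^esub> w}"

definition conn_comps :: "'a set \<Rightarrow> 'a set set \<Rightarrow> 'a set set" where
  "conn_comps V E = comp_of V E ` V"

definition is_forest :: "lattice_point \<Rightarrow> nat \<Rightarrow> lattice_point set set \<Rightarrow> bool" where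
  "is_forest v t E \<longleftrightarrow>
     E \<subseteq> (\<Union>L\<in>lozenges_in v t. diagonals L) \<and>
     (\<forall>L\<in>lozenges_in v t. \<exists>!A. A \<in> diagonals L \<and> A \<in> E) \<and>
     acyclic_ugraph (Vert v t) E"

text \<open>
  A rooted forest is a pair of an edge set and a map (undefined elsewhere) choosing
  the root \<open>s C\<close> of every component \<open>C\<close>.
\<close>

type_synonym rooted_forest =
  "lattice_point set set \<times> (lattice_point set \<Rightarrow> lattice_point)"

definition is_rooted_forest :: "lattice_point \<Rightarrow> nat \<Rightarrow> rooted_forest \<Rightarrow> bool" where
  "is_rooted_forest v t = (\<lambda>(E, s). is_forest v t E \<and>
     s \<in> (\<Pi>\<^sub>E C\<in>conn_comps (Vert v t) E. C \<inter> boundary v t))"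

definition roots :: "lattice_point \<Rightarrow> nat \<Rightarrow> rooted_forest \<Rightarrow> lattice_point set" where
  "roots v t = (\<lambda>(E, s). s ` conn_comps (Vert v t) E)"

text \<open>\<open>(u, w)\<close> is an oriented edge iff it is the first step of the path from \<open>u\<close> to its root.\<close>

definition oriented_edges ::
    "lattice_point \<Rightarrow> nat \<Rightarrow> rooted_forest \<Rightarrow> (lattice_point \<times> lattice_point) set" where
  "oriented_edges v t = (\<lambda>(E, s).
     {(u, w). \<exists>p. is_path (ugraph (Vert v t) E) u ((u, w) # p) (s (comp_of (Vert v t) E u))})"


section \<open>The network\<close>

text \<open>
  In the network the corners \<open>a\<^sub>L\<close>, \<open>b\<^sub>L\<close>, \<open>c\<^sub>L\<close>, \<open>d\<^sub>L\<close> are labelled by position, in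
  such a way that \<open>{b\<^sub>L, d\<^sub>L}\<close> and \<open>{a\<^sub>L, c\<^sub>L}\<close> are the two diagonals: draw the triangular lattice
  with \<open>e31\<close> horizontal and the second coordinate decreasing downwards.  Of the two diagonals of a
  lozenge exactly one is closer to the vertical direction; \<open>b\<^sub>L\<close> is its upper end and \<open>d\<^sub>L\<close> its lower
  end.  For the red vertex \<open>r\<close> and the blue vertex \<open>s\<close> of \<open>L\<close> this means
    \<open>b\<^sub>L = r\<close>, \<open>d\<^sub>L = s\<close> if \<open>s = r + e12\<close>;
    \<open>b\<^sub>L = s\<close>, \<open>d\<^sub>L = r\<close> if \<open>s = r + e23\<close>; and
    \<open>b\<^sub>L = r - e12\<close>, \<open>d\<^sub>L = r - e23\<close> (both green) if \<open>s = r + e31\<close>.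
  It is not possible to take \<open>d\<^sub>L\<close> red and \<open>b\<^sub>L\<close> blue in every lozenge: then no arc would leave a red
  vertex and there would be no directed path from a green vertex to another green or a blue one.
\<close>

definition b_vert :: "space_point set \<Rightarrow> lattice_point" where
  "b_vert L =
     (if blue_vert L = red_vert L + e12 then red_vert L
      else if blue_vert L = red_vert L + e23 then blue_vert L
      else red_vert L - e12)"

definition d_vert :: "space_point set \<Rightarrow> lattice_point" where
  "d_vert L =
     (if blue_vert L = red_vert L + e12 then blue_vert L
      else if blue_vert L = red_vert L + e23 then red_vert L
      else red_vert L - e23)"

definition ac_verts :: "space_point set \<Rightarrow> lattice_point set" where
  "ac_verts L = loz_verts L - {b_vert L, d_vert L}"

text \<open>The lozenge center \<open>e\<^sub>L\<close> is \<open>Center L\<close>.\<close>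

datatype net_vertex = Lattice lattice_point | Center "space_point set"

record ('a, 'k) network =
  net_graph :: "'a pair_pre_digraph"
  net_weight :: "'a \<times> 'a \<Rightarrow> 'k"

text \<open>
  The indeterminates \<open>x u\<close> are arbitrary elements of a field.  The weight function is only
  meaningful on the arcs; it is set to 1 elsewhere.
\<close>

definition N_tilde ::
    "(lattice_point \<Rightarrow> 'k::field) \<Rightarrow> lattice_point \<Rightarrow> nat \<Rightarrow> (net_vertex, 'k) network" where
  "N_tilde x v t =
     \<lparr>net_graph =
        \<lparr>pverts = Lattice ` Vert v t \<union> Center ` lozenges_in v t,
         parcs = (\<Union>L\<in>lozenges_in v t.
           {(Lattice u, Center L) | u. u \<in> ac_verts L} \<union>
           {(Lattice (b_vert L), Center L), (Center L, Lattice (d_vert L))})\<rparr>,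
      net_weight = (\<lambda>arc. case arc of
          (Lattice u, Center L) \<Rightarrow>
            (if u \<in> ac_verts L then (\<Prod>w\<in>ac_verts L. x w) / (x (b_vert L) * x (d_vert L)) else 1)
        | _ \<Rightarrow> 1)\<rparr>"

text \<open>
  The set of tuples of pairwise vertex-disjoint directed paths with prescribed starts \<open>us\<close> and
  ends \<open>ws\<close>, each tuple being identified with its set of arcs.
\<close>

definition path_tuples :: "('a, 'k) network \<Rightarrow> 'a list \<Rightarrow> 'a list \<Rightarrow> ('a \<times> 'a) set set" where
  "path_tuples N us ws =
     {\<Union>(set ` set ps) | ps.
        length us = length ws \<and> length ps = length us \<and>
        (\<forall>i<length ps. is_path (net_graph N) (us ! i) (ps ! i) (ws ! i)) \<and>
        (\<forall>i<length ps. \<forall>j<length ps. i \<noteq> j \<longrightarrow>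
           path_verts (net_graph N) (us ! i) (ps ! i) \<inter>
           path_verts (net_graph N) (us ! j) (ps ! j) = {})}"

definition phi ::
    "lattice_point \<Rightarrow> nat \<Rightarrow> rooted_forest \<Rightarrow> (net_vertex \<times> net_vertex) set" where
  "phi v t F =
     (\<Union>L\<in>lozenges_in v t. \<Union>(u, w)\<in>{(u, w) \<in> oriented_edges v t F. {u, w} \<in> diagonals L}.
        if u = d_vert L then {}
        else {(Lattice u, Center L), (Center L, Lattice (d_vert L))})"

definition R0 :: "lattice_point \<Rightarrow> nat \<Rightarrow> lattice_point set" where
  "R0 v t = c_pt v t ` {1..2 * t - 1} \<union> b_pt v t ` {1..t - 1}"


section \<open>The faces of \<open>G\<close>\<close>

text \<open>
  The open lozenges at a red vertex \<open>r\<close> whose blue vertex is \<open>r + e12\<close>, \<open>r + e23\<close> and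
  \<open>r + e31\<close>, respectively.
\<close>

definition rhombus12 :: "lattice_point \<Rightarrow> space_point set" where
  "rhombus12 = (\<lambda>(r1, r2, r3). {(x, y, z). x + y + z = 0 \<and>
     0 < x - of_int r1 \<and> x - of_int r1 < 1 \<and> 0 < of_int r2 - y \<and> of_int r2 - y < 1})"

definition rhombus23 :: "lattice_point \<Rightarrow> space_point set" where
  "rhombus23 = (\<lambda>(r1, r2, r3). {(x, y, z). x + y + z = 0 \<and>
     0 < y - of_int r2 \<and> y - of_int r2 < 1 \<and> 0 < of_int r3 - z \<and> of_int r3 - z < 1})"

definition rhombus31 :: "lattice_point \<Rightarrow> space_point set" where
  "rhombus31 = (\<lambda>(r1, r2, r3). {(x, y, z). x + y + z = 0 \<and>
     0 < z - of_int r3 \<and> z - of_int r3 < 1 \<and> 0 < of_int r1 - x \<and> of_int r1 - x < 1})"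

lemma mem_drawing:
  "p \<in> drawing \<longleftrightarrow> (\<exists>u e s. u \<in> P0 \<and> color u \<noteq> 0 \<and> e \<in> {e12, e23, e31} \<and>
     0 \<le> s \<and> s \<le> 1 \<and> p = embed u + s *\<^sub>R embed e)"
proof -
  have emb: "embed (u + e) = embed u + embed e" for u e
    by (cases u; cases e) (simp add: embed_def)
  have seg: "convex hull (embed ` {u, u + e}) = {embed u + s *\<^sub>R embed e | s. 0 \<le> s \<and> s \<le> 1}" for u e
    by (simp add: emb segment_convex_hull [symmetric] closed_segment_def algebra_simps)
  have "p \<in> drawing \<longleftrightarrow> (\<exists>u e. u \<in> P0 \<and> color u \<noteq> 0 \<and> e \<in> {e12, e23, e31} \<and>
     p \<in> convex hull (embed ` {u, u + e}))"
    unfolding drawing_def G_edges_def by blast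
  then show ?thesis unfolding seg by blast
qed

lemma drawing_edges:
  assumes "i + j + k = 0" "(j - k) mod 3 \<noteq> 0" "0 \<le> s" "s \<le> 1"
  shows "(of_int i + s, of_int j - s, of_int k) \<in> drawing"
    and "(of_int i, of_int j + s, of_int k - s) \<in> drawing"
    and "(of_int i - s, of_int j, of_int k + s) \<in> drawing"
proof -
  have *: "(i, j, k) \<in> P0 \<and> color (i, j, k) \<noteq> 0" using assms by (simp add: P0_def color_def)
  show "(of_int i + s, of_int j - s, of_int k) \<in> drawing"
    unfolding mem_drawing using * assms(3,4)
    by (intro exI [of _ "(i, j, k)"] exI [of _ e12] exI [of _ s]) (simp add: embed_def e12_def)
  show "(of_int i, of_int j + s, of_int k - s) \<in> drawing"
    unfolding mem_drawing using * assms(3,4)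
    by (intro exI [of _ "(i, j, k)"] exI [of _ e23] exI [of _ s]) (simp add: embed_def e23_def)
  show "(of_int i - s, of_int j, of_int k + s) \<in> drawing"
    unfolding mem_drawing using * assms(3,4)
    by (intro exI [of _ "(i, j, k)"] exI [of _ e31] exI [of _ s]) (simp add: embed_def e31_def)
qed

lemma drawingI12:
  assumes "i + j + k = 0" "(j - k) mod 3 \<noteq> 0" "0 \<le> s" "s \<le> 1"
    "x = of_int i + s" "y = of_int j - s" "z = of_int k"
  shows "(x, y, z) \<in> drawing"
  using drawing_edges(1) [OF assms(1-4)] assms(5-7) by simp

lemma drawingI23:
  assumes "i + j + k = 0" "(j - k) mod 3 \<noteq> 0" "0 \<le> s" "s \<le> 1"
    "x = of_int i" "y = of_int j + s" "z = of_int k - s"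
  shows "(x, y, z) \<in> drawing"
  using drawing_edges(2) [OF assms(1-4)] assms(5-7) by simp

lemma drawingI31:
  assumes "i + j + k = 0" "(j - k) mod 3 \<noteq> 0" "0 \<le> s" "s \<le> 1"
    "x = of_int i - s" "y = of_int j" "z = of_int k + s"
  shows "(x, y, z) \<in> drawing"
  using drawing_edges(3) [OF assms(1-4)] assms(5-7) by simp

lemma drawingE:
  assumes "p \<in> drawing"
  obtains i j k s where "i + j + k = 0" "(j - k) mod 3 \<noteq> 0" "0 \<le> s" "s \<le> 1"
    "p = (of_int i + s, of_int j - s, of_int k) \<or> p = (of_int i, of_int j + s, of_int k - s) \<or>
     p = (of_int i - s, of_int j, of_int k + s)"
proof -
  obtain u e s where u: "u \<in> P0" "color u \<noteq> 0" "e \<in> {e12, e23, e31}" "0 \<le> s" "s \<le> 1"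
    "p = embed u + s *\<^sub>R embed e"
    using assms unfolding mem_drawing by blast
  obtain i j k where "u = (i, j, k)" by (cases u)
  with u that [of i j k s] show ?thesis
    by (auto simp: P0_def color_def embed_def e12_def e23_def e31_def)
qed

lemma face_criterion:
  fixes D P C Q K :: "'a::euclidean_space set"
  assumes "open Q" "closed K" "Q \<subseteq> K" "convex (P \<inter> Q)" "P \<inter> Q \<noteq> {}"
    and "P \<inter> Q \<inter> D = {}" "P \<inter> K - Q \<subseteq> D"
  shows "P \<inter> Q \<in> components (P - D)"
  unfolding in_components_maximal
proof (intro conjI allI impI)
  show "P \<inter> Q \<noteq> {}" "P \<inter> Q \<subseteq> P - D" "connected (P \<inter> Q)"
    using assms convex_connected by auto
next
  fix C assume C: "C \<noteq> {} \<and> P \<inter> Q \<subseteq> C \<and> C \<subseteq> P - D \<and> connected C"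
  have "C \<subseteq> Q"
  proof (rule ccontr)
    assume "\<not> C \<subseteq> Q"
    then have "(- K) \<inter> C \<noteq> {}" using C assms(7) by blast
    moreover have "Q \<inter> C \<noteq> {}" using C assms(5) by blast
    moreover have "Q \<inter> (- K) \<inter> C = {}" "C \<subseteq> Q \<union> - K" using C assms(3,7) by blast+
    ultimately show False
      using C assms(1,2) connectedD [of C Q "- K"] by blast
  qed
  then show "C = P \<inter> Q" using C by blast
qed

lemma color_shift:
  fixes i j k :: int
  assumes "i + j + k = 0" "(j - k) mod 3 = 0"
  shows "(j - 1 - (k + 1)) mod 3 \<noteq> 0" "(j - (k - 1)) mod 3 \<noteq> 0" "(j + 1 - k) mod 3 \<noteq> 0"
    "(j - 1 - k) mod 3 \<noteq> 0" "(j - (k + 1)) mod 3 \<noteq> 0" "(j + 1 - (k - 1)) mod 3 \<noteq> 0"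
  using assms by presburger+

lemma strips_face:
  fixes f g :: "space_point \<Rightarrow> real" and a b :: int
  assumes "linear f" "linear g"
    and R: "R = {p \<in> plane. 0 < f p - a \<and> f p - a < 1 \<and> 0 < b - g p \<and> b - g p < 1}"
    and ne: "R \<noteq> {}" and disj: "R \<inter> drawing = {}"
    and bdry: "\<And>p. \<lbrakk>p \<in> plane; a \<le> f p; f p \<le> real_of_int a + 1; real_of_int b - 1 \<le> g p; g p \<le> b;
      f p = a \<or> f p = real_of_int a + 1 \<or> g p = real_of_int b - 1 \<or> g p = b\<rbrakk> \<Longrightarrow> p \<in> drawing"
  shows "R \<in> components (plane - drawing)"
proof -
  define Q where "Q = f -` {a<..<a + 1} \<inter> g -` {real_of_int b - 1<..<b}"
  define K where "K = f -` {real_of_int a..a + 1} \<inter> g -` {real_of_int b - 1..b}"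
  have eq: "R = plane \<inter> Q" unfolding R Q_def by auto
  have cont: "continuous_on UNIV f" "continuous_on UNIV g"
    using assms(1,2) by (simp_all add: linear_continuous_on linear_conv_bounded_linear)
  have pl: "plane = (\<lambda>p. fst p + fst (snd p) + snd (snd p)) -` {0}"
    by (auto simp: plane_def)
  have lin: "linear (\<lambda>p::space_point. fst p + fst (snd p) + snd (snd p))"
    by (auto intro!: linearI simp: algebra_simps)
  show ?thesis unfolding eq
  proof (rule face_criterion [of Q K])
    show "open Q" unfolding Q_def using cont by (intro open_Int open_vimage) auto
    show "closed K" unfolding K_def using cont by (intro closed_Int closed_vimage) auto
    show "Q \<subseteq> K" by (auto simp: Q_def K_def)
    show "convex (plane \<inter> Q)" unfolding pl Q_def
      by (intro convex_Int convex_linear_vimage assms lin) auto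
    show "plane \<inter> Q \<noteq> {}" "plane \<inter> Q \<inter> drawing = {}" using ne disj eq by auto
    show "plane \<inter> K - Q \<subseteq> drawing"
    proof
      fix p assume "p \<in> plane \<inter> K - Q"
      then show "p \<in> drawing" using bdry [of p] unfolding K_def Q_def by force
    qed
  qed
qed

lemma int_strip1: "0 < of_int i - (of_int j :: real) \<Longrightarrow> of_int i - (of_int j :: real) < 1 \<Longrightarrow> False"
  using of_int_less_iff [of j i, where 'a = real] of_int_less_iff [of i "j + 1", where 'a = real] by simp

lemma int_strip2:
  fixes s :: real
  shows "\<lbrakk>0 \<le> s; s \<le> 1; 0 < of_int i + s - of_int j; of_int i + s - of_int j < 1\<rbrakk> \<Longrightarrow> i = j"
  by linarith

lemma int_strip3:
  fixes s :: real
  shows "\<lbrakk>0 \<le> s; s \<le> 1; 0 < of_int j - (of_int i - s); of_int j - (of_int i - s) < 1\<rbrakk> \<Longrightarrow> i = j"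
  by linarith

lemma rhombus12_face:
  assumes "r \<in> P0" "color r = 0"
  shows "rhombus12 r \<in> components (plane - drawing)"
proof -
  obtain r1 r2 r3 where r: "r = (r1, r2, r3)" by (cases r)
  have sum0: "r1 + r2 + r3 = 0" and c: "(r2 - r3) mod 3 = 0"
    using assms by (auto simp: r P0_def color_def)
  have sum0': "real_of_int r1 + r2 + r3 = 0" using sum0 by linarith
  note cs = color_shift [OF sum0 c]
  show ?thesis
  proof (rule strips_face [of "fst" "(\<lambda>p. fst (snd p))" _ r1 r2])
    show "linear fst" "linear (\<lambda>p. fst (snd p))"
      by (auto intro!: linearI)
    show "rhombus12 r = {p \<in> plane. 0 < fst p - r1 \<and> fst p - r1 < 1 \<and> 0 < r2 - (\<lambda>p. fst (snd p)) p \<and> r2 - (\<lambda>p. fst (snd p)) p < 1}"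
      by (auto simp: rhombus12_def r plane_def)
    have "(of_int r1 + 1/2, of_int r2 - 1/2, of_int r3) \<in> rhombus12 r" using sum0' by (simp add: rhombus12_def r)
    then show "rhombus12 r \<noteq> {}" by blast
    show "rhombus12 r \<inter> drawing = {}"
    proof (rule ccontr)
      assume "rhombus12 r \<inter> drawing \<noteq> {}"
      then obtain p where p: "p \<in> rhombus12 r" "p \<in> drawing" by blast
      from p(2) obtain i j k s where ijk: "i + j + k = 0" "(j - k) mod 3 \<noteq> 0" "0 \<le> s" "s \<le> 1"
        "p = (of_int i + s, of_int j - s, of_int k) \<or> p = (of_int i, of_int j + s, of_int k - s) \<or>
         p = (of_int i - s, of_int j, of_int k + s)" by (rule drawingE)
      from ijk(5) consider "p = (of_int i + s, of_int j - s, of_int k)" | "p = (of_int i, of_int j + s, of_int k - s)" |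
         "p = (of_int i - s, of_int j, of_int k + s)" by blast
      then show False
      proof cases
        case 1
        have "i = r1" "j = r2"
          using p(1) ijk(3,4) int_strip2 int_strip3 unfolding 1(1) by (auto simp: rhombus12_def r)
        moreover from this have "i = r1" "j = r2" "k = r3" using ijk(1) sum0 by linarith+
        ultimately show False using ijk(2) c by simp
      next
        case 2
        then show False using p(1) int_strip1 by (auto simp: rhombus12_def r)
      next
        case 3
        then show False using p(1) int_strip1 by (auto simp: rhombus12_def r)
      qed
    qed
  next
    fix p :: space_point assume p: "p \<in> plane" "r1 \<le> fst p" "fst p \<le> real_of_int r1 + 1" "real_of_int r2 - 1 \<le> (\<lambda>p. fst (snd p)) p" "(\<lambda>p. fst (snd p)) p \<le> r2"
      "fst p = r1 \<or> fst p = real_of_int r1 + 1 \<or> (\<lambda>p. fst (snd p)) p = real_of_int r2 - 1 \<or> (\<lambda>p. fst (snd p)) p = r2"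
    obtain x y z :: real where xyz: "p = (x, y, z)" by (cases p)
    have xs: "x + y + z = 0" using p(1) by (simp add: xyz plane_def)
    note b = p(2-5) [unfolded xyz, simplified]
    from p(6) consider "x = r1" | "x = real_of_int r1 + 1" | "y = real_of_int r2 - 1" | "y = r2"
      by (auto simp: xyz)
    then show "p \<in> drawing"
    proof cases
      case 1
      have *: "(r1) + (r2 - 1) + (r3 + 1) = 0" "((r2 - 1) - (r3 + 1)) mod 3 \<noteq> 0" "0 \<le> 1 - (r2 - y)" "1 - (r2 - y) \<le> 1"
        subgoal using sum0 by linarith
        subgoal by (rule cs)
        subgoal using b by linarith
        subgoal using b by linarith
        done
      show ?thesis unfolding xyz by (rule drawingI23 [OF *]) (use 1 xs sum0' in simp_all)
    next
      case 2
      have *: "(r1 + 1) + (r2 - 1) + (r3) = 0" "((r2 - 1) - (r3)) mod 3 \<noteq> 0" "0 \<le> y - r2 + 1" "y - r2 + 1 \<le> 1"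
        subgoal using sum0 by linarith
        subgoal by (rule cs)
        subgoal using b by linarith
        subgoal using b by linarith
        done
      show ?thesis unfolding xyz by (rule drawingI23 [OF *]) (use 2 xs sum0' in simp_all)
    next
      case 3
      have *: "(r1 + 1) + (r2 - 1) + (r3) = 0" "((r2 - 1) - (r3)) mod 3 \<noteq> 0" "0 \<le> 1 - (x - r1)" "1 - (x - r1) \<le> 1"
        subgoal using sum0 by linarith
        subgoal by (rule cs)
        subgoal using b by linarith
        subgoal using b by linarith
        done
      show ?thesis unfolding xyz by (rule drawingI31 [OF *]) (use 3 xs sum0' in simp_all)
    next
      case 4
      have *: "(r1 + 1) + (r2) + (r3 - 1) = 0" "((r2) - (r3 - 1)) mod 3 \<noteq> 0" "0 \<le> 1 - (x - r1)" "1 - (x - r1) \<le> 1"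
        subgoal using sum0 by linarith
        subgoal by (rule cs)
        subgoal using b by linarith
        subgoal using b by linarith
        done
      show ?thesis unfolding xyz by (rule drawingI31 [OF *]) (use 4 xs sum0' in simp_all)
    qed
  qed
qed

lemma rhombus23_face:
  assumes "r \<in> P0" "color r = 0"
  shows "rhombus23 r \<in> components (plane - drawing)"
proof -
  obtain r1 r2 r3 where r: "r = (r1, r2, r3)" by (cases r)
  have sum0: "r1 + r2 + r3 = 0" and c: "(r2 - r3) mod 3 = 0"
    using assms by (auto simp: r P0_def color_def)
  have sum0': "real_of_int r1 + r2 + r3 = 0" using sum0 by linarith
  note cs = color_shift [OF sum0 c]
  show ?thesis
  proof (rule strips_face [of "(\<lambda>p. fst (snd p))" "(\<lambda>p. snd (snd p))" _ r2 r3])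
    show "linear (\<lambda>p. fst (snd p))" "linear (\<lambda>p. snd (snd p))"
      by (auto intro!: linearI)
    show "rhombus23 r = {p \<in> plane. 0 < (\<lambda>p. fst (snd p)) p - r2 \<and> (\<lambda>p. fst (snd p)) p - r2 < 1 \<and> 0 < r3 - (\<lambda>p. snd (snd p)) p \<and> r3 - (\<lambda>p. snd (snd p)) p < 1}"
      by (auto simp: rhombus23_def r plane_def)
    have "(of_int r1, of_int r2 + 1/2, of_int r3 - 1/2) \<in> rhombus23 r" using sum0' by (simp add: rhombus23_def r)
    then show "rhombus23 r \<noteq> {}" by blast
    show "rhombus23 r \<inter> drawing = {}"
    proof (rule ccontr)
      assume "rhombus23 r \<inter> drawing \<noteq> {}"
      then obtain p where p: "p \<in> rhombus23 r" "p \<in> drawing" by blast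
      from p(2) obtain i j k s where ijk: "i + j + k = 0" "(j - k) mod 3 \<noteq> 0" "0 \<le> s" "s \<le> 1"
        "p = (of_int i + s, of_int j - s, of_int k) \<or> p = (of_int i, of_int j + s, of_int k - s) \<or>
         p = (of_int i - s, of_int j, of_int k + s)" by (rule drawingE)
      from ijk(5) consider "p = (of_int i + s, of_int j - s, of_int k)" | "p = (of_int i, of_int j + s, of_int k - s)" |
         "p = (of_int i - s, of_int j, of_int k + s)" by blast
      then show False
      proof cases
        case 1
        then show False using p(1) int_strip1 by (auto simp: rhombus23_def r)
      next
        case 2
        have "j = r2" "k = r3"
          using p(1) ijk(3,4) int_strip2 int_strip3 unfolding 2(1) by (auto simp: rhombus23_def r)
        moreover from this have "i = r1" "j = r2" "k = r3" using ijk(1) sum0 by linarith+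
        ultimately show False using ijk(2) c by simp
      next
        case 3
        then show False using p(1) int_strip1 by (auto simp: rhombus23_def r)
      qed
    qed
  next
    fix p :: space_point assume p: "p \<in> plane" "r2 \<le> (\<lambda>p. fst (snd p)) p" "(\<lambda>p. fst (snd p)) p \<le> real_of_int r2 + 1" "real_of_int r3 - 1 \<le> (\<lambda>p. snd (snd p)) p" "(\<lambda>p. snd (snd p)) p \<le> r3"
      "(\<lambda>p. fst (snd p)) p = r2 \<or> (\<lambda>p. fst (snd p)) p = real_of_int r2 + 1 \<or> (\<lambda>p. snd (snd p)) p = real_of_int r3 - 1 \<or> (\<lambda>p. snd (snd p)) p = r3"
    obtain x y z :: real where xyz: "p = (x, y, z)" by (cases p)
    have xs: "x + y + z = 0" using p(1) by (simp add: xyz plane_def)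
    note b = p(2-5) [unfolded xyz, simplified]
    from p(6) consider "y = r2" | "y = real_of_int r2 + 1" | "z = real_of_int r3 - 1" | "z = r3"
      by (auto simp: xyz)
    then show "p \<in> drawing"
    proof cases
      case 1
      have *: "(r1 + 1) + (r2) + (r3 - 1) = 0" "((r2) - (r3 - 1)) mod 3 \<noteq> 0" "0 \<le> 1 - (r3 - z)" "1 - (r3 - z) \<le> 1"
        subgoal using sum0 by linarith
        subgoal by (rule cs)
        subgoal using b by linarith
        subgoal using b by linarith
        done
      show ?thesis unfolding xyz by (rule drawingI31 [OF *]) (use 1 xs sum0' in simp_all)
    next
      case 2
      have *: "(r1) + (r2 + 1) + (r3 - 1) = 0" "((r2 + 1) - (r3 - 1)) mod 3 \<noteq> 0" "0 \<le> z - r3 + 1" "z - r3 + 1 \<le> 1"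
        subgoal using sum0 by linarith
        subgoal by (rule cs)
        subgoal using b by linarith
        subgoal using b by linarith
        done
      show ?thesis unfolding xyz by (rule drawingI31 [OF *]) (use 2 xs sum0' in simp_all)
    next
      case 3
      have *: "(r1) + (r2 + 1) + (r3 - 1) = 0" "((r2 + 1) - (r3 - 1)) mod 3 \<noteq> 0" "0 \<le> 1 - (y - r2)" "1 - (y - r2) \<le> 1"
        subgoal using sum0 by linarith
        subgoal by (rule cs)
        subgoal using b by linarith
        subgoal using b by linarith
        done
      show ?thesis unfolding xyz by (rule drawingI12 [OF *]) (use 3 xs sum0' in simp_all)
    next
      case 4
      have *: "(r1 - 1) + (r2 + 1) + (r3) = 0" "((r2 + 1) - (r3)) mod 3 \<noteq> 0" "0 \<le> 1 - (y - r2)" "1 - (y - r2) \<le> 1"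
        subgoal using sum0 by linarith
        subgoal by (rule cs)
        subgoal using b by linarith
        subgoal using b by linarith
        done
      show ?thesis unfolding xyz by (rule drawingI12 [OF *]) (use 4 xs sum0' in simp_all)
    qed
  qed
qed

lemma rhombus31_face:
  assumes "r \<in> P0" "color r = 0"
  shows "rhombus31 r \<in> components (plane - drawing)"
proof -
  obtain r1 r2 r3 where r: "r = (r1, r2, r3)" by (cases r)
  have sum0: "r1 + r2 + r3 = 0" and c: "(r2 - r3) mod 3 = 0"
    using assms by (auto simp: r P0_def color_def)
  have sum0': "real_of_int r1 + r2 + r3 = 0" using sum0 by linarith
  note cs = color_shift [OF sum0 c]
  show ?thesis
  proof (rule strips_face [of "(\<lambda>p. snd (snd p))" "fst" _ r3 r1])
    show "linear (\<lambda>p. snd (snd p))" "linear fst"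
      by (auto intro!: linearI)
    show "rhombus31 r = {p \<in> plane. 0 < (\<lambda>p. snd (snd p)) p - r3 \<and> (\<lambda>p. snd (snd p)) p - r3 < 1 \<and> 0 < r1 - fst p \<and> r1 - fst p < 1}"
      by (auto simp: rhombus31_def r plane_def)
    have "(of_int r1 - 1/2, of_int r2, of_int r3 + 1/2) \<in> rhombus31 r" using sum0' by (simp add: rhombus31_def r)
    then show "rhombus31 r \<noteq> {}" by blast
    show "rhombus31 r \<inter> drawing = {}"
    proof (rule ccontr)
      assume "rhombus31 r \<inter> drawing \<noteq> {}"
      then obtain p where p: "p \<in> rhombus31 r" "p \<in> drawing" by blast
      from p(2) obtain i j k s where ijk: "i + j + k = 0" "(j - k) mod 3 \<noteq> 0" "0 \<le> s" "s \<le> 1"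
        "p = (of_int i + s, of_int j - s, of_int k) \<or> p = (of_int i, of_int j + s, of_int k - s) \<or>
         p = (of_int i - s, of_int j, of_int k + s)" by (rule drawingE)
      from ijk(5) consider "p = (of_int i + s, of_int j - s, of_int k)" | "p = (of_int i, of_int j + s, of_int k - s)" |
         "p = (of_int i - s, of_int j, of_int k + s)" by blast
      then show False
      proof cases
        case 1
        then show False using p(1) int_strip1 by (auto simp: rhombus31_def r)
      next
        case 2
        then show False using p(1) int_strip1 by (auto simp: rhombus31_def r)
      next
        case 3
        have "k = r3" "i = r1"
          using p(1) ijk(3,4) int_strip2 int_strip3 unfolding 3(1) by (auto simp: rhombus31_def r)
        moreover from this have "i = r1" "j = r2" "k = r3" using ijk(1) sum0 by linarith+
        ultimately show False using ijk(2) c by simp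
      qed
    qed
  next
    fix p :: space_point assume p: "p \<in> plane" "r3 \<le> (\<lambda>p. snd (snd p)) p" "(\<lambda>p. snd (snd p)) p \<le> real_of_int r3 + 1" "real_of_int r1 - 1 \<le> fst p" "fst p \<le> r1"
      "(\<lambda>p. snd (snd p)) p = r3 \<or> (\<lambda>p. snd (snd p)) p = real_of_int r3 + 1 \<or> fst p = real_of_int r1 - 1 \<or> fst p = r1"
    obtain x y z :: real where xyz: "p = (x, y, z)" by (cases p)
    have xs: "x + y + z = 0" using p(1) by (simp add: xyz plane_def)
    note b = p(2-5) [unfolded xyz, simplified]
    from p(6) consider "z = r3" | "z = real_of_int r3 + 1" | "x = real_of_int r1 - 1" | "x = r1"
      by (auto simp: xyz)
    then show "p \<in> drawing"
    proof cases
      case 1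
      have *: "(r1 - 1) + (r2 + 1) + (r3) = 0" "((r2 + 1) - (r3)) mod 3 \<noteq> 0" "0 \<le> 1 - (r1 - x)" "1 - (r1 - x) \<le> 1"
        subgoal using sum0 by linarith
        subgoal by (rule cs)
        subgoal using b by linarith
        subgoal using b by linarith
        done
      show ?thesis unfolding xyz by (rule drawingI12 [OF *]) (use 1 xs sum0' in simp_all)
    next
      case 2
      have *: "(r1 - 1) + (r2) + (r3 + 1) = 0" "((r2) - (r3 + 1)) mod 3 \<noteq> 0" "0 \<le> x - r1 + 1" "x - r1 + 1 \<le> 1"
        subgoal using sum0 by linarith
        subgoal by (rule cs)
        subgoal using b by linarith
        subgoal using b by linarith
        done
      show ?thesis unfolding xyz by (rule drawingI12 [OF *]) (use 2 xs sum0' in simp_all)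
    next
      case 3
      have *: "(r1 - 1) + (r2) + (r3 + 1) = 0" "((r2) - (r3 + 1)) mod 3 \<noteq> 0" "0 \<le> 1 - (z - r3)" "1 - (z - r3) \<le> 1"
        subgoal using sum0 by linarith
        subgoal by (rule cs)
        subgoal using b by linarith
        subgoal using b by linarith
        done
      show ?thesis unfolding xyz by (rule drawingI23 [OF *]) (use 3 xs sum0' in simp_all)
    next
      case 4
      have *: "(r1) + (r2 - 1) + (r3 + 1) = 0" "((r2 - 1) - (r3 + 1)) mod 3 \<noteq> 0" "0 \<le> 1 - (z - r3)" "1 - (z - r3) \<le> 1"
        subgoal using sum0 by linarith
        subgoal by (rule cs)
        subgoal using b by linarith
        subgoal using b by linarith
        done
      show ?thesis unfolding xyz by (rule drawingI23 [OF *]) (use 4 xs sum0' in simp_all)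
    qed
  qed
qed

lemma rhombus_exhaust:
  assumes "p \<in> plane" "p \<notin> drawing"
  obtains r where "r \<in> P0" "color r = 0" "p \<in> rhombus12 r \<or> p \<in> rhombus23 r \<or> p \<in> rhombus31 r"
proof -
  obtain x y z :: real where xyz: "p = (x, y, z)" by (cases p)
  have xs: "x + y + z = 0" using assms(1) by (simp add: xyz plane_def)
  define m n where "m = \<lfloor>x\<rfloor>" and "n = \<lfloor>y\<rfloor>"
  define a b where "a = x - m" and "b = y - n"
  have ab: "0 \<le> a" "a < 1" "0 \<le> b" "b < 1" by (simp_all add: a_def b_def m_def n_def) linarith+
  have x: "x = m + a" and y: "y = n + b" and z: "z = - m - n - a - b"
    using xs by (simp_all add: a_def b_def)
  have lat: "i + j + k = 0 \<Longrightarrow> (j - k) mod 3 = 0 \<Longrightarrow> (i, j, k) \<in> P0 \<and> color (i, j, k) = 0" for i j k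
    by (simp add: P0_def color_def)
  have nd: "(x, y, z) \<notin> drawing" using assms(2) xyz by simp
  consider "(m - n) mod 3 = 0" | "(m - n) mod 3 = 1" | "(m - n) mod 3 = 2" by linarith
  then show thesis
  proof cases
    case 1
    have c: "(m - n) mod 3 = 0" by fact
    show thesis
    proof (cases "a + b < 1")
      case ab1: True
      have ne_b: "\<not> b = 0"
      proof
        assume h: "b = 0"
        have m3: "((n) - (- m - n - 1)) mod 3 \<noteq> 0" using c by presburger
        have "(x, y, z) \<in> drawing"
          by (rule drawingI31 [of "m + 1" "n" "- m - n - 1" "1 - a", OF _ m3]) (use h ab x y z in auto)
        with nd show False ..
      qed
      have m3: "((n) - (- m - n)) mod 3 = 0" using c by presburger
      have "(x, y, z) \<in> rhombus23 (m, n, - m - n)"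
        unfolding rhombus23_def using ab1 ab x y z ne_b by auto
      then show thesis using that [of "(m, n, - m - n)"] lat [OF _ m3] xyz by simp
    next
      case ab1: False
      have ne_u: "\<not> a + b = 1"
      proof
        assume h: "a + b = 1"
        have m3: "((n + 1) - (- m - n - 1)) mod 3 \<noteq> 0" using c by presburger
        have "(x, y, z) \<in> drawing"
          by (rule drawingI12 [of "m" "n + 1" "- m - n - 1" "a", OF _ m3]) (use h ab x y z in auto)
        with nd show False ..
      qed
      have m3: "((n + 1) - (- m - n - 2)) mod 3 = 0" using c by presburger
      have "(x, y, z) \<in> rhombus31 (m + 1, n + 1, - m - n - 2)"
        unfolding rhombus31_def using ab1 ab x y z ne_u by auto
      then show thesis using that [of "(m + 1, n + 1, - m - n - 2)"] lat [OF _ m3] xyz by simp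
    qed
  next
    case 2
    have c: "(m - n) mod 3 = 1" by fact
    show thesis
    proof (cases "a + b < 1")
      case ab1: True
      have ne_a: "\<not> a = 0"
      proof
        assume h: "a = 0"
        have m3: "((n) - (- m - n)) mod 3 \<noteq> 0" using c by presburger
        have "(x, y, z) \<in> drawing"
          by (rule drawingI23 [of "m" "n" "- m - n" "b", OF _ m3]) (use h ab x y z in auto)
        with nd show False ..
      qed
      have ne_b: "\<not> b = 0"
      proof
        assume h: "b = 0"
        have m3: "((n) - (- m - n - 1)) mod 3 \<noteq> 0" using c by presburger
        have "(x, y, z) \<in> drawing"
          by (rule drawingI31 [of "m + 1" "n" "- m - n - 1" "1 - a", OF _ m3]) (use h ab x y z in auto)
        with nd show False ..
      qed
      have m3: "((n + 1) - (- m - n - 1)) mod 3 = 0" using c by presburger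
      have "(x, y, z) \<in> rhombus12 (m, n + 1, - m - n - 1)"
        unfolding rhombus12_def using ab1 ab x y z ne_a ne_b by auto
      then show thesis using that [of "(m, n + 1, - m - n - 1)"] lat [OF _ m3] xyz by simp
    next
      case ab1: False
      have m3: "((n + 1) - (- m - n - 1)) mod 3 = 0" using c by presburger
      have "(x, y, z) \<in> rhombus12 (m, n + 1, - m - n - 1)"
        unfolding rhombus12_def using ab1 ab x y z  by auto
      then show thesis using that [of "(m, n + 1, - m - n - 1)"] lat [OF _ m3] xyz by simp
    qed
  next
    case 3
    have c: "(m - n) mod 3 = 2" by fact
    show thesis
    proof (cases "a + b < 1")
      case ab1: True
      have ne_a: "\<not> a = 0"
      proof
        assume h: "a = 0"
        have m3: "((n) - (- m - n)) mod 3 \<noteq> 0" using c by presburger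
        have "(x, y, z) \<in> drawing"
          by (rule drawingI23 [of "m" "n" "- m - n" "b", OF _ m3]) (use h ab x y z in auto)
        with nd show False ..
      qed
      have m3: "((n) - (- m - n - 1)) mod 3 = 0" using c by presburger
      have "(x, y, z) \<in> rhombus31 (m + 1, n, - m - n - 1)"
        unfolding rhombus31_def using ab1 ab x y z ne_a by auto
      then show thesis using that [of "(m + 1, n, - m - n - 1)"] lat [OF _ m3] xyz by simp
    next
      case ab1: False
      have ne_u: "\<not> a + b = 1"
      proof
        assume h: "a + b = 1"
        have m3: "((n + 1) - (- m - n - 1)) mod 3 \<noteq> 0" using c by presburger
        have "(x, y, z) \<in> drawing"
          by (rule drawingI12 [of "m" "n + 1" "- m - n - 1" "a", OF _ m3]) (use h ab x y z in auto)
        with nd show False ..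
      qed
      have m3: "((n) - (- m - n - 1)) mod 3 = 0" using c by presburger
      have "(x, y, z) \<in> rhombus23 (m + 1, n, - m - n - 1)"
        unfolding rhombus23_def using ab1 ab x y z ne_u by auto
      then show thesis using that [of "(m + 1, n, - m - n - 1)"] lat [OF _ m3] xyz by simp
    qed
  qed
qed

lemma components_eq:
  "components (plane - drawing) =
     (\<Union>r\<in>{r \<in> P0. color r = 0}. {rhombus12 r, rhombus23 r, rhombus31 r})" (is "?C = ?R")
proof
  show R: "?R \<subseteq> ?C" using rhombus12_face rhombus23_face rhombus31_face by blast
  show "?C \<subseteq> ?R"
  proof
    fix C assume C: "C \<in> ?C"
    then obtain p where p: "p \<in> C" using in_components_nonempty by blast
    then have "p \<in> plane" "p \<notin> drawing" using in_components_subset [OF C] by auto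
    then obtain R where "R \<in> ?R" "p \<in> R" by (rule rhombus_exhaust) blast
    then show "C \<in> ?R" using R C p components_nonoverlap [of C "plane - drawing" R] by blast
  qed
qed

lemma closure_rhombus_corner:
  fixes w c :: space_point
  assumes "\<And>s. 0 < s \<Longrightarrow> s \<le> 1 \<Longrightarrow> (1 - s) *\<^sub>R w + s *\<^sub>R c \<in> R"
  shows "w \<in> closure R"
proof -
  let ?f = "\<lambda>s. (1 - s) *\<^sub>R w + s *\<^sub>R c"
  have "?f ` closure {0<..1::real} \<subseteq> closure R"
  proof (rule image_closure_subset)
    show "continuous_on (closure {0<..1}) ?f" by (intro continuous_intros)
    show "?f ` {0<..1} \<subseteq> closure R" using assms closure_subset by fastforce
  qed simp
  moreover have "0 \<in> closure {0<..1::real}" by (simp add: closure_greaterThanAtMost)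
  ultimately have "?f 0 \<in> closure R" by blast
  then show ?thesis by simp
qed

lemma loz_verts_rhombus12:
  assumes "r \<in> P0"
  shows "loz_verts (rhombus12 r) = {r, r + e12, r - e23, r - e31}"
proof -
  obtain r1 r2 r3 where r: "r = (r1, r2, r3)" by (cases r)
  have sum0: "r1 + r2 + r3 = 0" using assms by (auto simp: r P0_def)
  have sum0': "real_of_int r1 + real_of_int r2 + real_of_int r3 = 0" using sum0 by linarith
  let ?V = "{(r1, r2, r3), (r1 + 1, r2 - 1, r3), (r1, r2 - 1, r3 + 1), (r1 + 1, r2, r3 - 1)}"
  define K :: "space_point set" where
    "K = {p. of_int r1 \<le> fst p \<and> fst p \<le> of_int r1 + 1 \<and> of_int r2 - 1 \<le> fst (snd p) \<and> fst (snd p) \<le> of_int r2}"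
  have "closed K" unfolding K_def by (intro closed_Collect_conj closed_Collect_le continuous_intros)
  moreover have "rhombus12 r \<subseteq> K" by (auto simp: rhombus12_def r K_def)
  ultimately have cl: "closure (rhombus12 r) \<subseteq> K" by (rule closure_minimal [rotated])
  have "u \<in> ?V" if u: "u \<in> loz_verts (rhombus12 r)" for u
  proof -
    obtain i j k where ijk: "u = (i, j, k)" by (cases u)
    have s: "i + j + k = 0" and "embed u \<in> K" using u cl by (auto simp: loz_verts_def ijk P0_def)
    then have "r1 \<le> i" "i \<le> r1 + 1" "r2 - 1 \<le> j" "j \<le> r2"
      unfolding K_def embed_def ijk by auto
    then have "(i = r1 \<or> i = r1 + 1) \<and> (j = r2 - 1 \<or> j = r2)" by linarith
    then show ?thesis using s sum0 unfolding ijk by auto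
  qed
  moreover have "u \<in> loz_verts (rhombus12 r)" if u: "u \<in> ?V" for u
  proof -
    have "embed u \<in> closure (rhombus12 r)"
    proof (rule closure_rhombus_corner [where c = "(of_int r1 + 1/2, of_int r2 - 1/2, of_int r3)"])
      fix s :: real assume "0 < s" "s \<le> 1"
      with u sum0' show "(1 - s) *\<^sub>R embed u + s *\<^sub>R (of_int r1 + 1/2, of_int r2 - 1/2, of_int r3) \<in> rhombus12 r"
        by (auto simp: rhombus12_def r embed_def algebra_simps)
    qed
    then show ?thesis using u sum0 by (auto simp: loz_verts_def P0_def)
  qed
  ultimately have "loz_verts (rhombus12 r) = ?V" by blast
  then show ?thesis by (simp add: r e12_def e23_def e31_def)
qed

lemma bounded_rhombus12: "bounded (rhombus12 r)"
proof -
  obtain r1 r2 r3 where r: "r = (r1, r2, r3)" by (cases r)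
  have "rhombus12 r \<subseteq> cbox (of_int r1, of_int r2 - 1, - of_int r1 - of_int r2 - 1) (of_int r1 + 1, of_int r2, - of_int r1 - of_int r2 + 1)"
    by (auto simp: rhombus12_def r cbox_Pair_eq)
  then show ?thesis using bounded_cbox bounded_subset by blast
qed

lemma loz_verts_rhombus23:
  assumes "r \<in> P0"
  shows "loz_verts (rhombus23 r) = {r, r + e23, r - e31, r - e12}"
proof -
  obtain r1 r2 r3 where r: "r = (r1, r2, r3)" by (cases r)
  have sum0: "r1 + r2 + r3 = 0" using assms by (auto simp: r P0_def)
  have sum0': "real_of_int r1 + real_of_int r2 + real_of_int r3 = 0" using sum0 by linarith
  let ?V = "{(r1, r2, r3), (r1, r2 + 1, r3 - 1), (r1 + 1, r2, r3 - 1), (r1 - 1, r2 + 1, r3)}"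
  define K :: "space_point set" where
    "K = {p. of_int r2 \<le> fst (snd p) \<and> fst (snd p) \<le> of_int r2 + 1 \<and> of_int r3 - 1 \<le> snd (snd p) \<and> snd (snd p) \<le> of_int r3}"
  have "closed K" unfolding K_def by (intro closed_Collect_conj closed_Collect_le continuous_intros)
  moreover have "rhombus23 r \<subseteq> K" by (auto simp: rhombus23_def r K_def)
  ultimately have cl: "closure (rhombus23 r) \<subseteq> K" by (rule closure_minimal [rotated])
  have "u \<in> ?V" if u: "u \<in> loz_verts (rhombus23 r)" for u
  proof -
    obtain i j k where ijk: "u = (i, j, k)" by (cases u)
    have s: "i + j + k = 0" and "embed u \<in> K" using u cl by (auto simp: loz_verts_def ijk P0_def)
    then have "r2 \<le> j" "j \<le> r2 + 1" "r3 - 1 \<le> k" "k \<le> r3"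
      unfolding K_def embed_def ijk by auto
    then have "(j = r2 \<or> j = r2 + 1) \<and> (k = r3 - 1 \<or> k = r3)" by linarith
    then show ?thesis using s sum0 unfolding ijk by auto
  qed
  moreover have "u \<in> loz_verts (rhombus23 r)" if u: "u \<in> ?V" for u
  proof -
    have "embed u \<in> closure (rhombus23 r)"
    proof (rule closure_rhombus_corner [where c = "(of_int r1, of_int r2 + 1/2, of_int r3 - 1/2)"])
      fix s :: real assume "0 < s" "s \<le> 1"
      with u sum0' show "(1 - s) *\<^sub>R embed u + s *\<^sub>R (of_int r1, of_int r2 + 1/2, of_int r3 - 1/2) \<in> rhombus23 r"
        by (auto simp: rhombus23_def r embed_def algebra_simps)
    qed
    then show ?thesis using u sum0 by (auto simp: loz_verts_def P0_def)
  qed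
  ultimately have "loz_verts (rhombus23 r) = ?V" by blast
  then show ?thesis by (simp add: r e12_def e23_def e31_def)
qed

lemma bounded_rhombus23: "bounded (rhombus23 r)"
proof -
  obtain r1 r2 r3 where r: "r = (r1, r2, r3)" by (cases r)
  have "rhombus23 r \<subseteq> cbox (- of_int r2 - of_int r3 - 1, of_int r2, of_int r3 - 1) (- of_int r2 - of_int r3 + 1, of_int r2 + 1, of_int r3)"
    by (auto simp: rhombus23_def r cbox_Pair_eq)
  then show ?thesis using bounded_cbox bounded_subset by blast
qed

lemma loz_verts_rhombus31:
  assumes "r \<in> P0"
  shows "loz_verts (rhombus31 r) = {r, r + e31, r - e12, r - e23}"
proof -
  obtain r1 r2 r3 where r: "r = (r1, r2, r3)" by (cases r)
  have sum0: "r1 + r2 + r3 = 0" using assms by (auto simp: r P0_def)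
  have sum0': "real_of_int r1 + real_of_int r2 + real_of_int r3 = 0" using sum0 by linarith
  let ?V = "{(r1, r2, r3), (r1 - 1, r2, r3 + 1), (r1 - 1, r2 + 1, r3), (r1, r2 - 1, r3 + 1)}"
  define K :: "space_point set" where
    "K = {p. of_int r3 \<le> snd (snd p) \<and> snd (snd p) \<le> of_int r3 + 1 \<and> of_int r1 - 1 \<le> fst p \<and> fst p \<le> of_int r1}"
  have "closed K" unfolding K_def by (intro closed_Collect_conj closed_Collect_le continuous_intros)
  moreover have "rhombus31 r \<subseteq> K" by (auto simp: rhombus31_def r K_def)
  ultimately have cl: "closure (rhombus31 r) \<subseteq> K" by (rule closure_minimal [rotated])
  have "u \<in> ?V" if u: "u \<in> loz_verts (rhombus31 r)" for u
  proof -
    obtain i j k where ijk: "u = (i, j, k)" by (cases u)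
    have s: "i + j + k = 0" and "embed u \<in> K" using u cl by (auto simp: loz_verts_def ijk P0_def)
    then have "r3 \<le> k" "k \<le> r3 + 1" "r1 - 1 \<le> i" "i \<le> r1"
      unfolding K_def embed_def ijk by auto
    then have "(k = r3 \<or> k = r3 + 1) \<and> (i = r1 - 1 \<or> i = r1)" by linarith
    then show ?thesis using s sum0 unfolding ijk by auto
  qed
  moreover have "u \<in> loz_verts (rhombus31 r)" if u: "u \<in> ?V" for u
  proof -
    have "embed u \<in> closure (rhombus31 r)"
    proof (rule closure_rhombus_corner [where c = "(of_int r1 - 1/2, of_int r2, of_int r3 + 1/2)"])
      fix s :: real assume "0 < s" "s \<le> 1"
      with u sum0' show "(1 - s) *\<^sub>R embed u + s *\<^sub>R (of_int r1 - 1/2, of_int r2, of_int r3 + 1/2) \<in> rhombus31 r"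
        by (auto simp: rhombus31_def r embed_def algebra_simps)
    qed
    then show ?thesis using u sum0 by (auto simp: loz_verts_def P0_def)
  qed
  ultimately have "loz_verts (rhombus31 r) = ?V" by blast
  then show ?thesis by (simp add: r e12_def e23_def e31_def)
qed

lemma bounded_rhombus31: "bounded (rhombus31 r)"
proof -
  obtain r1 r2 r3 where r: "r = (r1, r2, r3)" by (cases r)
  have "rhombus31 r \<subseteq> cbox (of_int r1 - 1, - of_int r3 - of_int r1 - 1, of_int r3) (of_int r1, - of_int r3 - of_int r1 + 1, of_int r3 + 1)"
    by (auto simp: rhombus31_def r cbox_Pair_eq)
  then show ?thesis using bounded_cbox bounded_subset by blast
qed

lemma lozenges_eq:
  "lozenges = (\<Union>r\<in>{r \<in> P0. color r = 0}. {rhombus12 r, rhombus23 r, rhombus31 r})"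
  unfolding lozenges_def components_eq
  using bounded_rhombus12 bounded_rhombus23 bounded_rhombus31 by blast

lemma color_steps:
  assumes "color r = 0"
  shows "color (r + e12) = 2" "color (r + e23) = 2" "color (r + e31) = 2"
    "color (r - e12) = 1" "color (r - e23) = 1" "color (r - e31) = 1"
proof -
  obtain i j k where r: "r = (i, j, k)" by (cases r)
  have "(j - k) mod 3 = 0" using assms by (simp add: color_def r)
  then obtain q where q: "j = k + 3 * q" by (metis add.commute diff_add_cancel mod_0_imp_dvd dvdE)
  show "color (r + e12) = 2" "color (r + e23) = 2" "color (r + e31) = 2"
    "color (r - e12) = 1" "color (r - e23) = 1" "color (r - e31) = 1"
    unfolding color_def r e12_def e23_def e31_def q by (simp_all, presburger+)
qed

lemma rhombus12_labels:
  assumes "r \<in> P0" "color r = 0"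
  shows "red_vert (rhombus12 r) = r" "blue_vert (rhombus12 r) = r + e12"
    "green_verts (rhombus12 r) = {r - e23, r - e31}"
    "b_vert (rhombus12 r) = r" "d_vert (rhombus12 r) = r + e12" "ac_verts (rhombus12 r) = {r - e23, r - e31}"
proof -
  note V = loz_verts_rhombus12 [OF assms(1)]
  note cs = color_steps [OF assms(2)]
  show red: "red_vert (rhombus12 r) = r" and blue: "blue_vert (rhombus12 r) = r + e12"
    unfolding red_vert_def blue_vert_def V using assms(2) cs by (auto intro!: the_equality)
  show "green_verts (rhombus12 r) = {r - e23, r - e31}"
    unfolding green_verts_def V using assms(2) cs by auto
  show b: "b_vert (rhombus12 r) = r" and d: "d_vert (rhombus12 r) = r + e12"
    unfolding b_vert_def d_vert_def red blue by (simp_all add: e12_def e23_def e31_def)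
  show "ac_verts (rhombus12 r) = {r - e23, r - e31}"
    unfolding ac_verts_def b d V by (cases r) (simp add: e12_def e23_def e31_def insert_Diff_if insert_commute)
qed

lemma rhombus23_labels:
  assumes "r \<in> P0" "color r = 0"
  shows "red_vert (rhombus23 r) = r" "blue_vert (rhombus23 r) = r + e23"
    "green_verts (rhombus23 r) = {r - e31, r - e12}"
    "b_vert (rhombus23 r) = r + e23" "d_vert (rhombus23 r) = r" "ac_verts (rhombus23 r) = {r - e31, r - e12}"
proof -
  note V = loz_verts_rhombus23 [OF assms(1)]
  note cs = color_steps [OF assms(2)]
  show red: "red_vert (rhombus23 r) = r" and blue: "blue_vert (rhombus23 r) = r + e23"
    unfolding red_vert_def blue_vert_def V using assms(2) cs by (auto intro!: the_equality)
  show "green_verts (rhombus23 r) = {r - e31, r - e12}"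
    unfolding green_verts_def V using assms(2) cs by auto
  show b: "b_vert (rhombus23 r) = r + e23" and d: "d_vert (rhombus23 r) = r"
    unfolding b_vert_def d_vert_def red blue by (simp_all add: e12_def e23_def e31_def)
  show "ac_verts (rhombus23 r) = {r - e31, r - e12}"
    unfolding ac_verts_def b d V by (cases r) (simp add: e12_def e23_def e31_def insert_Diff_if insert_commute)
qed

lemma rhombus31_labels:
  assumes "r \<in> P0" "color r = 0"
  shows "red_vert (rhombus31 r) = r" "blue_vert (rhombus31 r) = r + e31"
    "green_verts (rhombus31 r) = {r - e12, r - e23}"
    "b_vert (rhombus31 r) = r - e12" "d_vert (rhombus31 r) = r - e23" "ac_verts (rhombus31 r) = {r, r + e31}"
proof -
  note V = loz_verts_rhombus31 [OF assms(1)]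
  note cs = color_steps [OF assms(2)]
  show red: "red_vert (rhombus31 r) = r" and blue: "blue_vert (rhombus31 r) = r + e31"
    unfolding red_vert_def blue_vert_def V using assms(2) cs by (auto intro!: the_equality)
  show "green_verts (rhombus31 r) = {r - e12, r - e23}"
    unfolding green_verts_def V using assms(2) cs by auto
  show b: "b_vert (rhombus31 r) = r - e12" and d: "d_vert (rhombus31 r) = r - e23"
    unfolding b_vert_def d_vert_def red blue by (simp_all add: e12_def e23_def e31_def)
  show "ac_verts (rhombus31 r) = {r, r + e31}"
    unfolding ac_verts_def b d V by (cases r) (simp add: e12_def e23_def e31_def insert_Diff_if insert_commute)
qed



end

theory Submission
  imports Defs
begin

text \<open>
  A rooted forest with root set \<open>R0\<close> amounts to a bijection \<open>f\<close> from the non-root vertices to the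
  lozenges with \<open>u \<in> f u\<close>: the edge leaving \<open>u\<close> is the diagonal of \<open>f u\<close> through \<open>u\<close>.  The
  points \<open>a\<^sub>2\<^sub>i\<close> and \<open>c\<^sub>n\<close> are not the lower corner \<open>d\<^sub>L\<close> of any lozenge, every other vertex of exactly one.
  Hence the arcs \<open>u \<rightarrow> e\<^sub>L \<rightarrow> d\<^sub>L\<close>, for \<open>L = f u\<close> and \<open>u \<noteq> d\<^sub>L\<close>, form vertex-disjoint paths from the
  \<open>a\<^sub>2\<^sub>i\<close> to the roots that are lower corners, which are \<open>b\<^sub>1, \<dots>, b\<^sub>t\<^sub>-\<^sub>1\<close>; and \<open>f\<close> is recovered from the
  paths by letting \<open>f u\<close> be the lozenge below \<open>u\<close> on its path, and the lozenge with \<open>d\<^sub>L = u\<close> if there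
  is no arc leaving \<open>u\<close>.  Two planarity arguments remain.

  Which end belongs to which start: the number of times a path crosses the horizontal ray to the
  right of \<open>q\<close> does not change when \<open>q\<close> moves along a disjoint path, so disjoint paths keep their
  left-to-right order.

  Every bijection \<open>f\<close> is acyclic: green vertices are connected only to green ones, and a green
  cycle has a winding number around each red or blue vertex (and vice versa).  It is
  constant along the edges of the forest, as these do not cross the cycle, and vanishes at the
  roots.  So the vertices of nonzero winding number are closed under passing to the successor and
  contain a cycle of the other kind with a smaller maximal height, and infinite descent applies.
\<close>

section \<open>Coordinates for the lozenges\<close>

text \<open>The green edges and the red-blue edges behave like two plane graphs dual to each other:
  each lozenge carries one edge of each kind, and these two cross, while edges in different lozenges
  do not. All of this is expressed by comparing integers. A diagonal either stays in one column or
  passes exactly one, at the mean height of its ends, so columns and heights suffice to decide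
  whether it meets a vertical ray. Both planarity arguments rest on the same device. When the origin
  of a ray moves along an edge, the crossing number of any other edge from u to w changes by
  [w in S] - [u in S], where S is the set of vertices between the old and the new ray. Such terms
  cancel over a set that the successor map permutes and telescope along a path. A winding number is
  nonzero somewhere for a local reason: the ends of the dual of a flat edge of the cycle are
  separated by that edge alone, because \<open>f\<close> puts no second edge into its
  lozenge.\<close>

lemma Delta_eq:
  assumes "(v1, v2, v3) \<in> P0" "t > 0"
  shows "Delta (v1, v2, v3) t = {(x, y, z). x + y + z = 0 \<and>
    (x - of_int v1) - (z - of_int v3) \<le> real t \<and> (y - of_int v2) - (x - of_int v1) \<le> real t \<and>
    (z - of_int v3) - (y - of_int v2) \<le> real t}" (is "_ = ?D")
proof -
  have v0: "real_of_int v1 + of_int v2 + of_int v3 = 0"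
    using assms(1) unfolding P0_def by (auto simp flip: of_int_add)
  have hull: "Delta (v1, v2, v3) t = {\<alpha> *\<^sub>R (of_int v1 + real t, of_int v2 - real t, of_int v3)
      + \<beta> *\<^sub>R (of_int v1, of_int v2 + real t, of_int v3 - real t)
      + \<gamma> *\<^sub>R (of_int v1 - real t, of_int v2, of_int v3 + real t) |
      \<alpha> \<beta> \<gamma>. 0 \<le> \<alpha> \<and> 0 \<le> \<beta> \<and> 0 \<le> \<gamma> \<and> \<alpha> + \<beta> + \<gamma> = 1}"
    unfolding Delta_def image_insert image_empty convex_hull_3
    by (simp add: embed_def e12_def e23_def e31_def)
  show ?thesis
  proof (intro equalityI subsetI)
    fix p assume "p \<in> Delta (v1, v2, v3) t"
    then obtain \<alpha> \<beta> \<gamma> where nn: "0 \<le> \<alpha>" "0 \<le> \<beta>" "0 \<le> \<gamma>" and s: "\<alpha> + \<beta> + \<gamma> = 1"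
      and p: "p = \<alpha> *\<^sub>R (of_int v1 + real t, of_int v2 - real t, of_int v3)
      + \<beta> *\<^sub>R (of_int v1, of_int v2 + real t, of_int v3 - real t)
      + \<gamma> *\<^sub>R (of_int v1 - real t, of_int v2, of_int v3 + real t)"
      unfolding hull by blast
    have w: "\<alpha> * w + \<beta> * w + \<gamma> * w = w" for w using s by (metis distrib_right mult_1)
    have p': "p = (of_int v1 + (\<alpha> - \<gamma>) * real t, of_int v2 + (\<beta> - \<alpha>) * real t, of_int v3 + (\<gamma> - \<beta>) * real t)"
      unfolding p using w [of "of_int v1"] w [of "of_int v2"] w [of "of_int v3"]
      by (simp add: algebra_simps)
    have "\<alpha> * real t + \<beta> * real t + \<gamma> * real t = real t" by (rule w)
    moreover have "0 \<le> \<alpha> * real t" "0 \<le> \<beta> * real t" "0 \<le> \<gamma> * real t" using nn by auto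
    ultimately show "p \<in> ?D" unfolding p' using v0 by (simp add: algebra_simps)
  next
    fix p assume "p \<in> ?D"
    then obtain x y z where p: "p = (x, y, z)" and D: "x + y + z = 0"
      "(x - of_int v1) - (z - of_int v3) \<le> real t" "(y - of_int v2) - (x - of_int v1) \<le> real t"
      "(z - of_int v3) - (y - of_int v2) \<le> real t" by blast
    \<comment> \<open>Barycentric coordinates: in units of t, the second minus the first coordinate
      of p - v is \<beta> + \<gamma> - 2 \<alpha> = 1 - 3 \<alpha>, and cyclically. Each inequality
      of the triangle is thus the nonnegativity of one of them.\<close>
    define \<alpha> \<beta> \<gamma> where "\<alpha> = (real t - ((y - of_int v2) - (x - of_int v1))) / (3 * real t)"
      and "\<beta> = (real t - ((z - of_int v3) - (y - of_int v2))) / (3 * real t)"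
      and "\<gamma> = (real t - ((x - of_int v1) - (z - of_int v3))) / (3 * real t)"
    note defs = \<alpha>_def \<beta>_def \<gamma>_def
    have t0: "real t > 0" using assms(2) by simp
    have nn: "0 \<le> \<alpha>" "0 \<le> \<beta>" "0 \<le> \<gamma>" using D t0 by (simp_all add: defs)
    have s: "\<alpha> + \<beta> + \<gamma> = 1" using t0 by (simp add: defs field_simps)
    have T: "\<alpha> * real t = (real t - ((y - of_int v2) - (x - of_int v1))) / 3"
      "\<beta> * real t = (real t - ((z - of_int v3) - (y - of_int v2))) / 3"
      "\<gamma> * real t = (real t - ((x - of_int v1) - (z - of_int v3))) / 3"
      using t0 by (simp_all add: defs)
    have w: "\<alpha> * w + (\<beta> * w + \<gamma> * w) = w" for w using s by (metis distrib_right mult_1 add.assoc)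
    have "p = \<alpha> *\<^sub>R (of_int v1 + real t, of_int v2 - real t, of_int v3)
      + \<beta> *\<^sub>R (of_int v1, of_int v2 + real t, of_int v3 - real t)
      + \<gamma> *\<^sub>R (of_int v1 - real t, of_int v2, of_int v3 + real t)"
      unfolding p using T v0 D(1) w [of "of_int v1"] w [of "of_int v2"] w [of "of_int v3"]
      by (simp add: algebra_simps)
    then show "p \<in> Delta (v1, v2, v3) t" unfolding hull using nn s by blast
  qed
qed

locale lozenge_triangle =
  fixes v :: lattice_point and t :: nat
  assumes v_P0: "v \<in> P0" and t_ge2: "t \<ge> 2" and v_color: "(int t + 1) mod 3 = color v"
begin

text \<open>
  The points of color \<open>1\<close>, \<open>2\<close>, \<open>0\<close> are the projections along \<open>(1, 1, 1)\<close> of the integer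
  points \<open>(a, b, c)\<close> with \<open>a + b + c\<close> equal to \<open>t\<close>, \<open>t - 1\<close>, \<open>t - 2\<close>; the triangle becomes the
  octant \<open>a, b, c \<ge> 0\<close>, and the steps \<open>e31\<close>, \<open>e12\<close>, \<open>e23\<close> increase \<open>a\<close>, \<open>b\<close>, \<open>c\<close>.
\<close>

definition pt :: "int \<Rightarrow> int \<Rightarrow> int \<Rightarrow> lattice_point" where
  "pt a b c = v + (b - a, c - b, a - c)"

lemma pt_e: "pt a b c + e12 = pt a (b + 1) c" "pt a b c + e23 = pt a b (c + 1)"
  "pt a b c + e31 = pt (a + 1) b c" "pt a b c - e12 = pt (a + 1) b (c + 1)"
  "pt a b c - e23 = pt (a + 1) (b + 1) c" "pt a b c - e31 = pt a (b + 1) (c + 1)"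
  by (simp_all add: pt_def e12_def e23_def e31_def prod_eq_iff)

lemma pt_P0: "pt a b c \<in> P0"
  using v_P0 by (auto simp: pt_def P0_def)

lemma pt_eq_iff: "pt a b c = pt a' b' c' \<longleftrightarrow> b - a = b' - a' \<and> c - b = c' - b'"
  by (auto simp: pt_def prod_eq_iff)

lemma color_pt: "color (pt a b c) = (int t + 1 - (a + b + c)) mod 3"
proof -
  obtain v1 v2 v3 where v: "v = (v1, v2, v3)" by (cases v)
  have m: "(int t + 1) mod 3 = (v2 - v3) mod 3" using v_color by (simp add: color_def v)
  have pt: "pt a b c = (v1 + (b - a), v2 + (c - b), v3 + (a - c))" for a b c
    unfolding pt_def by (simp add: v)
  have "v2 + (c - b) - (v3 + (a - c)) = (v2 - v3) - (a + b + c) + c * 3" by simp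
  then show ?thesis unfolding color_def pt using mod_diff_cong [OF m refl, of "a + b + c"]
    by (simp only: prod.case mod_mult_self1)
qed

lemma red_points: "{r \<in> P0. color r = 0} = {pt a b c |a b c. a + b + c = int t - 2}"
proof (intro equalityI subsetI)
  fix r assume r: "r \<in> {r \<in> P0. color r = 0}"
  obtain v1 v2 v3 where v: "v = (v1, v2, v3)" by (cases v)
  obtain i j k where ijk: "r = (i, j, k)" by (cases r)
  have s: "i + j + k = 0" "v1 + v2 + v3 = 0" using r v_P0 by (auto simp: ijk P0_def v)
  have "3 dvd int t + 1 - (v2 - v3)" "3 dvd j - k"
    using v_color r by (simp_all add: color_def v ijk mod_eq_dvd_iff mod_0_imp_dvd)
  then obtain m n where mn: "int t + 1 - (v2 - v3) = 3 * m" "j - k = 3 * n" by (auto elim!: dvdE)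
  \<comment> \<open>Matching the coordinates of \<open>pt\<close> with sum t - 2 forces 3 b = t - 2
    + (i - v1) - (j - v2). The two colour congruences make the right side a multiple of 3, and this
    is its third.\<close>
  define b where "b = m + n - j + v2 - 1"
  have "3 * b = int t - 2 + (i - v1) - (j - v2)" unfolding b_def using mn s by simp
  then have "r = pt (b - (i - v1)) b (b + (j - v2))" "(b - (i - v1)) + b + (b + (j - v2)) = int t - 2"
    using s unfolding pt_def by (auto simp: ijk v)
  then show "r \<in> {pt a b c |a b c. a + b + c = int t - 2}" by blast
next
  fix r assume "r \<in> {pt a b c |a b c. a + b + c = int t - 2}"
  then obtain a b c where "r = pt a b c" "a + b + c = int t - 2" by blast
  then show "r \<in> {r \<in> P0. color r = 0}" by (simp add: pt_P0 color_pt)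
qed

lemma closed_Delta: "closed (Delta v t)"
  unfolding Delta_def by (intro compact_imp_closed finite_imp_compact_convex_hull) simp

text \<open>The red vertex alone decides: with coordinate sum t - 2 the inequality b + c - 2 a <= t
  of the triangle reads 3 a >= -2, hence a >= 0 for integers. Conversely, the other corners arise by
  increasing coordinates.\<close>

lemma rhombus_subset_Delta:
  assumes s: "a + b + c = int t - 2"
  shows "rhombus12 (pt a b c) \<subseteq> Delta v t \<longleftrightarrow> 0 \<le> a \<and> 0 \<le> b \<and> 0 \<le> c"
    and "rhombus23 (pt a b c) \<subseteq> Delta v t \<longleftrightarrow> 0 \<le> a \<and> 0 \<le> b \<and> 0 \<le> c"
    and "rhombus31 (pt a b c) \<subseteq> Delta v t \<longleftrightarrow> 0 \<le> a \<and> 0 \<le> b \<and> 0 \<le> c"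
proof -
  obtain v1 v2 v3 where v: "v = (v1, v2, v3)" by (cases v)
  have pt: "pt a b c = (v1 + (b - a), v2 + (c - b), v3 + (a - c))" for a b c
    unfolding pt_def by (simp add: v)
  have s0: "v1 + v2 + v3 = 0" using v_P0 by (simp add: v P0_def)
  then have v0: "real_of_int v1 + of_int v2 + of_int v3 = 0" by (simp flip: of_int_add)
  have D: "Delta v t = {(x, y, z). x + y + z = 0 \<and>
    (x - of_int v1) - (z - of_int v3) \<le> real t \<and> (y - of_int v2) - (x - of_int v1) \<le> real t \<and>
    (z - of_int v3) - (y - of_int v2) \<le> real t}"
    unfolding v using v_P0 t_ge2 by (intro Delta_eq) (auto simp: v)
  have r: "real_of_int a + of_int b + of_int c = real t - 2" using s by linarith
  have nn: "0 \<le> a \<and> 0 \<le> b \<and> 0 \<le> c" if "L \<subseteq> Delta v t" "pt a b c \<in> loz_verts L" for L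
  proof -
    have "embed (pt a b c) \<in> Delta v t"
      using that closed_Delta closure_minimal unfolding loz_verts_def by blast
    then have "real_of_int (b + c - 2 * a) \<le> real t" "real_of_int (a + c - 2 * b) \<le> real t"
      "real_of_int (a + b - 2 * c) \<le> real t"
      unfolding D embed_def pt by auto
    then show ?thesis using s by linarith
  qed
  show "rhombus12 (pt a b c) \<subseteq> Delta v t \<longleftrightarrow> 0 \<le> a \<and> 0 \<le> b \<and> 0 \<le> c" (is "?l \<longleftrightarrow> ?r")
  proof
    show "?l \<Longrightarrow> ?r" using nn loz_verts_rhombus12 [OF pt_P0] by blast
    show ?l if ?r
    proof
      fix p assume p: "p \<in> rhombus12 (pt a b c)"
      obtain x y z where "p = (x, y, z)" by (cases p)
      with p that show "p \<in> Delta v t" using r v0 unfolding D pt rhombus12_def by simp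
    qed
  qed
  show "rhombus23 (pt a b c) \<subseteq> Delta v t \<longleftrightarrow> 0 \<le> a \<and> 0 \<le> b \<and> 0 \<le> c" (is "?l \<longleftrightarrow> ?r")
  proof
    show "?l \<Longrightarrow> ?r" using nn loz_verts_rhombus23 [OF pt_P0] by blast
    show ?l if ?r
    proof
      fix p assume p: "p \<in> rhombus23 (pt a b c)"
      obtain x y z where "p = (x, y, z)" by (cases p)
      with p that show "p \<in> Delta v t" using r v0 unfolding D pt rhombus23_def by simp
    qed
  qed
  show "rhombus31 (pt a b c) \<subseteq> Delta v t \<longleftrightarrow> 0 \<le> a \<and> 0 \<le> b \<and> 0 \<le> c" (is "?l \<longleftrightarrow> ?r")
  proof
    show "?l \<Longrightarrow> ?r" using nn loz_verts_rhombus31 [OF pt_P0] by blast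
    show ?l if ?r
    proof
      fix p assume p: "p \<in> rhombus31 (pt a b c)"
      obtain x y z where "p = (x, y, z)" by (cases p)
      with p that show "p \<in> Delta v t" using r v0 unfolding D pt rhombus31_def by simp
    qed
  qed
qed

definition cell :: "int \<Rightarrow> int \<Rightarrow> int \<Rightarrow> bool" where
  "cell a b c \<longleftrightarrow> 0 \<le> a \<and> 0 \<le> b \<and> 0 \<le> c \<and> a + b + c = int t - 2"

lemma lozenges_in_eq: "lozenges_in v t =
  {L. \<exists>a b c. cell a b c \<and> L \<in> {rhombus12 (pt a b c), rhombus23 (pt a b c), rhombus31 (pt a b c)}}"
proof (intro equalityI subsetI)
  fix L assume "L \<in> lozenges_in v t"
  then obtain r where r: "r \<in> {r \<in> P0. color r = 0}" and D: "L \<subseteq> Delta v t"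
    and L: "L = rhombus12 r \<or> L = rhombus23 r \<or> L = rhombus31 r"
    unfolding lozenges_in_def lozenges_eq by blast
  from r obtain a b c where abc: "r = pt a b c" "a + b + c = int t - 2"
    unfolding red_points by blast
  then have "cell a b c" using D L rhombus_subset_Delta [OF abc(2)] unfolding cell_def by blast
  then show "L \<in> {L. \<exists>a b c. cell a b c \<and> L \<in> {rhombus12 (pt a b c), rhombus23 (pt a b c), rhombus31 (pt a b c)}}"
    using abc L by blast
next
  fix L assume "L \<in> {L. \<exists>a b c. cell a b c \<and> L \<in> {rhombus12 (pt a b c), rhombus23 (pt a b c), rhombus31 (pt a b c)}}"
  then obtain a b c where c: "cell a b c"
    and L: "L = rhombus12 (pt a b c) \<or> L = rhombus23 (pt a b c) \<or> L = rhombus31 (pt a b c)" by blast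
  have abc: "a + b + c = int t - 2" using c by (simp add: cell_def)
  then have "pt a b c \<in> {r \<in> P0. color r = 0}" unfolding red_points by blast
  moreover have "L \<subseteq> Delta v t" using c L rhombus_subset_Delta [OF abc] unfolding cell_def by blast
  ultimately show "L \<in> lozenges_in v t" using L unfolding lozenges_in_def lozenges_eq by blast
qed

lemma cell_red: "cell a b c \<Longrightarrow> color (pt a b c) = 0"
  by (simp add: cell_def color_pt)

lemmas labels12 = rhombus12_labels [OF pt_P0 cell_red, unfolded pt_e]
lemmas labels23 = rhombus23_labels [OF pt_P0 cell_red, unfolded pt_e]
lemmas labels31 = rhombus31_labels [OF pt_P0 cell_red, unfolded pt_e]
lemmas corners12 = loz_verts_rhombus12 [OF pt_P0, unfolded pt_e]
lemmas corners23 = loz_verts_rhombus23 [OF pt_P0, unfolded pt_e]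
lemmas corners31 = loz_verts_rhombus31 [OF pt_P0, unfolded pt_e]

text \<open>Only the third type has green upper and lower corners. Every lozenge has one green and
  one red-blue diagonal, which is why red and blue form a single class below.\<close>

lemma lozenge_cases [consumes 1, case_names 12 23 31]:
  assumes "L \<in> lozenges_in v t"
  obtains a b c where "cell a b c" "L = rhombus12 (pt a b c)"
      "b_vert L = pt a b c" "d_vert L = pt a (b + 1) c"
      "ac_verts L = {pt (a + 1) (b + 1) c, pt a (b + 1) (c + 1)}"
      "green_verts L = ac_verts L" "{red_vert L, blue_vert L} = {b_vert L, d_vert L}"
      "loz_verts L = {b_vert L, d_vert L} \<union> ac_verts L"
    | a b c where "cell a b c" "L = rhombus23 (pt a b c)"
      "b_vert L = pt a b (c + 1)" "d_vert L = pt a b c"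
      "ac_verts L = {pt a (b + 1) (c + 1), pt (a + 1) b (c + 1)}"
      "green_verts L = ac_verts L" "{red_vert L, blue_vert L} = {b_vert L, d_vert L}"
      "loz_verts L = {b_vert L, d_vert L} \<union> ac_verts L"
    | a b c where "cell a b c" "L = rhombus31 (pt a b c)"
      "b_vert L = pt (a + 1) b (c + 1)" "d_vert L = pt (a + 1) (b + 1) c"
      "ac_verts L = {pt a b c, pt (a + 1) b c}"
      "green_verts L = {b_vert L, d_vert L}" "{red_vert L, blue_vert L} = ac_verts L"
      "loz_verts L = {b_vert L, d_vert L} \<union> ac_verts L"
proof -
  from assms obtain a b c where c: "cell a b c"
    and L: "L \<in> {rhombus12 (pt a b c), rhombus23 (pt a b c), rhombus31 (pt a b c)}"
    unfolding lozenges_in_eq by blast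
  from L consider "L = rhombus12 (pt a b c)" | "L = rhombus23 (pt a b c)" | "L = rhombus31 (pt a b c)" by blast
  then show thesis
  proof cases
    case 1 show thesis by (rule that(1) [OF c 1], simp_all add: 1 labels12 [OF c] corners12, (blast+)?)
  next
    case 2 show thesis by (rule that(2) [OF c 2], simp_all add: 2 labels23 [OF c] corners23, (blast+)?)
  next
    case 3 show thesis by (rule that(3) [OF c 3], simp_all add: 3 labels31 [OF c] corners31, (blast+)?)
  qed
qed

text \<open>Position in the drawing with \<open>e31\<close> horizontal: \<open>X\<close> increases
  against \<open>e31\<close> and counts half edge lengths, \<open>Y\<close> counts rows
  upwards.\<close>

definition X :: "lattice_point \<Rightarrow> int" where "X u = fst u - snd (snd u)"
definition Y :: "lattice_point \<Rightarrow> int" where "Y u = fst (snd u)"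

lemma X_pt: "X (pt a b c) = X v + b + c - 2 * a"
  by (simp add: X_def pt_def)

lemma Y_pt: "Y (pt a b c) = Y v + c - b"
  by (simp add: Y_def pt_def)

lemma green_pt:
  "int t - 2 \<le> a + b + c \<Longrightarrow> a + b + c \<le> int t \<Longrightarrow> color (pt a b c) = 1 \<longleftrightarrow> a + b + c = int t"
  unfolding color_pt by presburger

text \<open>Triples with the same projection differ by a multiple of (1, 1, 1), which changes the
  sum by a multiple of 3; a window of three consecutive sums leaves one representative.\<close>

lemma pt_inj:
  assumes "int t - 2 \<le> a + b + c" "a + b + c \<le> int t" "int t - 2 \<le> a' + b' + c'" "a' + b' + c' \<le> int t"
  shows "pt a b c = pt a' b' c' \<longleftrightarrow> a = a' \<and> b = b' \<and> c = c'"
  using assms unfolding pt_eq_iff by auto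

lemma lozenge_corners [consumes 1, case_names 12 23 31]:
  assumes "L \<in> lozenges_in v t"
  obtains a b c where "cell a b c" "L = rhombus12 (pt a b c)"
      "b_vert L = pt a b c" "d_vert L = pt a (b + 1) c"
      "ac_verts L = {pt (a + 1) (b + 1) c, pt a (b + 1) (c + 1)}"
    | a b c where "cell a b c" "L = rhombus23 (pt a b c)"
      "b_vert L = pt a b (c + 1)" "d_vert L = pt a b c"
      "ac_verts L = {pt (a + 1) b (c + 1), pt a (b + 1) (c + 1)}"
    | a b c where "cell a b c" "L = rhombus31 (pt a b c)"
      "b_vert L = pt (a + 1) b (c + 1)" "d_vert L = pt (a + 1) (b + 1) c"
      "ac_verts L = {pt (a + 1) b c, pt a b c}"
  using assms by (cases L rule: lozenge_cases) (erule that; simp; fail | erule that; auto)+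

lemma diagonals_eq:
  assumes "L \<in> lozenges_in v t" shows "diagonals L = {{b_vert L, d_vert L}, ac_verts L}"
  by (rule lozenge_cases [OF assms]) (simp_all add: diagonals_def insert_commute [of "{_, _}" "{_, _}"])

lemma loz_verts_eq:
  assumes "L \<in> lozenges_in v t" shows "loz_verts L = {b_vert L, d_vert L} \<union> ac_verts L"
  by (rule lozenge_cases [OF assms])

lemma bd_not_ac: "b_vert L \<notin> ac_verts L" "d_vert L \<notin> ac_verts L"
  by (auto simp: ac_verts_def)

lemma Y_b_d:
  assumes "L \<in> lozenges_in v t" shows "Y (d_vert L) < Y (b_vert L)"
  by (rule lozenge_corners [OF assms]) (simp_all add: Y_pt)

lemma ac_vertsE:
  assumes "L \<in> lozenges_in v t"
  obtains p q where "ac_verts L = {p, q}" "X p < X q"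
    "2 * Y (d_vert L) < Y p + Y q" "Y p + Y q < 2 * Y (b_vert L)"
    "X p < X (b_vert L)" "X (b_vert L) < X q" "X p < X (d_vert L)" "X (d_vert L) < X q"
  by (rule lozenge_corners [OF assms]; rule that, assumption) (simp_all add: X_pt Y_pt)

lemma b_vert_inj:
  assumes "L \<in> lozenges_in v t" "L' \<in> lozenges_in v t" "b_vert L = b_vert L'"
  shows "L = L'"
  by (rule lozenge_corners [OF assms(1)]; rule lozenge_corners [OF assms(2)]; insert assms(3))
    (auto simp: pt_inj cell_def)

lemma d_vert_inj:
  assumes "L \<in> lozenges_in v t" "L' \<in> lozenges_in v t" "d_vert L = d_vert L'"
  shows "L = L'"
  by (rule lozenge_corners [OF assms(1)]; rule lozenge_corners [OF assms(2)]; insert assms(3))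
    (auto simp: pt_inj cell_def)

lemma ac_verts_inj:
  assumes "L \<in> lozenges_in v t" "L' \<in> lozenges_in v t" "ac_verts L = ac_verts L'"
  shows "L = L'"
  by (rule lozenge_corners [OF assms(1)]; rule lozenge_corners [OF assms(2)]; insert assms(3))
    (auto simp: pt_inj cell_def doubleton_eq_iff)

lemma b_d_not_ac_verts:
  assumes "L \<in> lozenges_in v t" "L' \<in> lozenges_in v t"
  shows "{b_vert L, d_vert L} \<noteq> ac_verts L'"
  by (rule lozenge_corners [OF assms(1)]; rule lozenge_corners [OF assms(2)])
    (auto simp: pt_inj cell_def doubleton_eq_iff)

section \<open>Opposite corners of a lozenge and the two colour classes\<close>

definition opp :: "space_point set \<Rightarrow> lattice_point \<Rightarrow> lattice_point" where
  "opp L u = (THE w. {u, w} \<in> diagonals L)"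

lemma opp_eqI:
  assumes "L \<in> lozenges_in v t" "{u, w} \<in> diagonals L"
  shows "opp L u = w"
proof -
  obtain p q where pq: "ac_verts L = {p, q}" using ac_vertsE [OF assms(1)] by metis
  have "w' = w" if "{u, w'} \<in> diagonals L" for w'
    using that assms(2) bd_not_ac [of L] unfolding diagonals_eq [OF assms(1)] pq
    by (auto simp: doubleton_eq_iff)
  then show ?thesis unfolding opp_def using assms(2) by (intro the_equality)
qed

lemma opp_cases:
  assumes "L \<in> lozenges_in v t" "u \<in> loz_verts L"
  obtains "u = b_vert L" "opp L u = d_vert L" | "u = d_vert L" "opp L u = b_vert L"
    | "u \<in> ac_verts L" "ac_verts L = {u, opp L u}"
proof -
  obtain p q where pq: "ac_verts L = {p, q}" using ac_vertsE [OF assms(1)] by metis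
  have "opp L (b_vert L) = d_vert L" "opp L (d_vert L) = b_vert L" "opp L p = q" "opp L q = p"
    by (rule opp_eqI [OF assms(1)]; auto simp: diagonals_eq [OF assms(1)] pq)+
  moreover consider "u = b_vert L" | "u = d_vert L" | "u = p" | "u = q"
    using assms(2) pq unfolding loz_verts_eq [OF assms(1)] by auto
  ultimately show thesis using that pq by cases (metis insertCI insert_commute)+
qed

lemma opp_diagonal:
  assumes "L \<in> lozenges_in v t" "u \<in> loz_verts L"
  shows "{u, opp L u} \<in> diagonals L"
  by (rule opp_cases [OF assms]) (auto simp: diagonals_eq [OF assms(1)])

lemma opp_vert:
  assumes "L \<in> lozenges_in v t" "u \<in> loz_verts L"
  shows "opp L u \<in> loz_verts L"
  by (rule opp_cases [OF assms]) (auto simp: loz_verts_eq [OF assms(1)])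

lemma opp_neq:
  assumes "L \<in> lozenges_in v t" "u \<in> loz_verts L"
  shows "opp L u \<noteq> u"
  by (rule opp_cases [OF assms]; rule ac_vertsE [OF assms(1)])
    (use Y_b_d [OF assms(1)] in \<open>auto simp: doubleton_eq_iff\<close>)

text \<open>An edge determines its lozenge, so naming the edge that leaves a vertex and naming the
  lozenge \<open>f u\<close> carry the same information.\<close>

lemma diagonal_inj:
  assumes "L \<in> lozenges_in v t" "L' \<in> lozenges_in v t" "A \<in> diagonals L" "A \<in> diagonals L'"
  shows "L = L'"
proof -
  have "A = {b_vert L, d_vert L} \<or> A = ac_verts L" "A = {b_vert L', d_vert L'} \<or> A = ac_verts L'"
    using assms(3,4) diagonals_eq assms(1,2) by auto
  moreover have "L = L'" if "{b_vert L, d_vert L} = {b_vert L', d_vert L'}"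
    using that Y_b_d [OF assms(1)] Y_b_d [OF assms(2)] b_vert_inj [OF assms(1,2)]
    by (auto simp: doubleton_eq_iff)
  ultimately show ?thesis
    using ac_verts_inj b_d_not_ac_verts assms(1,2) by blast
qed

lemma diagonal_vert:
  assumes "L \<in> lozenges_in v t" "{u, w} \<in> diagonals L"
  shows "u \<in> loz_verts L" "w \<in> loz_verts L"
  using assms(2) unfolding diagonals_eq [OF assms(1)] loz_verts_eq [OF assms(1)] by auto

abbreviation green :: "lattice_point \<Rightarrow> bool" where "green u \<equiv> color u = 1"

lemma green_ac:
  assumes "L \<in> lozenges_in v t"
  shows "u \<in> ac_verts L \<Longrightarrow> green u \<longleftrightarrow> \<not> green (b_vert L)"
    "green (d_vert L) \<longleftrightarrow> green (b_vert L)"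
  by (rule lozenge_corners [OF assms]; auto simp: green_pt cell_def)+

lemma green_opp:
  assumes "L \<in> lozenges_in v t" "u \<in> loz_verts L"
  shows "green (opp L u) \<longleftrightarrow> green u"
proof (rule opp_cases [OF assms])
  assume "u \<in> ac_verts L" "ac_verts L = {u, opp L u}"
  then show ?thesis using green_ac(1) [OF assms(1)] by (metis insertCI)
qed (simp_all add: green_ac(2) [OF assms(1)])

lemma Vert_loz: "L \<in> lozenges_in v t \<Longrightarrow> u \<in> loz_verts L \<Longrightarrow> u \<in> Vert v t"
  by (auto simp: Vert_def)

lemma finite_lozenges_in: "finite (lozenges_in v t)"
proof -
  let ?I = "{0..int t}"
  have "lozenges_in v t \<subseteq> (\<Union>a\<in>?I. \<Union>b\<in>?I. \<Union>c\<in>?I. {rhombus12 (pt a b c), rhombus23 (pt a b c), rhombus31 (pt a b c)})"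
    unfolding lozenges_in_eq cell_def by fastforce
  then show ?thesis by (rule finite_subset) auto
qed

lemma finite_Vert: "finite (Vert v t)"
proof -
  have "finite (loz_verts L)" if "L \<in> lozenges_in v t" for L
    using that loz_verts_eq [OF that] ac_vertsE [OF that] by (metis finite.simps finite_Un)
  then show ?thesis unfolding Vert_def using finite_lozenges_in by auto
qed

end

section \<open>Columns and winding numbers\<close>

context lozenge_triangle begin

text \<open>The vertical columns are numbered from right to left; a red-blue column is a zigzag of
  width one.\<close>

definition col :: "lattice_point \<Rightarrow> int" where
  "col u = (let a = (int t + X v - X u) div 3 in if green u then 2 * a else 2 * a + 1)"

text \<open>The dividend in \<open>col\<close> is 3 a plus the defect t - (a + b + c), which lies
  between 0 and 2, so division by 3 recovers a.\<close>

lemma col_pt: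
  assumes "int t - 2 \<le> a + b + c" "a + b + c \<le> int t"
  shows "col (pt a b c) = (if a + b + c = int t then 2 * a else 2 * a + 1)"
proof -
  have "int t + X v - X (pt a b c) = (int t - (a + b + c)) + a * 3" by (simp add: X_pt)
  then have "(int t + X v - X (pt a b c)) div 3 = a" using assms by simp
  then show ?thesis by (simp add: col_def green_pt assms)
qed

text \<open>The vertical diagonal stays within one column; the flat diagonal passes exactly that
  column, strictly between the ends of the vertical one.\<close>

lemma lozenge_shape:
  assumes "L \<in> lozenges_in v t"
  obtains p q where "ac_verts L = {p, q}" "col p = col (b_vert L) + 1" "col q = col (b_vert L) - 1"
    "col (d_vert L) = col (b_vert L)" "2 * Y (d_vert L) < Y p + Y q" "Y p + Y q < 2 * Y (b_vert L)"
  by (rule lozenge_corners [OF assms]; rule that, assumption) (auto simp: col_pt Y_pt cell_def)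

lemma even_col: "even (col u) \<longleftrightarrow> green u"
  by (simp add: col_def Let_def)

lemma lozenge_coords:
  assumes "L \<in> lozenges_in v t"
  shows "\<exists>a b c. cell a b c \<and>
    (b_vert L = pt a b c \<and> d_vert L = pt a (b + 1) c \<and>
       ac_verts L = {pt (a + 1) (b + 1) c, pt a (b + 1) (c + 1)} \<or>
     b_vert L = pt a b (c + 1) \<and> d_vert L = pt a b c \<and>
       ac_verts L = {pt (a + 1) b (c + 1), pt a (b + 1) (c + 1)} \<or>
     b_vert L = pt (a + 1) b (c + 1) \<and> d_vert L = pt (a + 1) (b + 1) c \<and>
       ac_verts L = {pt (a + 1) b c, pt a b c})"
  by (rule lozenge_corners [OF assms]) blast+

text \<open>In a column a is fixed, so c - b has a fixed parity. Relative to \<open>Y v\<close>, the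
  vertical diagonals of a green column are the intervals [c - b - 1, c - b + 1], those of a red-blue
  column the intervals [c - b - 1, c - b] and [c - b, c - b + 1]; they overlap at most in end
  points.\<close>

lemma column_disjoint:
  assumes "K \<in> lozenges_in v t" "L \<in> lozenges_in v t" "K \<noteq> L" "col (b_vert K) = col (b_vert L)"
  shows "Y (b_vert L) \<le> Y (d_vert K) \<or> Y (b_vert K) \<le> Y (d_vert L)"
proof -
  obtain a b c where K: "cell a b c" "b_vert K = pt a b c \<and> d_vert K = pt a (b + 1) c \<or>
    b_vert K = pt a b (c + 1) \<and> d_vert K = pt a b c \<or>
    b_vert K = pt (a + 1) b (c + 1) \<and> d_vert K = pt (a + 1) (b + 1) c"
    using lozenge_coords [OF assms(1)] by blast
  obtain a' b' c' where L: "cell a' b' c'" "b_vert L = pt a' b' c' \<and> d_vert L = pt a' (b' + 1) c' \<or>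
    b_vert L = pt a' b' (c' + 1) \<and> d_vert L = pt a' b' c' \<or>
    b_vert L = pt (a' + 1) b' (c' + 1) \<and> d_vert L = pt (a' + 1) (b' + 1) c'"
    using lozenge_coords [OF assms(2)] by blast
  have ne: "b_vert K \<noteq> b_vert L" using b_vert_inj assms(1-3) by blast
  have s: "a + b + c = int t - 2" "a' + b' + c' = int t - 2" using K(1) L(1) by (simp_all add: cell_def)
  have col: "col (pt a b c) = 2 * a + 1" "col (pt a b (c + 1)) = 2 * a + 1"
    "col (pt (a + 1) b (c + 1)) = 2 * a + 2"
    "col (pt a' b' c') = 2 * a' + 1" "col (pt a' b' (c' + 1)) = 2 * a' + 1"
    "col (pt (a' + 1) b' (c' + 1)) = 2 * a' + 2"
    using s by (simp_all add: col_pt)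
  have b: "b = b'" if "a = a'" "c = c'" using s that by simp
  from K(2) L(2) show ?thesis
  proof (elim disjE conjE)
    assume *: "b_vert K = pt a b c" "d_vert K = pt a (b + 1) c" "b_vert L = pt a' b' c'" "d_vert L = pt a' (b' + 1) c'"
    have "a = a'" using assms(4) by (simp add: * col)
    moreover have "c \<noteq> c'" using ne b calculation by (auto simp: *)
    ultimately have "a = a'" "c \<noteq> c'" by blast+
    then show ?thesis using s unfolding * Y_pt by linarith
  next
    assume *: "b_vert K = pt a b c" "d_vert K = pt a (b + 1) c" "b_vert L = pt a' b' (c' + 1)" "d_vert L = pt a' b' c'"
    have "a = a'" using assms(4) by (simp add: * col)
    then show ?thesis using s unfolding * Y_pt by presburger
  next
    assume *: "b_vert K = pt a b c" "d_vert K = pt a (b + 1) c" "b_vert L = pt (a' + 1) b' (c' + 1)"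
    have "2 * a + 1 = 2 * a' + 2" using assms(4) by (simp add: * col)
    then show ?thesis by presburger
  next
    assume *: "b_vert K = pt a b (c + 1)" "d_vert K = pt a b c" "b_vert L = pt a' b' c'" "d_vert L = pt a' (b' + 1) c'"
    have "a = a'" using assms(4) by (simp add: * col)
    then show ?thesis using s unfolding * Y_pt by presburger
  next
    assume *: "b_vert K = pt a b (c + 1)" "d_vert K = pt a b c" "b_vert L = pt a' b' (c' + 1)" "d_vert L = pt a' b' c'"
    have "a = a'" using assms(4) by (simp add: * col)
    moreover have "c \<noteq> c'" using ne b calculation by (auto simp: *)
    ultimately have "a = a'" "c \<noteq> c'" by blast+
    then show ?thesis using s unfolding * Y_pt by linarith
  next
    assume *: "b_vert K = pt a b (c + 1)" "d_vert K = pt a b c" "b_vert L = pt (a' + 1) b' (c' + 1)"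
    have "2 * a + 1 = 2 * a' + 2" using assms(4) by (simp add: * col)
    then show ?thesis by presburger
  next
    assume *: "b_vert K = pt (a + 1) b (c + 1)" "b_vert L = pt a' b' c'"
    have "2 * a' + 1 = 2 * a + 2" using assms(4) by (simp add: * col)
    then show ?thesis by presburger
  next
    assume *: "b_vert K = pt (a + 1) b (c + 1)" "b_vert L = pt a' b' (c' + 1)"
    have "2 * a' + 1 = 2 * a + 2" using assms(4) by (simp add: * col)
    then show ?thesis by presburger
  next
    assume *: "b_vert K = pt (a + 1) b (c + 1)" "d_vert K = pt (a + 1) (b + 1) c"
      "b_vert L = pt (a' + 1) b' (c' + 1)" "d_vert L = pt (a' + 1) (b' + 1) c'"
    have "a = a'" using assms(4) by (simp add: * col)
    moreover have "c \<noteq> c'" using ne b calculation by (auto simp: *)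
    ultimately have "a = a'" "c \<noteq> c'" by blast+
    then show ?thesis using s unfolding * Y_pt by linarith
  qed
qed

text \<open>The two flat diagonals overlap over the strip between the columns, with \<open>p\<close>
  and \<open>w\<close> on its two borders. They do not cross there: \<open>p\<close> is below the
  diagonal of \<open>K\<close> exactly when the diagonal of \<open>L\<close> is below
  \<open>w\<close>, and ties do not occur.\<close>

lemma adjacent_columns:
  assumes "K \<in> lozenges_in v t" "L \<in> lozenges_in v t" "col (b_vert K) = col (b_vert L) + 1"
    and "p \<in> ac_verts L" "q \<in> ac_verts L" "col q < col p"
    and "u \<in> ac_verts K" "w \<in> ac_verts K" "col w < col u"
  shows "(2 * Y p < Y u + Y w \<and> Y p + Y q < 2 * Y w) \<or> (2 * Y p > Y u + Y w \<and> Y p + Y q > 2 * Y w)"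
proof -
  obtain a b c where K: "cell a b c" "b_vert K = pt a b c \<and>
       ac_verts K = {pt (a + 1) (b + 1) c, pt a (b + 1) (c + 1)} \<or>
     b_vert K = pt a b (c + 1) \<and> ac_verts K = {pt (a + 1) b (c + 1), pt a (b + 1) (c + 1)} \<or>
     b_vert K = pt (a + 1) b (c + 1) \<and> ac_verts K = {pt (a + 1) b c, pt a b c}"
    using lozenge_coords [OF assms(1)] by blast
  obtain a' b' c' where L: "cell a' b' c'" "b_vert L = pt a' b' c' \<and>
       ac_verts L = {pt (a' + 1) (b' + 1) c', pt a' (b' + 1) (c' + 1)} \<or>
     b_vert L = pt a' b' (c' + 1) \<and> ac_verts L = {pt (a' + 1) b' (c' + 1), pt a' (b' + 1) (c' + 1)} \<or>
     b_vert L = pt (a' + 1) b' (c' + 1) \<and> ac_verts L = {pt (a' + 1) b' c', pt a' b' c'}"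
    using lozenge_coords [OF assms(2)] by blast
  have s: "a + b + c = int t - 2" "a' + b' + c' = int t - 2" using K(1) L(1) by (simp_all add: cell_def)
  have K': "(\<exists>y. col (b_vert K) = 2 * a + 1 \<and> (y = c - b - 1 \<and> Y u = Y v + y \<and> Y w = Y v + y + 1 \<or>
        y = c - b + 1 \<and> Y u = Y v + y \<and> Y w = Y v + y - 1)) \<or>
      col (b_vert K) = 2 * a + 2 \<and> Y u = Y v + c - b \<and> Y w = Y v + c - b"
    using K(2) assms(7-9) s by (elim disjE conjE) (auto simp: col_pt Y_pt)
  have L': "(\<exists>y. col (b_vert L) = 2 * a' + 1 \<and> (y = c' - b' - 1 \<and> Y p = Y v + y \<and> Y q = Y v + y + 1 \<or>
        y = c' - b' + 1 \<and> Y p = Y v + y \<and> Y q = Y v + y - 1)) \<or>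
      col (b_vert L) = 2 * a' + 2 \<and> Y p = Y v + c' - b' \<and> Y q = Y v + c' - b'"
    using L(2) assms(4-6) s by (elim disjE conjE) (auto simp: col_pt Y_pt)
  \<comment> \<open>Adjacent columns have opposite parity, so exactly one of the two lozenges is of
    the third type.\<close>
  consider "a' = a - 1" "c + b = c' + b' - 1" "(Y u = Y v + c - b - 1 \<and> Y w = Y v + c - b \<or>
        Y u = Y v + c - b + 1 \<and> Y w = Y v + c - b)" "Y p = Y v + c' - b'" "Y q = Y v + c' - b'"
    | "a' = a" "c + b = c' + b'" "Y u = Y v + c - b" "Y w = Y v + c - b"
        "(Y p = Y v + c' - b' - 1 \<and> Y q = Y v + c' - b' \<or> Y p = Y v + c' - b' + 1 \<and> Y q = Y v + c' - b')"
    using K' L' assms(3) s by (elim disjE exE conjE) (simp_all, presburger+)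
  then show ?thesis
  proof cases
    case 1
    define y m where "y = Y v - b" and "m = c - c'"
    have "b = b' - 1 - m" "c = c' + m" using 1(2) by (simp_all add: m_def)
    then show ?thesis using 1(3-5) by presburger
  next
    case 2
    define m where "m = c - c'"
    have "b = b' - m" "c = c' + m" using 2(2) by (simp_all add: m_def)
    then show ?thesis using 2(3-5) by presburger
  qed
qed

text \<open>The signed crossing of the step from \<open>u\<close> to \<open>w\<close> with the vertical ray upwards from \<open>p\<close>.\<close>

definition cr :: "lattice_point \<Rightarrow> lattice_point \<Rightarrow> lattice_point \<Rightarrow> int" where
  "cr p u w = (of_bool (col w < col p) - of_bool (col u < col p)) * of_bool (2 * Y p < Y u + Y w)"

lemma cr_swap: "cr p w u = - cr p u w"
  by (simp add: cr_def add.commute)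

lemma diagonal_cases:
  assumes "K \<in> lozenges_in v t" "{u, w} \<in> diagonals K"
  obtains (bd) "{u, w} = {b_vert K, d_vert K}" "col u = col (b_vert K)" "col w = col (b_vert K)"
    | (ac) "u \<in> ac_verts K" "w \<in> ac_verts K" "col u = col (b_vert K) + 1" "col w = col (b_vert K) - 1"
    | (ca) "u \<in> ac_verts K" "w \<in> ac_verts K" "col w = col (b_vert K) + 1" "col u = col (b_vert K) - 1"
proof -
  obtain p q where "ac_verts K = {p, q}" "col p = col (b_vert K) + 1" "col q = col (b_vert K) - 1"
    "col (d_vert K) = col (b_vert K)" by (rule lozenge_shape [OF assms(1)])
  with assms(2) bd ac ca show thesis
    unfolding diagonals_eq [OF assms(1)] by (auto simp: doubleton_eq_iff)
qed

lemma ac_height: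
  assumes "K \<in> lozenges_in v t" "u \<in> ac_verts K" "w \<in> ac_verts K" "u \<noteq> w"
  shows "2 * Y (d_vert K) < Y u + Y w" "Y u + Y w < 2 * Y (b_vert K)"
proof -
  obtain p q where "ac_verts K = {p, q}" "2 * Y (d_vert K) < Y p + Y q" "Y p + Y q < 2 * Y (b_vert K)"
    by (rule lozenge_shape [OF assms(1)])
  with assms(2-4) show "2 * Y (d_vert K) < Y u + Y w" "Y u + Y w < 2 * Y (b_vert K)" by auto
qed

lemma col_d: "L \<in> lozenges_in v t \<Longrightarrow> col (d_vert L) = col (b_vert L)"
  by (rule lozenge_shape)

text \<open>In the same column the vertical diagonal of \<open>L\<close> lies wholly above or wholly
  below the edge. Otherwise parity puts both ends of the edge on the same side of the column, and
  neither ray is crossed.\<close>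

lemma cr_bd_aux:
  assumes K: "K \<in> lozenges_in v t" and L: "L \<in> lozenges_in v t" and KL: "K \<noteq> L"
    and u: "u \<in> ac_verts K" "w \<in> ac_verts K" "col u = col (b_vert K) + 1" "col w = col (b_vert K) - 1"
    and gr: "green u \<noteq> green (b_vert L)"
  shows "cr (b_vert L) u w = cr (d_vert L) u w"
proof (cases "col (b_vert K) = col (b_vert L)")
  case True
  have "u \<noteq> w" using u by auto
  then show ?thesis
    using column_disjoint [OF K L KL True] ac_height [OF K u(1,2)] Y_b_d [OF L] Y_b_d [OF K] col_d [OF L]
    unfolding cr_def by auto
next
  case False
  have "odd (col (b_vert K) + 1 - col (b_vert L))"
    using gr unfolding even_col [symmetric] u(3) by auto
  then have "col w < col (b_vert L) \<longleftrightarrow> col u < col (b_vert L)" unfolding u using False by presburger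
  then show ?thesis unfolding cr_def col_d [OF L] by simp
qed

lemma cr_bd:
  assumes K: "K \<in> lozenges_in v t" and L: "L \<in> lozenges_in v t" and KL: "K \<noteq> L"
    and uw: "{u, w} \<in> diagonals K" and gr: "green u \<noteq> green (b_vert L)"
  shows "cr (b_vert L) u w = cr (d_vert L) u w"
  using K uw
proof (cases rule: diagonal_cases)
  case bd
  then show ?thesis by (simp add: cr_def)
next
  case ac
  then show ?thesis using cr_bd_aux [OF K L KL] gr by blast
next
  case ca
  then have "green w \<noteq> green (b_vert L)" using gr green_ac(1) [OF K] by simp
  then show ?thesis using cr_bd_aux [OF K L KL ca(2,1,3,4)] cr_swap [of _ u w] by simp
qed

text \<open>The flat diagonal passes its column above the lower and below the upper corner: only the
  ray from the lower corner meets it.\<close>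

lemma cr_own:
  assumes L: "L \<in> lozenges_in v t" and u: "ac_verts L = {u, w}" "u \<noteq> w"
  shows "cr (b_vert L) u w \<noteq> cr (d_vert L) u w"
proof -
  have "{u, w} \<in> diagonals L" using diagonals_eq [OF L] u by simp
  with L show ?thesis
  proof (cases rule: diagonal_cases)
    case bd
    then show ?thesis using u bd_not_ac [of L] by (auto simp: doubleton_eq_iff)
  qed (use ac_height [OF L _ _ u(2)] col_d [OF L] in \<open>auto simp: cr_def\<close>)
qed

text \<open>\<open>S\<close> consists of the vertices between the two upward rays and above the
  diagonal from \<open>p\<close> to \<open>q\<close>. An edge of the other class meets at most one
  of the rays, and it does so exactly when it enters or leaves \<open>S\<close>.\<close>

lemma cr_ac_aux:
  assumes K: "K \<in> lozenges_in v t" and L: "L \<in> lozenges_in v t"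
    and pq: "p \<in> ac_verts L" "q \<in> ac_verts L" "col p = col (b_vert L) + 1" "col q = col (b_vert L) - 1"
    and u: "u \<in> ac_verts K" "w \<in> ac_verts K" "col u = col (b_vert K) + 1" "col w = col (b_vert K) - 1"
    and gr: "green u \<noteq> green p"
  defines "S \<equiv> {u. col u = col (b_vert L) \<and> Y p + Y q < 2 * Y u}"
  shows "cr p u w - cr q u w = of_bool (w \<in> S) - of_bool (u \<in> S)"
proof -
  let ?m = "col (b_vert L)" and ?k = "col (b_vert K)"
  have odd: "odd (?k - ?m)" using gr unfolding even_col [symmetric] pq u by auto
  then have "?k = ?m + 1 \<or> ?m = ?k + 1 \<or> (?k \<ge> ?m + 3 \<or> ?k \<le> ?m - 3)" by presburger
  then consider "?k = ?m + 1" | "?m = ?k + 1" | "?k \<ge> ?m + 3 \<or> ?k \<le> ?m - 3" by blast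
  then show ?thesis
  proof cases
    case 1
    then show ?thesis using adjacent_columns [OF K L 1 pq(1,2) _ u(1,2)] pq(3,4) u(3,4)
      by (auto simp: cr_def S_def)
  next
    case 2
    then show ?thesis using adjacent_columns [OF L K 2 u(1,2) _ pq(1,2)] pq(3,4) u(3,4)
      by (auto simp: cr_def S_def)
  next
    case 3
    then have "col w < col p \<longleftrightarrow> col u < col p" "col w < col q \<longleftrightarrow> col u < col q" "w \<notin> S" "u \<notin> S"
      using pq(3,4) u(3,4) unfolding S_def by auto
    then show ?thesis by (simp add: cr_def)
  qed
qed

lemma cr_ac:
  assumes L: "L \<in> lozenges_in v t" and pq: "{p, q} = ac_verts L"
  shows "\<exists>S. \<forall>K\<in>lozenges_in v t. \<forall>u w. K \<noteq> L \<longrightarrow> {u, w} \<in> diagonals K \<longrightarrow> green u \<noteq> green p \<longrightarrow>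
    cr p u w - cr q u w = of_bool (w \<in> S) - of_bool (u \<in> S)"
proof -
  have *: "\<exists>S. \<forall>K\<in>lozenges_in v t. \<forall>u w. K \<noteq> L \<longrightarrow> {u, w} \<in> diagonals K \<longrightarrow> green u \<noteq> green p \<longrightarrow>
    cr p u w - cr q u w = of_bool (w \<in> S) - of_bool (u \<in> S)"
    if pq: "p \<in> ac_verts L" "q \<in> ac_verts L" "col p = col (b_vert L) + 1" "col q = col (b_vert L) - 1" for p q
  proof (intro exI ballI allI impI)
    fix K u w assume K: "K \<in> lozenges_in v t" and KL: "K \<noteq> L" and uw: "{u, w} \<in> diagonals K"
      and gr: "green u \<noteq> green p"
    let ?S = "{u. col u = col (b_vert L) \<and> Y p + Y q < 2 * Y u}"
    from K uw show "cr p u w - cr q u w = of_bool (w \<in> ?S) - of_bool (u \<in> ?S)"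
    proof (cases rule: diagonal_cases)
      case bd
      have "p \<noteq> q" using pq by auto
      then have "w \<in> ?S \<longleftrightarrow> u \<in> ?S" if "col (b_vert K) = col (b_vert L)"
        using column_disjoint [OF K L KL that] ac_height [OF L pq(1,2)] bd Y_b_d [OF K] Y_b_d [OF L]
        by (auto simp: doubleton_eq_iff)
      then show ?thesis using bd by (auto simp: cr_def)
    next
      case ac
      then show ?thesis using cr_ac_aux [OF K L pq] gr by blast
    next
      case ca
      then have "green w \<noteq> green p" using gr green_ac(1) [OF K] by simp
      then show ?thesis using cr_ac_aux [OF K L pq ca(2,1,3,4)] cr_swap [of _ u w] by simp
    qed
  qed
  have "{p, q} \<in> diagonals L" using diagonals_eq [OF L] pq by simp
  with L show ?thesis
  proof (cases rule: diagonal_cases)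
    case bd
    then show ?thesis using pq bd_not_ac [of L] by auto
  next
    case ac
    then show ?thesis by (rule *)
  next
    case ca
    have gr: "green q \<longleftrightarrow> green p" using green_ac(1) [OF L] ca by simp
    obtain S where S: "\<And>K u w. K \<in> lozenges_in v t \<Longrightarrow> K \<noteq> L \<Longrightarrow> {u, w} \<in> diagonals K \<Longrightarrow>
      green u \<noteq> green q \<Longrightarrow> cr q u w - cr p u w = of_bool (w \<in> S) - of_bool (u \<in> S)"
      using * [OF ca(2,1,3,4)] by blast
    \<comment> \<open>Exchanging \<open>p\<close> and \<open>q\<close> reverses the sign, and so
      does passing to the complement of \<open>S\<close>.\<close>
    have "cr p u w - cr q u w = of_bool (w \<in> - S) - of_bool (u \<in> - S)"
      if "K \<in> lozenges_in v t" "K \<noteq> L" "{u, w} \<in> diagonals K" "green u \<noteq> green p" for K u w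
      using S [OF that(1-3)] that(4) gr by auto
    then show ?thesis by blast
  qed
qed

section \<open>Boundary points and the rays from the roots\<close>

lemma a_pt_eq: "a_pt v t n = pt 0 (int (n div 2)) (int t - int ((n + 1) div 2))"
  and b_pt_eq: "b_pt v t n = pt (int (n div 2)) (int t - int ((n + 1) div 2)) 0"
  and c_pt_eq: "c_pt v t n = pt (int t - int ((n + 1) div 2)) 0 (int (n div 2))"
  by (cases "even n"; auto simp: a_pt_def b_pt_def c_pt_def pt_def Let_def elim!: evenE oddE)+

lemma R0_E:
  assumes "\<rho> \<in> R0 v t"
  obtains a b c where "\<rho> = pt a b c" "0 \<le> a" "0 \<le> b" "0 \<le> c" "b = 0 \<or> c = 0"
    "a + b + c = int t \<or> a + b + c = int t - 1"
proof -
  have half: "int (n div 2) + (int t - int ((n + 1) div 2)) = int t \<or>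
    int (n div 2) + (int t - int ((n + 1) div 2)) = int t - 1"
    "int t - int ((n + 1) div 2) \<ge> 0" if "n \<le> 2 * t - 1" for n
    using that t_ge2 by linarith+
  from assms consider n where "n \<in> {1..2 * t - 1}" "\<rho> = c_pt v t n" | n where "n \<in> {1..t - 1}" "\<rho> = b_pt v t n"
    unfolding R0_def by blast
  then show thesis
  proof cases
    case 1
    then show thesis using half [of n] by (intro that [OF 1(2) [unfolded c_pt_eq]]) auto
  next
    case 2
    then show thesis using half [of n] by (intro that [OF 2(2) [unfolded b_pt_eq]]) auto
  qed
qed

text \<open>Roots lie on the upper side b = 0 or on the lower side c = 0. In the first case edges of
  the other class pass the column of \<rho> below it, and nothing is counted. In the second they
  pass above it, so that the crossing number only records the change of side of the column.\<close>

lemma cr_root: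
  assumes \<rho>: "\<rho> \<in> R0 v t"
  shows "\<exists>S. \<forall>K\<in>lozenges_in v t. \<forall>u w. {u, w} \<in> diagonals K \<longrightarrow> green u \<noteq> green \<rho> \<longrightarrow>
    cr \<rho> u w = of_bool (w \<in> S) - of_bool (u \<in> S)"
proof -
  obtain a b c where abc: "\<rho> = pt a b c" "0 \<le> a" "0 \<le> b" "0 \<le> c" "b = 0 \<or> c = 0"
    "a + b + c = int t \<or> a + b + c = int t - 1" by (rule R0_E [OF \<rho>])
  define S where "S = (if b = 0 then {} else {u. col u < col \<rho>})"
  have "cr \<rho> u w = of_bool (w \<in> S) - of_bool (u \<in> S)"
    if K: "K \<in> lozenges_in v t" "{u, w} \<in> diagonals K" and gr: "green u \<noteq> green \<rho>" for K u w
  proof (cases "col w < col \<rho> \<longleftrightarrow> col u < col \<rho>")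
    case True
    then show ?thesis by (auto simp: cr_def S_def)
  next
    case False
    have kk: "u \<noteq> w \<and> u \<in> ac_verts K \<and> w \<in> ac_verts K \<and> col (b_vert K) = col \<rho>"
      using K
    proof (cases rule: diagonal_cases)
      case bd
      with False show ?thesis by simp
    next
      case ac
      have "odd (col (b_vert K) + 1 - col \<rho>)" using gr unfolding even_col [symmetric] ac by auto
      then show ?thesis using False ac by (auto, presburger+)
    next
      case ca
      have "odd (col (b_vert K) - 1 - col \<rho>)" using gr unfolding even_col [symmetric] ca by auto
      then show ?thesis using False ca by (auto, presburger+)
    qed
    have col\<rho>: "col \<rho> = (if a + b + c = int t then 2 * a else 2 * a + 1)"
      unfolding abc(1) using abc(6) by (intro col_pt) auto
    obtain a' b' c' where L: "cell a' b' c'" "b_vert K = pt a' b' c' \<and>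
       ac_verts K = {pt (a' + 1) (b' + 1) c', pt a' (b' + 1) (c' + 1)} \<or>
     b_vert K = pt a' b' (c' + 1) \<and> ac_verts K = {pt (a' + 1) b' (c' + 1), pt a' (b' + 1) (c' + 1)} \<or>
     b_vert K = pt (a' + 1) b' (c' + 1) \<and> ac_verts K = {pt (a' + 1) b' c', pt a' b' c'}"
      using lozenge_coords [OF K(1)] by blast
    have s: "a' + b' + c' = int t - 2" "0 \<le> b'" "0 \<le> c'" using L(1) by (simp_all add: cell_def)
    have "col (b_vert K) = 2 * a' + 1 \<and> (Y u + Y w = 2 * Y v + 2 * (c' - b') - 1 \<or> Y u + Y w = 2 * Y v + 2 * (c' - b') + 1)
      \<or> col (b_vert K) = 2 * a' + 2 \<and> Y u + Y w = 2 * Y v + 2 * (c' - b')"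
      using L(2) kk s by (elim disjE conjE) (auto simp: col_pt Y_pt)
    moreover have "2 * a \<noteq> 2 * a' + 1" "2 * a + 1 \<noteq> 2 * a' + 2" by presburger+
    ultimately have "a = a' \<and> a + b + c = int t - 1 \<and> (Y u + Y w = 2 * Y v + 2 * (c' - b') - 1 \<or> Y u + Y w = 2 * Y v + 2 * (c' - b') + 1)
      \<or> a = a' + 1 \<and> a + b + c = int t \<and> Y u + Y w = 2 * Y v + 2 * (c' - b')"
      using kk abc(6) unfolding col\<rho> by auto
    then have "if b = 0 then Y u + Y w < 2 * Y \<rho> else 2 * Y \<rho> < Y u + Y w"
      using abc(3-5) s unfolding abc(1) Y_pt by auto
    then show ?thesis by (auto simp: cr_def S_def split: if_splits)
  qed
  then show ?thesis by blast
qed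

end

section \<open>Sets permuted by the successor map, their winding numbers, and the descent\<close>

lemma sum_of_bool_permute:
  assumes "bij_betw n C C" "finite C"
  shows "(\<Sum>u\<in>C. of_bool (n u \<in> S) - of_bool (u \<in> S)) = (0 :: int)"
  using sum.reindex_bij_betw [OF assms(1), of "\<lambda>u. of_bool (u \<in> S) :: int"] by (simp add: sum_subtractf)

text \<open>Take a nonempty closed subset of least size: its image is again closed, hence not
  smaller.\<close>

lemma closed_contains_permuted:
  assumes "finite J" "J \<noteq> {}" "n ` J \<subseteq> J"
  obtains C where "C \<subseteq> J" "C \<noteq> {}" "n ` C = C"
proof -
  define P where "P C \<longleftrightarrow> C \<noteq> {} \<and> C \<subseteq> J \<and> n ` C \<subseteq> C" for C
  define C where "C = arg_min card P"
  have "P J" using assms unfolding P_def by blast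
  then have *: "P C \<and> (\<forall>D. P D \<longrightarrow> card C \<le> card D)" unfolding C_def by (rule arg_min_nat_lemma)
  then have C: "C \<noteq> {}" "C \<subseteq> J" "n ` C \<subseteq> C" unfolding P_def by blast+
  have min: "card C \<le> card D" if "D \<noteq> {}" "D \<subseteq> J" "n ` D \<subseteq> D" for D
    using * that unfolding P_def by blast
  have "n ` C \<noteq> {}" "n ` C \<subseteq> J" "n ` (n ` C) \<subseteq> n ` C" using C(1-3) by blast+
  then have "card C \<le> card (n ` C)" by (rule min)
  moreover have "finite C" using C assms(1) finite_subset by blast
  ultimately have "n ` C = C" using C(3) by (metis card_seteq)
  then show thesis using C that by blast
qed

context lozenge_triangle begin

definition orientation :: "(lattice_point \<Rightarrow> space_point set) \<Rightarrow> bool" where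
  "orientation f \<longleftrightarrow> bij_betw f (Vert v t - R0 v t) (lozenges_in v t) \<and>
     (\<forall>u \<in> Vert v t - R0 v t. u \<in> loz_verts (f u))"

definition nxt :: "(lattice_point \<Rightarrow> space_point set) \<Rightarrow> lattice_point \<Rightarrow> lattice_point" where
  "nxt f u = opp (f u) u"

lemma orientationD:
  assumes "orientation f" "u \<in> Vert v t" "u \<notin> R0 v t"
  shows "f u \<in> lozenges_in v t" "u \<in> loz_verts (f u)" "nxt f u \<in> Vert v t" "nxt f u \<noteq> u"
    "{u, nxt f u} \<in> diagonals (f u)" "green (nxt f u) \<longleftrightarrow> green u"
proof -
  show L: "f u \<in> lozenges_in v t" and u: "u \<in> loz_verts (f u)"
    using assms unfolding orientation_def bij_betw_def by auto
  show "nxt f u \<in> Vert v t" "nxt f u \<noteq> u" "{u, nxt f u} \<in> diagonals (f u)" "green (nxt f u) \<longleftrightarrow> green u"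
    unfolding nxt_def using opp_vert [OF L u] Vert_loz [OF L] opp_neq [OF L u] opp_diagonal [OF L u] green_opp [OF L u]
    by auto
qed

lemma nxt_cases:
  assumes "orientation f" "u \<in> Vert v t" "u \<notin> R0 v t"
  obtains (down) "b_vert (f u) = u" "d_vert (f u) = nxt f u"
    | (up) "d_vert (f u) = u" "b_vert (f u) = nxt f u"
    | (ac) "u \<in> ac_verts (f u)" "ac_verts (f u) = {u, nxt f u}"
  by (rule opp_cases [OF orientationD(1,2) [OF assms]]) (simp_all only: nxt_def that)

lemma orientation_inj:
  assumes "orientation f" "u \<in> Vert v t - R0 v t" "w \<in> Vert v t - R0 v t" "f u = f w"
  shows "u = w"
  using assms unfolding orientation_def bij_betw_def inj_on_def by blast

text \<open>Counted on the upward ray from \<open>p\<close>. Summing over a set that the successor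
  map permutes avoids listing a cycle in order.\<close>

definition wind :: "(lattice_point \<Rightarrow> space_point set) \<Rightarrow> lattice_point set \<Rightarrow> lattice_point \<Rightarrow> int" where
  "wind f C p = (\<Sum>u\<in>C. cr p u (nxt f u))"

context
  fixes f C g
  assumes f: "orientation f" and C: "C \<subseteq> Vert v t - R0 v t" "C \<noteq> {}" "nxt f ` C = C"
    and mono: "\<And>u. u \<in> C \<Longrightarrow> green u \<longleftrightarrow> g"
begin

lemma finite_C: "finite C"
  using C(1) finite_Vert finite_subset by blast

lemma bij_C: "bij_betw (nxt f) C C"
proof (rule bij_betw_imageI)
  show "inj_on (nxt f) C" by (rule eq_card_imp_inj_on [OF finite_C]) (simp only: C(3))
qed (fact C(3))

lemma nxt_C: "u \<in> C \<Longrightarrow> nxt f u \<in> C"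
  using imageI [of u C "nxt f"] by (simp only: C(3))

lemma C_D:
  assumes "u \<in> C"
  shows "f u \<in> lozenges_in v t" "u \<in> loz_verts (f u)" "{u, nxt f u} \<in> diagonals (f u)" "nxt f u \<noteq> u"
proof -
  have "u \<in> Vert v t" "u \<notin> R0 v t" using assms C(1) by auto
  then show "f u \<in> lozenges_in v t" "u \<in> loz_verts (f u)" "{u, nxt f u} \<in> diagonals (f u)" "nxt f u \<noteq> u"
    by (simp_all add: orientationD [OF f])
qed

lemma C_inj:
  assumes "u \<in> C" "w \<in> Vert v t - R0 v t" "f u = f w"
  shows "u = w"
  using orientation_inj [OF f _ assms(2,3)] assms(1) C(1) by blast

lemma wind_root:
  assumes "\<rho> \<in> R0 v t" "green \<rho> \<noteq> g"
  shows "wind f C \<rho> = 0"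
proof -
  have "\<exists>S. \<forall>K\<in>lozenges_in v t. \<forall>u w. {u, w} \<in> diagonals K \<longrightarrow> green u \<noteq> green \<rho> \<longrightarrow>
    cr \<rho> u w = of_bool (w \<in> S) - of_bool (u \<in> S)" by (rule cr_root [OF assms(1)])
  then obtain S where S: "\<forall>K\<in>lozenges_in v t. \<forall>u w. {u, w} \<in> diagonals K \<longrightarrow> green u \<noteq> green \<rho> \<longrightarrow>
    cr \<rho> u w = of_bool (w \<in> S) - of_bool (u \<in> S)" ..
  have "cr \<rho> u (nxt f u) = of_bool (nxt f u \<in> S) - of_bool (u \<in> S)" if "u \<in> C" for u
    using S [rule_format, OF C_D(1) [OF that] C_D(3) [OF that]] mono [OF that] assms(2) by blast
  then have "wind f C \<rho> = (\<Sum>u\<in>C. of_bool (nxt f u \<in> S) - of_bool (u \<in> S))"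
    unfolding wind_def by (intro sum.cong refl)
  then show ?thesis using sum_of_bool_permute [OF bij_C finite_C] by simp
qed

text \<open>\<open>p\<close> belongs to the other class and so is not in \<open>C\<close>; by
  injectivity of \<open>f\<close> no edge of \<open>C\<close> lies in \<open>f p\<close>, and edges
  in other lozenges do not cross the step out of \<open>p\<close>.\<close>

lemma wind_nxt:
  assumes p: "p \<in> Vert v t" "p \<notin> R0 v t" "green p \<noteq> g"
  shows "wind f C (nxt f p) = wind f C p"
proof -
  note D = orientationD [OF f p(1,2)]
  have ne: "f u \<noteq> f p" if "u \<in> C" for u
  proof
    assume "f u = f p"
    then have "u = p" using p by (intro C_inj [OF that]) auto
    then show False using mono [OF that] p(3) by simp
  qed
  have bd: "wind f C (b_vert (f p)) = wind f C (d_vert (f p))" if "p \<notin> ac_verts (f p)"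
  proof -
    have "green (b_vert (f p)) \<noteq> g"
      using that D(2) p(3) green_ac(2) [OF D(1)] unfolding loz_verts_eq [OF D(1)] by auto
    then have "cr (b_vert (f p)) u (nxt f u) = cr (d_vert (f p)) u (nxt f u)" if "u \<in> C" for u
      using cr_bd [OF C_D(1) [OF that] D(1) ne [OF that] C_D(3) [OF that]] mono [OF that] by blast
    then show ?thesis unfolding wind_def by simp
  qed
  from f p(1,2) show ?thesis
  proof (cases rule: nxt_cases)
    case down
    then show ?thesis using bd bd_not_ac(1) [of "f p"] by simp
  next
    case up
    then show ?thesis using bd bd_not_ac(2) [of "f p"] by simp
  next
    case ac
    have "\<exists>S. \<forall>K\<in>lozenges_in v t. \<forall>u w. K \<noteq> f p \<longrightarrow> {u, w} \<in> diagonals K \<longrightarrow> green u \<noteq> green p \<longrightarrow>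
      cr p u w - cr (nxt f p) u w = of_bool (w \<in> S) - of_bool (u \<in> S)"
      by (rule cr_ac [OF D(1) ac(2) [symmetric]])
    then obtain S where S: "\<forall>K\<in>lozenges_in v t. \<forall>u w. K \<noteq> f p \<longrightarrow> {u, w} \<in> diagonals K \<longrightarrow> green u \<noteq> green p \<longrightarrow>
      cr p u w - cr (nxt f p) u w = of_bool (w \<in> S) - of_bool (u \<in> S)" ..
    have "cr p u (nxt f u) - cr (nxt f p) u (nxt f u) = of_bool (nxt f u \<in> S) - of_bool (u \<in> S)"
      if "u \<in> C" for u
      using S [rule_format, OF C_D(1) [OF that] ne [OF that] C_D(3) [OF that]] mono [OF that] p(3) by blast
    then have "wind f C p - wind f C (nxt f p) = (\<Sum>u\<in>C. of_bool (nxt f u \<in> S) - of_bool (u \<in> S))"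
      unfolding wind_def sum_subtractf [symmetric] by (intro sum.cong refl)
    then show ?thesis using sum_of_bool_permute [OF bij_C finite_C] by simp
  qed
qed

text \<open>Rays point upwards, so some edge of \<open>C\<close> has its midpoint above
  \<open>p\<close>. This is what makes the descent terminate.\<close>

lemma wind_height:
  assumes "wind f C p \<noteq> 0"
  shows "Y p < Max (Y ` C)"
proof -
  obtain u where u: "u \<in> C" "cr p u (nxt f u) \<noteq> 0"
    using assms unfolding wind_def by (meson sum.not_neutral_contains_not_neutral)
  then have "2 * Y p < Y u + Y (nxt f u)" unfolding cr_def by auto
  moreover have "nxt f u \<in> C" using u(1) by (rule nxt_C)
  then have "Y u \<le> Max (Y ` C)" "Y (nxt f u) \<le> Max (Y ` C)"
    using u(1) finite_C by simp_all
  ultimately show ?thesis by linarith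
qed

text \<open>Otherwise a highest vertex of \<open>C\<close> is reached from below and left downwards,
  both times as the upper corner of a lozenge. A vertex is the upper corner of at most one lozenge,
  so \<open>f\<close> would take the same value at two vertices.\<close>

lemma ac_step_exists: "\<exists>u\<in>C. u \<in> ac_verts (f u)"
proof (rule ccontr)
  assume no: "\<not> (\<exists>u\<in>C. u \<in> ac_verts (f u))"
  have "Max (Y ` C) \<in> Y ` C" using finite_C C(2) by simp
  then obtain u where u: "u \<in> C" "Max (Y ` C) = Y u" by blast
  then have max: "Y w \<le> Y u" if "w \<in> C" for w
    using that finite_C unfolding u(2) [symmetric] by (intro Max_ge) auto
  obtain u0 where u0: "u0 \<in> C" "nxt f u0 = u" using u(1) by (subst (asm) C(3) [symmetric]) (erule imageE, simp)
  have "u \<in> Vert v t" "u \<notin> R0 v t" "u0 \<in> Vert v t" "u0 \<notin> R0 v t" using u(1) u0(1) C(1) by auto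
  note V = this
  from f V(1,2) have "b_vert (f u) = u"
  proof (cases rule: nxt_cases)
    case up
    have "nxt f u \<in> C" using u(1) by (rule nxt_C)
    then show ?thesis using max [of "nxt f u"] up Y_b_d [OF C_D(1) [OF u(1)]] by simp
  next
    case ac
    then show ?thesis using no u(1) by blast
  qed
  moreover from f V(3,4) have "b_vert (f u0) = u"
  proof (cases rule: nxt_cases)
    case down
    then show ?thesis using max [OF u0(1)] Y_b_d [OF C_D(1) [OF u0(1)]] u0(2) by simp
  next
    case up
    then show ?thesis using u0(2) by simp
  next
    case ac
    then show ?thesis using no u0(1) by blast
  qed
  ultimately have "f u = f u0" using b_vert_inj C_D(1) u(1) u0(1) by metis
  then have "u = u0" using C(1) u(1) u0(1) by (intro C_inj) auto
  then show False using C_D(4) [OF u(1)] u0(2) by simp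
qed

text \<open>A flat step of \<open>C\<close> is the only edge of \<open>C\<close> in its lozenge and
  hence the only one separating the upper from the lower corner. Their winding numbers differ, so
  one of them is nonzero.\<close>

lemma wind_nonzero: "\<exists>p\<in>Vert v t. green p \<noteq> g \<and> wind f C p \<noteq> 0"
proof -
  obtain u where u: "u \<in> C" "u \<in> ac_verts (f u)" using ac_step_exists by blast
  note L = C_D(1) [OF u(1)]
  have ac: "ac_verts (f u) = {u, nxt f u}"
  proof -
    have "u \<in> Vert v t" "u \<notin> R0 v t" using u(1) C(1) by auto
    with f show ?thesis
    proof (cases rule: nxt_cases)
      case down
      then show ?thesis using u(2) bd_not_ac(1) [of "f u"] by simp
    next
      case up
      then show ?thesis using u(2) bd_not_ac(2) [of "f u"] by simp
    qed
  qed
  have gr: "green (b_vert (f u)) \<noteq> g" "green (d_vert (f u)) \<noteq> g"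
    using green_ac(1) [OF L u(2)] green_ac(2) [OF L] mono [OF u(1)] by simp_all
  have "cr (b_vert (f u)) w (nxt f w) = cr (d_vert (f u)) w (nxt f w)" if "w \<in> C - {u}" for w
  proof -
    have w: "w \<in> C" "w \<noteq> u" using that by auto
    then have "f w \<noteq> f u" using C(1) u(1) C_inj [OF w(1), of u] by auto
    then show ?thesis using cr_bd [OF C_D(1) [OF w(1)] L _ C_D(3) [OF w(1)]] mono [OF w(1)] gr by blast
  qed
  then have "(\<Sum>w\<in>C - {u}. cr (b_vert (f u)) w (nxt f w)) = (\<Sum>w\<in>C - {u}. cr (d_vert (f u)) w (nxt f w))"
    by (intro sum.cong refl)
  moreover have "cr (b_vert (f u)) u (nxt f u) \<noteq> cr (d_vert (f u)) u (nxt f u)"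
    by (rule cr_own [OF L ac C_D(4) [OF u(1), symmetric]])
  ultimately have "wind f C (b_vert (f u)) \<noteq> wind f C (d_vert (f u))"
    unfolding wind_def sum.remove [OF finite_C u(1)] by simp
  then have "wind f C (b_vert (f u)) \<noteq> 0 \<or> wind f C (d_vert (f u)) \<noteq> 0" by auto
  moreover have "b_vert (f u) \<in> Vert v t" "d_vert (f u) \<in> Vert v t"
    using Vert_loz [OF L] loz_verts_eq [OF L] by auto
  ultimately show ?thesis using gr by blast
qed

end

lemma no_closed_monochromatic:
  assumes f: "orientation f" and J: "J \<subseteq> Vert v t - R0 v t" "J \<noteq> {}" "nxt f ` J \<subseteq> J"
    and g: "\<And>u. u \<in> J \<Longrightarrow> green u \<longleftrightarrow> g"
  shows False
  using J g
\<comment> \<open>Subtracting the least height of all vertices turns the maximal height into a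
  natural number; as \<open>I\<close> consists of vertices, \<open>nat\<close> truncates nothing
  there.\<close>
proof (induction "nat (Max (Y ` J) - Min (Y ` Vert v t))" arbitrary: J g rule: less_induct)
  case less
  have fin: "finite J" using less.prems(1) finite_Vert finite_subset by blast
  obtain C where CJ: "C \<subseteq> J" "C \<noteq> {}" "nxt f ` C = C"
    using closed_contains_permuted [OF fin less.prems(2,3)] .
  have C: "C \<subseteq> Vert v t - R0 v t" "\<And>u. u \<in> C \<Longrightarrow> green u \<longleftrightarrow> g" using CJ(1) less.prems(1,4) by blast+
  note C' = f C(1) CJ(2,3) C(2)
  define I where "I = {p \<in> Vert v t. green p \<noteq> g \<and> wind f C p \<noteq> 0}"
  have I: "I \<subseteq> Vert v t - R0 v t" using wind_root [OF C'] unfolding I_def by blast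
  have "I \<noteq> {}" using wind_nonzero [OF C'] unfolding I_def by blast
  moreover have "nxt f ` I \<subseteq> I"
  proof
    fix q assume "q \<in> nxt f ` I"
    then obtain p where p: "p \<in> I" "q = nxt f p" by blast
    then have "p \<in> Vert v t" "p \<notin> R0 v t" "green p \<noteq> g" "wind f C p \<noteq> 0" using I unfolding I_def by auto
    then show "q \<in> I" unfolding p(2) I_def
      using orientationD(3,6) [OF f, of p] wind_nxt [OF C', of p] by simp
  qed
  moreover have "nat (Max (Y ` I) - Min (Y ` Vert v t)) < nat (Max (Y ` J) - Min (Y ` Vert v t))"
  proof -
    have finI: "finite I" unfolding I_def using finite_Vert by simp
    then have "Max (Y ` I) \<in> Y ` I" using \<open>I \<noteq> {}\<close> by simp
    then obtain p where p: "p \<in> I" "Max (Y ` I) = Y p" by blast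
    have "Y p < Max (Y ` C)" using wind_height [OF C'] p(1) unfolding I_def by blast
    also have "\<dots> \<le> Max (Y ` J)" using CJ fin by (intro Max_mono) auto
    finally have "Max (Y ` I) < Max (Y ` J)" using p(2) by simp
    moreover have "Min (Y ` Vert v t) \<le> Y p" using p(1) finite_Vert unfolding I_def by simp
    ultimately show ?thesis using p(2) by simp
  qed
  ultimately show False using less.hyps [OF _ I, of "\<not> g"] unfolding I_def by blast
qed

lemma no_closed:
  assumes f: "orientation f" and J: "J \<subseteq> Vert v t - R0 v t" "J \<noteq> {}" "nxt f ` J \<subseteq> J"
  shows False
proof -
  obtain u where u: "u \<in> J" using J(2) by blast
  let ?K = "{w \<in> J. green w \<longleftrightarrow> green u}"
  have "nxt f w \<in> ?K" if "w \<in> ?K" for w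
    using that J(1,3) orientationD(6) [OF f, of w] by auto
  then have "nxt f ` ?K \<subseteq> ?K" by blast
  then show False using J(1) u no_closed_monochromatic [OF f, of ?K "green u"] by blast
qed

end

section \<open>Disjoint paths do not cross\<close>

text \<open>Turns sums over the arcs of a path into sums over its vertices and supplies the unique
  arc out of and into a vertex.\<close>

lemma (in pair_wf_digraph) apath_bij_betw:
  assumes "apath u p w"
  shows "bij_betw fst (set p) (set (awalk_verts u p) - {w})"
    and "bij_betw snd (set p) (set (awalk_verts u p) - {u})"
proof -
  have "bij_betw fst (set p) (set (awalk_verts u p) - {w}) \<and>
    bij_betw snd (set p) (set (awalk_verts u p) - {u})"
    using assms
  proof (induction p arbitrary: u)
    case Nil
    then show ?case by (simp add: apath_Nil_iff bij_betw_def)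
  next
    case (Cons e es)
    let ?W = "set (awalk_verts (snd e) es)"
    have e: "fst e = u" "apath (snd e) es w" "u \<notin> ?W"
      using Cons.prems by (auto simp: apath_Cons_iff)
    note IH = Cons.IH [OF e(2)]
    have W: "snd e \<in> ?W" "w \<in> ?W"
      using e(2) awends_of_awalk(2) [of "snd e" es w] hd_in_awalk_verts(2) [OF e(2)]
      by (auto simp: apath_def)
    have ne: "e \<notin> set es"
      using IH e(1,3) unfolding bij_betw_def by blast
    have "bij_betw fst (insert e (set es)) (insert (fst e) (?W - {w}))"
      using IH ne e W by (intro bij_betw_combine [of fst "{e}" "{fst e}", simplified]) auto
    moreover have "insert (fst e) (?W - {w}) = insert u ?W - {w}" using e W by auto
    moreover have "bij_betw snd (insert e (set es)) (insert (snd e) (?W - {snd e}))"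
      using IH ne e W by (intro bij_betw_combine [of snd "{e}" "{snd e}", simplified]) auto
    moreover have "insert (snd e) (?W - {snd e}) = insert u ?W - {u}" using e W by auto
    ultimately show ?case using e(1) by simp
  qed
  then show "bij_betw fst (set p) (set (awalk_verts u p) - {w})"
    "bij_betw snd (set p) (set (awalk_verts u p) - {u})" by blast+
qed

lemma (in pair_wf_digraph) apath_telescope:
  fixes g :: "'a \<Rightarrow> int"
  assumes "apath u p w"
  shows "(\<Sum>e\<in>set p. g (fst e) - g (snd e)) = g u - g w"
proof -
  let ?W = "set (awalk_verts u p)"
  have W: "u \<in> ?W" "w \<in> ?W"
    using assms hd_in_awalk_verts(2) [OF assms]
    by (auto simp: apath_def)
  have "(\<Sum>e\<in>set p. g (fst e) - g (snd e)) = sum g (?W - {w}) - sum g (?W - {u})"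
    using sum.reindex_bij_betw [OF apath_bij_betw(1) [OF assms], of g]
      sum.reindex_bij_betw [OF apath_bij_betw(2) [OF assms], of g] by (simp add: sum_subtractf)
  then show ?thesis using W by (simp add: sum_diff1)
qed

text \<open>(D, E) is the position of the first step relative to the second; (x, y) and (i, j) are
  their displacements. Steps fall by at most two rows, so every term vanishes unless E is between -2
  and 2. The last two hypotheses exclude the only way in which such steps cross without sharing an
  end: a vertical step of two rows over a horizontal step in the middle row.\<close>

lemma crossing_difference_0:
  fixes D E x y i j :: int
  assumes "(x, y) \<in> {(1, 0), (-1, 0), (1, -1), (0, -1), (1, -2)}"
    and "(i, j) \<in> {(1, 0), (-1, 0), (1, -1), (0, -1), (1, -2)}"
    and "D \<noteq> 0 \<or> E \<noteq> 0" "D \<noteq> i \<or> E \<noteq> j" "D + x \<noteq> 0 \<or> E + y \<noteq> 0" "D + x \<noteq> i \<or> E + y \<noteq> j"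
    and "\<not> (y = - 2 \<and> j = 0 \<and> E = 1 \<and> (D = 0 \<or> D = -1) \<and> (i = D \<or> i = D + 1))"
    and "\<not> (j = - 2 \<and> y = 0 \<and> E = - 1 \<and> (D = 0 \<or> D = 1) \<and> (D + x = 0 \<or> D + x = 1))"
  shows "of_bool (0 < E \<and> E + y \<le> 0 \<and> 0 < E + y + 2 * (D + x))
      - of_bool (j < E \<and> E + y \<le> j \<and> j + 2 * i < E + y + 2 * (D + x))
    = (of_bool (j < E + y \<and> E + y \<le> 0 \<and> 0 < E + y + 2 * (D + x))
      - of_bool (j < E \<and> E \<le> 0 \<and> 0 < E + 2 * D) :: int)"
proof -
  consider "E \<le> -3 \<or> 3 \<le> E" | "E = -2" | "E = -1" | "E = 0" | "E = 1" | "E = 2" by linarith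
  note E = this
  from assms(1,2) show ?thesis
    apply (simp only: insert_iff empty_iff prod.inject simp_thms)
    apply (elim disjE conjE)
    apply (rule E; insert assms(3-8); simp; presburger?)+
    done
qed

lemma crossing_difference:
  fixes i1 i2 i3 i4 j1 j2 j3 j4 :: int
  assumes "(i2 - i1, j2 - j1) \<in> {(1, 0), (-1, 0), (1, -1), (0, -1), (1, -2)}"
    and "(i4 - i3, j4 - j3) \<in> {(1, 0), (-1, 0), (1, -1), (0, -1), (1, -2)}"
    and "i1 \<noteq> i3 \<or> j1 \<noteq> j3" "i1 \<noteq> i4 \<or> j1 \<noteq> j4" "i2 \<noteq> i3 \<or> j2 \<noteq> j3" "i2 \<noteq> i4 \<or> j2 \<noteq> j4"
    and "\<not> (j2 = j1 - 2 \<and> j4 = j3 \<and> j3 = j1 - 1 \<and> (i3 = i1 \<or> i3 = i1 + 1))"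
    and "\<not> (j4 = j3 - 2 \<and> j2 = j1 \<and> j1 = j3 - 1 \<and> (i1 = i3 \<or> i1 = i3 + 1))"
  shows "of_bool (j3 < j1 \<and> j2 \<le> j3 \<and> j3 + 2 * i3 < j2 + 2 * i2)
      - of_bool (j4 < j1 \<and> j2 \<le> j4 \<and> j4 + 2 * i4 < j2 + 2 * i2)
    = (of_bool (j4 < j2 \<and> j2 \<le> j3 \<and> j3 + 2 * i3 < j2 + 2 * i2)
      - of_bool (j4 < j1 \<and> j1 \<le> j3 \<and> j3 + 2 * i3 < j1 + 2 * i1) :: int)"
proof -
  let ?D = "i1 - i3" and ?E = "j1 - j3" and ?x = "i2 - i1" and ?y = "j2 - j1" and ?i = "i4 - i3" and ?j = "j4 - j3"
  have *: "of_bool (0 < ?E \<and> ?E + ?y \<le> 0 \<and> 0 < ?E + ?y + 2 * (?D + ?x))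
      - of_bool (?j < ?E \<and> ?E + ?y \<le> ?j \<and> ?j + 2 * ?i < ?E + ?y + 2 * (?D + ?x))
    = (of_bool (?j < ?E + ?y \<and> ?E + ?y \<le> 0 \<and> 0 < ?E + ?y + 2 * (?D + ?x))
      - of_bool (?j < ?E \<and> ?E \<le> 0 \<and> 0 < ?E + 2 * ?D) :: int)"
  proof (rule crossing_difference_0 [OF assms(1,2)])
    show "?D \<noteq> 0 \<or> ?E \<noteq> 0" using assms(3) by simp
    show "?D \<noteq> ?i \<or> ?E \<noteq> ?j" using assms(4) by simp
    show "?D + ?x \<noteq> 0 \<or> ?E + ?y \<noteq> 0" using assms(5) by simp
    show "?D + ?x \<noteq> ?i \<or> ?E + ?y \<noteq> ?j" using assms(6) by simp
    show "\<not> (?y = - 2 \<and> ?j = 0 \<and> ?E = 1 \<and> (?D = 0 \<or> ?D = -1) \<and> (?i = ?D \<or> ?i = ?D + 1))"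
    proof (intro notI, elim conjE)
      assume *: "?y = - 2" "?j = 0" "?E = 1" "?D = 0 \<or> ?D = -1"
      have "j2 = j1 - 2" "j4 = j3" "j3 = j1 - 1" using *(1-3) by simp_all
      moreover have "i3 = i1 \<or> i3 = i1 + 1" using *(4) by presburger
      ultimately show False using assms(7) by blast
    qed
    show "\<not> (?j = - 2 \<and> ?y = 0 \<and> ?E = - 1 \<and> (?D = 0 \<or> ?D = 1) \<and> (?D + ?x = 0 \<or> ?D + ?x = 1))"
    proof (intro notI, elim conjE)
      assume *: "?j = - 2" "?y = 0" "?E = - 1" "?D = 0 \<or> ?D = 1"
      have "j4 = j3 - 2" "j2 = j1" "j1 = j3 - 1" using *(1-3) by simp_all
      moreover have "i1 = i3 \<or> i1 = i3 + 1" using *(4) by presburger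
      ultimately show False using assms(8) by blast
    qed
  qed
  have A: "0 < ?E \<longleftrightarrow> j3 < j1"
    "?E + ?y \<le> 0 \<longleftrightarrow> j2 \<le> j3"
    "0 < ?E + ?y + 2 * (?D + ?x) \<longleftrightarrow> j3 + 2 * i3 < j2 + 2 * i2"
    "?j < ?E \<longleftrightarrow> j4 < j1"
    "?E + ?y \<le> ?j \<longleftrightarrow> j2 \<le> j4"
    "?j + 2 * ?i < ?E + ?y + 2 * (?D + ?x) \<longleftrightarrow> j4 + 2 * i4 < j2 + 2 * i2"
    "?j < ?E + ?y \<longleftrightarrow> j4 < j2"
    "?E \<le> 0 \<longleftrightarrow> j1 \<le> j3"
    "0 < ?E + 2 * ?D \<longleftrightarrow> j3 + 2 * i3 < j1 + 2 * i1"
    by (simp_all add: algebra_simps)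
  show ?thesis using * by (simp only: A)
qed

section \<open>Crossing numbers of paths in the network\<close>

context lozenge_triangle begin

text \<open>The digraph does not depend on the weights, so the indeterminates get an arbitrary value
  here; \<open>net_graph_N_tilde\<close> covers all others.\<close>

definition net :: "net_vertex pair_pre_digraph" where
  "net = net_graph (N_tilde (\<lambda>_. 0 :: real) v t)"

lemma net_graph_N_tilde: "net_graph (N_tilde x v t) = net"
  by (simp add: net_def N_tilde_def)

lemma loz_verts_d:
  assumes "L \<in> lozenges_in v t"
  shows "loz_verts L - {d_vert L} = insert (b_vert L) (ac_verts L)"
  using Y_b_d [OF assms] bd_not_ac [of L] unfolding loz_verts_eq [OF assms] by auto

lemma net_arcs: "parcs net =
  (\<Union>L\<in>lozenges_in v t. (\<lambda>u. (Lattice u, Center L)) ` (loz_verts L - {d_vert L}) \<union> {(Center L, Lattice (d_vert L))})"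
proof -
  have "{(Lattice u, Center L) | u. u \<in> ac_verts L} \<union> {(Lattice (b_vert L), Center L), (Center L, Lattice (d_vert L))}
    = (\<lambda>u. (Lattice u, Center L)) ` (loz_verts L - {d_vert L}) \<union> {(Center L, Lattice (d_vert L))}"
    if "L \<in> lozenges_in v t" for L
    unfolding loz_verts_d [OF that] by blast
  then show ?thesis unfolding net_def N_tilde_def by simp
qed

lemma net_arc_Lattice:
  "(Lattice u, y) \<in> parcs net \<longleftrightarrow> (\<exists>L\<in>lozenges_in v t. u \<in> loz_verts L \<and> u \<noteq> d_vert L \<and> y = Center L)"
  unfolding net_arcs by blast

lemma net_arc_Center:
  "(Center L, y) \<in> parcs net \<longleftrightarrow> L \<in> lozenges_in v t \<and> y = Lattice (d_vert L)"
  unfolding net_arcs by blast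

lemma net_verts: "pverts net = Lattice ` Vert v t \<union> Center ` lozenges_in v t"
  by (simp add: net_def N_tilde_def)

lemma net_wf: "pair_wf_digraph net"
proof
  fix e assume "e \<in> parcs net"
  then obtain L where L: "L \<in> lozenges_in v t"
    and e: "(\<exists>u. u \<in> loz_verts L \<and> e = (Lattice u, Center L)) \<or> e = (Center L, Lattice (d_vert L))"
    unfolding net_arcs by blast
  have "Center L \<in> pverts net" using L unfolding net_verts by simp
  moreover have V: "Lattice u \<in> pverts net" if "u \<in> loz_verts L" for u
    using Vert_loz [OF L that] unfolding net_verts by simp
  moreover have "Lattice (d_vert L) \<in> pverts net" by (rule V) (simp add: loz_verts_eq [OF L])
  ultimately show "fst e \<in> pverts net" "snd e \<in> pverts net"
    using e by (elim disjE exE conjE; simp)+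
qed

lemma X_P0: "u \<in> P0 \<Longrightarrow> X u = Y u + 2 * fst u"
  by (auto simp: X_def Y_def P0_def)

lemma P0_eq_iff: "u \<in> P0 \<Longrightarrow> w \<in> P0 \<Longrightarrow> u = w \<longleftrightarrow> fst u = fst w \<and> Y u = Y w"
  by (auto simp: Y_def P0_def prod_eq_iff)

lemma fst_pt: "fst (pt a b c) = fst v + b - a"
  by (simp add: pt_def)

lemma loz_verts_P0: "u \<in> loz_verts L \<Longrightarrow> u \<in> P0"
  by (simp add: loz_verts_def)

lemma d_vert_loz: "L \<in> lozenges_in v t \<Longrightarrow> d_vert L \<in> loz_verts L"
  using loz_verts_eq by blast

text \<open>In the coordinates \<open>fst\<close> and \<open>Y\<close> a step is horizontal, goes
  down one row, or goes straight down two rows. That the first and the last kind start at green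
  vertices is what prevents steps from crossing.\<close>

lemma step_shape:
  assumes "L \<in> lozenges_in v t" "u \<in> loz_verts L" "u \<noteq> d_vert L"
  shows "(fst (d_vert L) - fst u, Y (d_vert L) - Y u) \<in> {(1, 0), (-1, 0), (1, -1), (0, -1), (1, -2)}"
    and "Y (d_vert L) = Y u \<or> Y (d_vert L) = Y u - 2 \<Longrightarrow> green u"
proof -
  have u: "u = b_vert L \<or> u \<in> ac_verts L" using assms loz_verts_d [OF assms(1)] by blast
  obtain a b c where c: "cell a b c" and L:
    "b_vert L = pt a b c \<and> d_vert L = pt a (b + 1) c \<and>
       ac_verts L = {pt (a + 1) (b + 1) c, pt a (b + 1) (c + 1)} \<or>
     b_vert L = pt a b (c + 1) \<and> d_vert L = pt a b c \<and>
       ac_verts L = {pt (a + 1) b (c + 1), pt a (b + 1) (c + 1)} \<or>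
     b_vert L = pt (a + 1) b (c + 1) \<and> d_vert L = pt (a + 1) (b + 1) c \<and>
       ac_verts L = {pt (a + 1) b c, pt a b c}"
    using lozenge_coords [OF assms(1)] by blast
  have s: "a + b + c = int t - 2" using c by (simp add: cell_def)
  have "(fst (d_vert L) - fst u, Y (d_vert L) - Y u) \<in> {(1, 0), (-1, 0), (1, -1), (0, -1), (1, -2)} \<and>
    (Y (d_vert L) = Y u \<or> Y (d_vert L) = Y u - 2 \<longrightarrow> green u)"
    using L u s by (elim disjE conjE) (auto simp: fst_pt Y_pt green_pt)
  then show "(fst (d_vert L) - fst u, Y (d_vert L) - Y u) \<in> {(1, 0), (-1, 0), (1, -1), (0, -1), (1, -2)}"
    "Y (d_vert L) = Y u \<or> Y (d_vert L) = Y u - 2 \<Longrightarrow> green u" by blast+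
qed

text \<open>A vertical step of two rows starts at a green vertex and passes between the two points
  below it; a horizontal step joining these would also have to start at a green one.\<close>

lemma not_green_below:
  assumes "u \<in> P0" "w \<in> P0" "green u" "Y w = Y u - 1" "fst w = fst u \<or> fst w = fst u + 1"
  shows "\<not> green w"
proof -
  obtain i j k where u: "u = (i, j, k)" by (cases u)
  have "w = (i, j - 1, k + 1) \<or> w = (i + 1, j - 1, k)"
    using assms(1,2,4,5) by (auto simp: u P0_def Y_def)
  moreover have "(j - k) mod 3 = 1" using assms(3) by (simp add: u color_def)
  then have "(j - k - 2) mod 3 \<noteq> 1" "(j - k - 1) mod 3 \<noteq> 1" by presburger+
  ultimately show ?thesis by (auto simp: color_def algebra_simps)
qed

text \<open>The step from \<open>u\<close> through \<open>e\<^sub>L\<close> to \<open>d\<^sub>L\<close> crosses the horizontal ray from \<open>q\<close> to the right,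
  shifted slightly upwards.\<close>

definition crossing :: "lattice_point \<Rightarrow> net_vertex \<times> net_vertex \<Rightarrow> int" where
  "crossing q e = (case e of (Lattice u, Center L) \<Rightarrow>
     of_bool (Y q < Y u \<and> Y (d_vert L) \<le> Y q \<and> X q < X (d_vert L)) | _ \<Rightarrow> 0)"

text \<open>A centre takes the value of the lower corner it leads to: the arc leaving it contributes
  nothing, and telescoping over arcs becomes telescoping over steps.\<close>

definition node_val :: "lattice_point set \<Rightarrow> net_vertex \<Rightarrow> int" where
  "node_val S y = (case y of Lattice u \<Rightarrow> of_bool (u \<in> S) | Center L \<Rightarrow> of_bool (d_vert L \<in> S))"

text \<open>\<open>S\<close> is the region between the two horizontal rays, to the right of
  \<open>q\<close>. A step disjoint from the one through \<open>M\<close> enters the region across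
  the upper ray and leaves it across the lower one.\<close>

lemma crossing_step:
  assumes L: "L \<in> lozenges_in v t" "u \<in> loz_verts L" "u \<noteq> d_vert L"
    and M: "M \<in> lozenges_in v t" "q \<in> loz_verts M" "q \<noteq> d_vert M"
    and ne: "u \<noteq> q" "u \<noteq> d_vert M" "d_vert L \<noteq> q" "d_vert L \<noteq> d_vert M"
  defines "S \<equiv> {z. Y (d_vert M) < Y z \<and> Y z \<le> Y q \<and> X q < X z}"
  shows "crossing q (Lattice u, Center L) - crossing (d_vert M) (Lattice u, Center L)
    = of_bool (d_vert L \<in> S) - of_bool (u \<in> S)"
proof -
  have P0: "u \<in> P0" "d_vert L \<in> P0" "q \<in> P0" "d_vert M \<in> P0"
    using loz_verts_P0 d_vert_loz L M by blast+
  have 7: "\<not> (Y (d_vert L) = Y u - 2 \<and> Y (d_vert M) = Y q \<and> Y q = Y u - 1 \<and> (fst q = fst u \<or> fst q = fst u + 1))"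
    using not_green_below [OF P0(1,3)] step_shape(2) [OF L] step_shape(2) [OF M] by blast
  have 8: "\<not> (Y (d_vert M) = Y q - 2 \<and> Y (d_vert L) = Y u \<and> Y u = Y q - 1 \<and> (fst u = fst q \<or> fst u = fst q + 1))"
    using not_green_below [OF P0(3,1)] step_shape(2) [OF L] step_shape(2) [OF M] by blast
  have ne': "fst u \<noteq> fst q \<or> Y u \<noteq> Y q" "fst u \<noteq> fst (d_vert M) \<or> Y u \<noteq> Y (d_vert M)"
    "fst (d_vert L) \<noteq> fst q \<or> Y (d_vert L) \<noteq> Y q"
    "fst (d_vert L) \<noteq> fst (d_vert M) \<or> Y (d_vert L) \<noteq> Y (d_vert M)"
    using ne P0_eq_iff P0 by blast+
  show ?thesis
    using crossing_difference [OF step_shape(1) [OF L] step_shape(1) [OF M] ne' 7 8]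
    unfolding crossing_def S_def by (simp add: X_P0 P0)
qed

lemma net_path_arcs:
  assumes "is_path net x p y"
  shows "set p \<subseteq> parcs net"
  using assms by (simp add: pre_digraph.apath_def pre_digraph.awalk_def)

lemma net_path_ends:
  assumes "is_path net x p y"
  shows "x \<in> path_verts net x p" "y \<in> path_verts net x p"
proof -
  interpret N: pair_wf_digraph net by (rule net_wf)
  show "x \<in> path_verts net x p"
    using N.hd_in_awalk_verts(2) [OF assms] by simp
  have "last (pawalk_verts x p) = y" "pawalk_verts x p \<noteq> []"
    using assms N.awlast_of_awalk N.awalk_verts_non_Nil unfolding pre_digraph.apath_def by blast+
  then show "y \<in> path_verts net x p"
    unfolding awalk_verts_with_proj_eq using last_in_set by metis
qed

lemma net_path_fst:
  assumes "is_path net x p y" shows "fst ` set p = path_verts net x p - {y}"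
proof -
  interpret N: pair_wf_digraph net by (rule net_wf)
  show ?thesis using N.apath_bij_betw(1) [OF assms] by (simp add: bij_betw_def)
qed

lemma net_path_snd:
  assumes "is_path net x p y" shows "snd ` set p = path_verts net x p - {x}"
proof -
  interpret N: pair_wf_digraph net by (rule net_wf)
  show ?thesis using N.apath_bij_betw(2) [OF assms] by (simp add: bij_betw_def)
qed

lemma net_path_Center:
  assumes p: "is_path net (Lattice s) p (Lattice e)" and c: "(Lattice u, Center L) \<in> set p"
  shows "(Center L, Lattice (d_vert L)) \<in> set p"
    "Lattice u \<in> path_verts net (Lattice s) p" "Lattice (d_vert L) \<in> path_verts net (Lattice s) p"
proof -
  have "Center L \<in> fst ` set p"
    using net_path_snd [OF p] c unfolding net_path_fst [OF p] by force
  then obtain y where y: "(Center L, y) \<in> set p" by force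
  then have "y = Lattice (d_vert L)" using net_path_arcs [OF p] net_arc_Center by blast
  with y show c': "(Center L, Lattice (d_vert L)) \<in> set p" by simp
  show "Lattice u \<in> path_verts net (Lattice s) p" using net_path_fst [OF p] c by force
  show "Lattice (d_vert L) \<in> path_verts net (Lattice s) p" using net_path_snd [OF p] c' by force
qed

lemma net_path_cases:
  assumes "is_path net (Lattice q) r (Lattice b)"
  obtains "r = []" "q = b"
    | M r' where "M \<in> lozenges_in v t" "q \<in> loz_verts M" "q \<noteq> d_vert M"
      "r = (Lattice q, Center M) # (Center M, Lattice (d_vert M)) # r'"
      "is_path net (Lattice (d_vert M)) r' (Lattice b)"
      "path_verts net (Lattice q) r = {Lattice q, Center M} \<union> path_verts net (Lattice (d_vert M)) r'"
proof -
  interpret N: pair_wf_digraph net by (rule net_wf)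
  show thesis
  proof (cases r)
    case Nil
    then show thesis using assms that(1) by (simp add: N.apath_Nil_iff)
  next
    case (Cons e r1)
    then have e: "e \<in> parcs net" "fst e = Lattice q" and r1: "is_path net (snd e) r1 (Lattice b)"
      using assms by (simp_all add: N.apath_Cons_iff)
    from e obtain M where M: "M \<in> lozenges_in v t" "q \<in> loz_verts M" "q \<noteq> d_vert M" "e = (Lattice q, Center M)"
      by (cases e) (auto simp: net_arc_Lattice)
    obtain e2 r' where r1': "r1 = e2 # r'" using r1 M(4) by (cases r1) (simp_all add: N.apath_Nil_iff)
    then have e2: "e2 \<in> parcs net" "fst e2 = Center M" and r': "is_path net (snd e2) r' (Lattice b)"
      using r1 M(4) by (simp_all add: N.apath_Cons_iff)
    then have e2: "e2 = (Center M, Lattice (d_vert M))" by (cases e2) (simp add: net_arc_Center)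
    show thesis
      using that(2) [OF M(1-3), of r'] Cons r1' e2 r' M(4)
      by simp
  qed
qed

definition crossings :: "(net_vertex \<times> net_vertex) list \<Rightarrow> lattice_point \<Rightarrow> int" where
  "crossings p q = (\<Sum>e\<in>set p. crossing q e)"

text \<open>The path starts above the region of \<open>crossing_step\<close> and ends no higher than
  its lower ray, so the telescoping sum is zero.\<close>

lemma crossings_step:
  assumes p: "is_path net (Lattice s) p (Lattice e)"
    and M: "M \<in> lozenges_in v t" "q \<in> loz_verts M" "q \<noteq> d_vert M"
    and dis: "Lattice q \<notin> path_verts net (Lattice s) p" "Lattice (d_vert M) \<notin> path_verts net (Lattice s) p"
    and Y: "Y q < Y s" "Y e \<le> Y (d_vert M)"
  shows "crossings p q = crossings p (d_vert M)"
proof -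
  interpret N: pair_wf_digraph net by (rule net_wf)
  let ?S = "{z. Y (d_vert M) < Y z \<and> Y z \<le> Y q \<and> X q < X z}"
  have "crossing q a - crossing (d_vert M) a = - (node_val ?S (fst a) - node_val ?S (snd a))"
    if a: "a \<in> set p" for a
  proof -
    have "a \<in> parcs net" using a net_path_arcs [OF p] by blast
    then obtain L where L: "L \<in> lozenges_in v t"
      and "(\<exists>u. u \<in> loz_verts L \<and> u \<noteq> d_vert L \<and> a = (Lattice u, Center L)) \<or> a = (Center L, Lattice (d_vert L))"
      unfolding net_arcs by blast
    then consider u where "u \<in> loz_verts L" "u \<noteq> d_vert L" "a = (Lattice u, Center L)"
      | "a = (Center L, Lattice (d_vert L))" by blast
    then show ?thesis
    proof cases
      case 1
      note PC = net_path_Center(2,3) [OF p a [unfolded 1(3)]]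
      have "u \<noteq> q" "u \<noteq> d_vert M" "d_vert L \<noteq> q" "d_vert L \<noteq> d_vert M" using PC dis by auto
      then show ?thesis using crossing_step [OF L 1(1,2) M] by (simp add: 1(3) node_val_def)
    next
      case 2
      then show ?thesis by (simp add: crossing_def node_val_def)
    qed
  qed
  then have "crossings p q - crossings p (d_vert M) = - (\<Sum>a\<in>set p. node_val ?S (fst a) - node_val ?S (snd a))"
    unfolding crossings_def sum_subtractf [symmetric] sum_negf [symmetric] by (intro sum.cong refl)
  also have "\<dots> = - (node_val ?S (Lattice s) - node_val ?S (Lattice e))"
    using N.apath_telescope [OF p] by simp
  also have "\<dots> = 0" using Y by (simp add: node_val_def)
  finally show ?thesis by simp
qed

text \<open>Heights never increase along a path. The second conclusion belongs to the induction: it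
  gives the bound \<open>Y e \<le> Y (d_vert M)\<close> that each step needs.\<close>

lemma crossings_along_path:
  assumes p: "is_path net (Lattice s) p (Lattice e)" and r: "is_path net (Lattice q) r (Lattice b)"
    and "path_verts net (Lattice s) p \<inter> path_verts net (Lattice q) r = {}"
    and "Y q < Y s" "Y e \<le> Y b"
  shows "crossings p q = crossings p b \<and> Y b \<le> Y q"
  using r assms(3,4)
proof (induction "length r" arbitrary: q r rule: less_induct)
  case less
  interpret N: pair_wf_digraph net by (rule net_wf)
  from less.prems(1) show ?case
  proof (cases rule: net_path_cases)
    case 1
    then show ?thesis by simp
  next
    case (2 M r')
    have Yd: "Y (d_vert M) \<le> Y q" using step_shape(1) [OF 2(1-3)] by auto
    have dv: "Lattice (d_vert M) \<in> path_verts net (Lattice (d_vert M)) r'"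
      by (rule net_path_ends(1) [OF 2(5)])
    have IH: "crossings p (d_vert M) = crossings p b \<and> Y b \<le> Y (d_vert M)"
      using less.prems(2,3) 2(4-6) Yd by (intro less.hyps) auto
    moreover have "crossings p q = crossings p (d_vert M)"
      using less.prems(2,3) 2(6) dv IH assms(5) by (intro crossings_step [OF p 2(1-3)]) auto
    ultimately show ?thesis using Yd by simp
  qed
qed

text \<open>The side c = 0 bounds the triangle on the lower left, so in the row of
  \<open>b_pt v t m\<close> nothing lies further left except, for odd m, the next boundary point. A
  step passing this height ends in the row or, when it falls two rows, possibly one row below, where
  the side lies further right.\<close>

lemma right_of_sink:
  assumes L: "L \<in> lozenges_in v t" "u \<in> loz_verts L" "u \<noteq> d_vert L" and m: "m \<le> t - 1"
    and Y: "Y (b_pt v t m) < Y u" "Y (d_vert L) \<le> Y (b_pt v t m)" and X: "X (d_vert L) \<le> X (b_pt v t m)"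
  shows "d_vert L = b_pt v t m \<or> odd m \<and> d_vert L = b_pt v t (m + 1)"
proof -
  define i j where "i = int (m div 2)" and "j = int t - int ((m + 1) div 2)"
  have b: "b_pt v t m = pt i j 0" by (simp add: b_pt_eq i_def j_def)
  have ij: "i + j = (if even m then int t else int t - 1)"
    unfolding i_def j_def by (auto elim!: evenE oddE)
  have u: "u = b_vert L \<or> u \<in> ac_verts L" using L loz_verts_d [OF L(1)] by blast
  obtain a b c where c: "cell a b c" and Lc:
    "b_vert L = pt a b c \<and> d_vert L = pt a (b + 1) c \<and>
       ac_verts L = {pt (a + 1) (b + 1) c, pt a (b + 1) (c + 1)} \<or>
     b_vert L = pt a b (c + 1) \<and> d_vert L = pt a b c \<and>
       ac_verts L = {pt (a + 1) b (c + 1), pt a (b + 1) (c + 1)} \<or>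
     b_vert L = pt (a + 1) b (c + 1) \<and> d_vert L = pt (a + 1) (b + 1) c \<and>
       ac_verts L = {pt (a + 1) b c, pt a b c}"
    using lozenge_coords [OF L(1)] by blast
  have s: "a + b + c = int t - 2" "0 \<le> a" "0 \<le> b" "0 \<le> c" using c by (simp_all add: cell_def)
  have "\<exists>\<alpha> \<beta> \<gamma>. d_vert L = pt \<alpha> \<beta> \<gamma> \<and> 0 \<le> \<gamma> \<and> \<alpha> + \<beta> + \<gamma> \<le> int t \<and>
    (\<gamma> - \<beta> = - j \<or> \<gamma> - \<beta> = - j - 1 \<and> \<alpha> + \<beta> + \<gamma> = int t)"
    using Lc
  proof (elim disjE conjE)
    assume *: "b_vert L = pt a b c" "d_vert L = pt a (b + 1) c" "ac_verts L = {pt (a + 1) (b + 1) c, pt a (b + 1) (c + 1)}"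
    have "c - (b + 1) = - j" using u Y unfolding * b by (auto simp: Y_pt)
    then show ?thesis using *(2) s by (intro exI [of _ a] exI [of _ "b + 1"] exI [of _ c]) simp
  next
    assume *: "b_vert L = pt a b (c + 1)" "d_vert L = pt a b c" "ac_verts L = {pt (a + 1) b (c + 1), pt a (b + 1) (c + 1)}"
    have "c - b = - j" using u Y unfolding * b by (auto simp: Y_pt)
    then show ?thesis using *(2) s by (intro exI [of _ a] exI [of _ b] exI [of _ c]) simp
  next
    assume *: "b_vert L = pt (a + 1) b (c + 1)" "d_vert L = pt (a + 1) (b + 1) c" "ac_verts L = {pt (a + 1) b c, pt a b c}"
    have "c - (b + 1) = - j \<or> c - (b + 1) = - j - 1" using u Y unfolding * b by (auto simp: Y_pt)
    then show ?thesis using *(2) s by (intro exI [of _ "a + 1"] exI [of _ "b + 1"] exI [of _ c]) auto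
  qed
  then obtain \<alpha> \<beta> \<gamma> where d: "d_vert L = pt \<alpha> \<beta> \<gamma>" "0 \<le> \<gamma>" "\<alpha> + \<beta> + \<gamma> \<le> int t"
    "\<gamma> - \<beta> = - j \<or> \<gamma> - \<beta> = - j - 1 \<and> \<alpha> + \<beta> + \<gamma> = int t" by blast
  have X': "\<beta> + \<gamma> - 2 * \<alpha> \<le> j - 2 * i" using X unfolding d(1) b X_pt by simp
  have ij': "int t - 1 \<le> i + j" using ij by simp
  have "\<beta> = j \<and> \<gamma> = 0 \<and> (\<alpha> = i \<or> \<alpha> = i + 1 \<and> odd m)"
    using d(4)
  proof
    assume "\<gamma> - \<beta> = - j"
    then have "\<gamma> = 0" "\<beta> = j" "i \<le> \<alpha>" "\<alpha> \<le> int t - j" using X' ij' d(2,3) by linarith+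
    then show ?thesis using ij by (auto split: if_splits)
  next
    assume *: "\<gamma> - \<beta> = - j - 1 \<and> \<alpha> + \<beta> + \<gamma> = int t"
    have False using * X' ij' d(2) by linarith
    then show ?thesis ..
  qed
  moreover have "b_pt v t (m + 1) = pt (i + 1) j 0" if "odd m"
    using that by (auto simp: b_pt_eq i_def j_def add.commute elim!: oddE)
  ultimately show ?thesis unfolding d(1) b by auto
qed

text \<open>Among the conceivable lozenges with this corner and a different lower corner only one
  lies inside the triangle, and it leads along the row to the neighbouring boundary point.\<close>

lemma step_from_even_b:
  assumes L: "L \<in> lozenges_in v t" "b_pt v t (m + 1) \<in> loz_verts L" "b_pt v t (m + 1) \<noteq> d_vert L" and m: "odd m" "m \<le> t - 1"
  shows "d_vert L = b_pt v t m"
proof -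
  define i j where "i = int (m div 2)" and "j = int t - int ((m + 1) div 2)"
  have ij: "i + j = int t - 1" unfolding i_def j_def using m(1) by (auto elim!: oddE)
  have b: "b_pt v t m = pt i j 0" by (simp add: b_pt_eq i_def j_def)
  have b1: "b_pt v t (m + 1) = pt (i + 1) j 0"
    using m(1) by (auto simp: b_pt_eq i_def j_def add.commute elim!: oddE)
  have u: "pt (i + 1) j 0 = b_vert L \<or> pt (i + 1) j 0 \<in> ac_verts L"
    using L loz_verts_d [OF L(1)] unfolding b1 by blast
  have ne: "pt (i + 1) j 0 \<noteq> d_vert L" using L(3) unfolding b1 .
  obtain a b c where c: "cell a b c" and Lc:
    "b_vert L = pt a b c \<and> d_vert L = pt a (b + 1) c \<and>
       ac_verts L = {pt (a + 1) (b + 1) c, pt a (b + 1) (c + 1)} \<or>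
     b_vert L = pt a b (c + 1) \<and> d_vert L = pt a b c \<and>
       ac_verts L = {pt (a + 1) b (c + 1), pt a (b + 1) (c + 1)} \<or>
     b_vert L = pt (a + 1) b (c + 1) \<and> d_vert L = pt (a + 1) (b + 1) c \<and>
       ac_verts L = {pt (a + 1) b c, pt a b c}"
    using lozenge_coords [OF L(1)] by blast
  have s: "a + b + c = int t - 2" "0 \<le> a" "0 \<le> b" "0 \<le> c" using c by (simp_all add: cell_def)
  show ?thesis using Lc u ne s ij unfolding b by (elim disjE conjE) (auto simp: pt_inj)
qed

lemma Y_a_pt: "Y (a_pt v t (2 * i)) = Y v + int t - 2 * int i"
  by (simp add: a_pt_eq Y_pt)

lemma Y_b_pt: "Y (b_pt v t m) = Y v + int ((m + 1) div 2) - int t"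
  by (simp add: b_pt_eq Y_pt)

lemma X_a_pt_max:
  assumes "L \<in> lozenges_in v t" "u \<in> loz_verts L"
  shows "X u \<le> X (a_pt v t (2 * i))"
proof -
  have "u = b_vert L \<or> u = d_vert L \<or> u \<in> ac_verts L" using assms loz_verts_eq by blast
  moreover obtain a b c where c: "cell a b c" and Lc:
    "b_vert L = pt a b c \<and> d_vert L = pt a (b + 1) c \<and>
       ac_verts L = {pt (a + 1) (b + 1) c, pt a (b + 1) (c + 1)} \<or>
     b_vert L = pt a b (c + 1) \<and> d_vert L = pt a b c \<and>
       ac_verts L = {pt (a + 1) b (c + 1), pt a (b + 1) (c + 1)} \<or>
     b_vert L = pt (a + 1) b (c + 1) \<and> d_vert L = pt (a + 1) (b + 1) c \<and>
       ac_verts L = {pt (a + 1) b c, pt a b c}"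
    using lozenge_coords [OF assms(1)] by blast
  moreover have "a + b + c = int t - 2" "0 \<le> a" using c by (simp_all add: cell_def)
  ultimately show ?thesis unfolding a_pt_eq by (elim disjE conjE) (auto simp: X_pt)
qed

text \<open>Otherwise m < m'. At the start of \<open>r\<close>, on the right-hand side of the
  triangle, \<open>p\<close> cannot cross the ray. At the end of \<open>r\<close>, \<open>p\<close>
  has passed that height, and it can do so only to the right of the boundary point. The counts 0 and
  1 contradict constancy along \<open>r\<close>.\<close>

lemma noncrossing:
  assumes p: "is_path net (Lattice (a_pt v t (2 * i))) p (Lattice (b_pt v t m))"
    and r: "is_path net (Lattice (a_pt v t (2 * i'))) r (Lattice (b_pt v t m'))"
    and dis: "path_verts net (Lattice (a_pt v t (2 * i))) p \<inter> path_verts net (Lattice (a_pt v t (2 * i'))) r = {}"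
    and i: "i < i'" and m': "m' \<le> t - 1"
  shows "m' < m"
proof (rule ccontr)
  assume "\<not> m' < m"
  interpret N: pair_wf_digraph net by (rule net_wf)
  let ?q = "a_pt v t (2 * i')" and ?b = "b_pt v t m'" and ?s = "a_pt v t (2 * i)" and ?e = "b_pt v t m"
  have ends: "Lattice ?b \<in> path_verts net (Lattice ?q) r" "Lattice ?e \<in> path_verts net (Lattice ?s) p"
    by (rule net_path_ends(2) [OF r], rule net_path_ends(2) [OF p])
  then have "m \<noteq> m'" using dis by auto
  with \<open>\<not> m' < m\<close> have mm: "m < m'" by simp
  have Ye: "Y ?e \<le> Y ?b" using mm unfolding Y_b_pt by (simp add: div_le_mono)
  have Ys: "Y ?q < Y ?s" using i unfolding Y_a_pt by simp
  have main: "crossings p ?q = crossings p ?b \<and> Y ?b \<le> Y ?q"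
    by (rule crossings_along_path [OF p r dis Ys Ye])
  have arc: "\<exists>L\<in>lozenges_in v t. (\<exists>u. u \<in> loz_verts L \<and> u \<noteq> d_vert L \<and> a = (Lattice u, Center L)) \<or>
    a = (Center L, Lattice (d_vert L))" if "a \<in> set p" for a
    using net_path_arcs [OF p] that unfolding net_arcs by blast
  have "crossing ?q a = 0" if "a \<in> set p" for a
    using arc [OF that]
  proof (elim bexE disjE exE conjE)
    fix L u assume "L \<in> lozenges_in v t" "a = (Lattice u, Center L)"
    then show ?thesis using X_a_pt_max [OF _ d_vert_loz, of L i'] by (simp add: crossing_def)
  qed (simp add: crossing_def)
  then have "crossings p ?q = 0" unfolding crossings_def by (intro sum.neutral ballI)
  moreover have "crossings p ?b = 1"
  proof -
    let ?S = "{z. Y ?b < Y z}"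
    have "crossing ?b a = node_val ?S (fst a) - node_val ?S (snd a)" if a: "a \<in> set p" for a
      using arc [OF a]
    proof (elim bexE disjE exE conjE)
      fix L u assume L: "L \<in> lozenges_in v t" "u \<in> loz_verts L" "u \<noteq> d_vert L" and au: "a = (Lattice u, Center L)"
      note PC = net_path_Center [OF p a [unfolded au]]
      have Yd: "Y (d_vert L) \<le> Y u" using step_shape(1) [OF L] by auto
      have right: "X ?b < X (d_vert L)" if Y: "Y ?b < Y u" "Y (d_vert L) \<le> Y ?b"
      proof (rule ccontr)
        assume "\<not> X ?b < X (d_vert L)"
        then have "d_vert L = ?b \<or> odd m' \<and> d_vert L = b_pt v t (m' + 1)"
          using right_of_sink [OF L m' Y] by simp
        moreover have "d_vert L \<noteq> ?b" using PC(3) ends(1) dis by auto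
        ultimately have dL: "odd m'" "d_vert L = b_pt v t (m' + 1)" by blast+
        \<comment> \<open>The step ends at the boundary neighbour on the left. As m < m',
          \<open>p\<close> does not stop there, and its only continuation runs into the end of
          \<open>r\<close>.\<close>
        have "d_vert L \<noteq> ?e"
        proof
          assume "d_vert L = ?e"
          then have "pt (int ((m' + 1) div 2)) (int t - int ((m' + 2) div 2)) 0 = pt (int (m div 2)) (int t - int ((m + 1) div 2)) 0"
            using dL(2) by (simp add: b_pt_eq)
          moreover have "int t - int ((m' + 2) div 2) < int t - int ((m + 1) div 2) \<or> (m' + 2) div 2 = (m + 1) div 2"
            using mm by (metis add_mono div_le_mono le_neq_implies_less less_imp_le_nat of_nat_less_iff one_le_numeral diff_strict_left_mono)
          moreover have "m div 2 < (m' + 1) div 2" using mm dL(1) by (auto elim!: oddE)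
          ultimately show False unfolding pt_eq_iff by linarith
        qed
        then have "Lattice (d_vert L) \<in> fst ` set p" using PC(3) unfolding net_path_fst [OF p] by simp
        then obtain y where y: "(Lattice (d_vert L), y) \<in> set p" by force
        then obtain M where M: "M \<in> lozenges_in v t" "d_vert L \<in> loz_verts M" "d_vert L \<noteq> d_vert M" "y = Center M"
          using net_path_arcs [OF p] net_arc_Lattice by blast
        have "d_vert M = ?b" using step_from_even_b [OF M(1)] M(2,3) dL m' by simp
        then show False using net_path_Center(3) [OF p] y M(4) ends(1) dis by fastforce
      qed
      show ?thesis using right Yd by (auto simp: au crossing_def node_val_def)
    next
      fix L assume "a = (Center L, Lattice (d_vert L))"
      then show ?thesis by (simp add: crossing_def node_val_def)
    qed
    then have "crossings p ?b = (\<Sum>a\<in>set p. node_val ?S (fst a) - node_val ?S (snd a))"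
      unfolding crossings_def by (intro sum.cong refl)
    also have "\<dots> = node_val ?S (Lattice ?s) - node_val ?S (Lattice ?e)" by (rule N.apath_telescope [OF p])
    also have "\<dots> = 1" using main Ys Ye by (simp add: node_val_def)
    finally show ?thesis .
  qed
  ultimately show False using main by simp
qed

end

section \<open>Rooted forests and functional graphs\<close>

lemma is_path_iff:
  "is_path H u p w \<longleftrightarrow> u \<in> pverts H \<and> set p \<subseteq> parcs H \<and> pcas u p w \<and> distinct (pawalk_verts u p)"
  by (simp add: pre_digraph.apath_def pre_digraph.awalk_def cas_with_proj_eq awalk_verts_with_proj_eq)

lemma pawalk_verts_start: "pcas u p w \<Longrightarrow> u \<in> set (pawalk_verts u p)"
  by (cases p) auto

lemma pawalk_verts_end: "pcas u p w \<Longrightarrow> w \<in> set (pawalk_verts u p)"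
  by (induction p arbitrary: u) auto

lemma pawalk_verts_arc: "pcas u p w \<Longrightarrow> e \<in> set p \<Longrightarrow> fst e \<in> set (pawalk_verts u p) \<and> snd e \<in> set (pawalk_verts u p)"
proof (induction p arbitrary: u)
  case (Cons e' p)
  then show ?case using pawalk_verts_start [of "snd e'" p w] by auto
qed simp

lemma pawalk_split:
  "pcas u p w \<Longrightarrow> x \<in> set (pawalk_verts u p) \<Longrightarrow> \<exists>p1 p2. p = p1 @ p2 \<and> pcas u p1 x \<and> pcas x p2 w"
proof (induction p arbitrary: u)
  case Nil
  then show ?case by auto
next
  case (Cons e p)
  show ?case
  proof (cases "x = u")
    case True
    then show ?thesis using Cons.prems(1) by (intro exI [of _ "[]"] exI [of _ "e # p"]) simp
  next
    case False
    then obtain p1 p2 where "p = p1 @ p2" "pcas (snd e) p1 x" "pcas x p2 w"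
      using Cons by (metis pawalk_verts.simps(2) pcas.simps(2) set_ConsD)
    then show ?thesis using Cons.prems(1) by (intro exI [of _ "e # p1"] exI [of _ p2]) simp
  qed
qed

lemma pawalk_verts_prefix: "pcas u p1 x \<Longrightarrow> pcas x p2 w \<Longrightarrow> \<exists>ys. pawalk_verts u (p1 @ p2) = pawalk_verts u p1 @ ys"
proof (induction p1 arbitrary: u)
  case Nil
  then show ?case by (cases p2) auto
qed auto

text \<open>The walk along a functional relation has no choice, so it visits everything reachable
  and stops only outside the domain; finiteness and acyclicity make it end without
  repetition.\<close>

lemma functional_path:
  assumes A: "finite A" "acyclic A" "single_valued A" "A \<subseteq> parcs H" and x: "x \<in> pverts H"
    and wf: "\<And>e. e \<in> parcs H \<Longrightarrow> snd e \<in> pverts H"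
  shows "\<exists>p y. is_path H x p y \<and> y \<notin> Domain A \<and> set (pawalk_verts x p) = A\<^sup>* `` {x} \<and>
    set p = {e \<in> A. (x, fst e) \<in> A\<^sup>*}"
  using finite_acyclic_wf_converse [OF A(1,2)] x
proof (induction x rule: wf_induct_rule)
  case (less x)
  show ?case
  proof (cases "x \<in> Domain A")
    case False
    then have "A\<^sup>* `` {x} = {x}" "{e \<in> A. (x, fst e) \<in> A\<^sup>*} = {}"
      by (auto elim: converse_rtranclE)
    then show ?thesis using False less.prems
      by (intro exI [of _ "[]"] exI [of _ x]) (simp add: is_path_iff)
  next
    case True
    then obtain y where y: "(x, y) \<in> A" by blast
    have star: "(x, z) \<in> A\<^sup>* \<longleftrightarrow> z = x \<or> (y, z) \<in> A\<^sup>*" for z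
      using y A(3) by (metis converse_rtranclE converse_rtrancl_into_rtrancl rtrancl.rtrancl_refl single_valuedD)
    have "y \<in> pverts H" using wf [of "(x, y)"] y A(4) by auto
    with less.IH [of y] y obtain p z where p: "is_path H y p z" "z \<notin> Domain A"
      "set (pawalk_verts y p) = A\<^sup>* `` {y}" "set p = {e \<in> A. (y, fst e) \<in> A\<^sup>*}" by auto
    have nx: "(y, x) \<notin> A\<^sup>*" using y A(2) unfolding acyclic_def by (meson rtrancl_into_trancl2)
    have "is_path H x ((x, y) # p) z"
      using p(1,3) less.prems y A(4) nx unfolding is_path_iff by auto
    moreover have "set (pawalk_verts x ((x, y) # p)) = A\<^sup>* `` {x}"
      using p(3) star by auto
    moreover have "set ((x, y) # p) = {e \<in> A. (x, fst e) \<in> A\<^sup>*}"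
    proof -
      have "e = (x, y) \<or> (y, fst e) \<in> A\<^sup>*" if "e \<in> A" "(x, fst e) \<in> A\<^sup>*" for e
        using that star y A(3) by (metis prod.collapse single_valuedD)
      then show ?thesis using p(4) star y by auto
    qed
    ultimately show ?thesis using p(2) by blast
  qed
qed

lemma source_exists:
  assumes "finite A" "acyclic A" "x \<in> Domain A"
  shows "\<exists>u \<in> Domain A - Range A. (u, x) \<in> A\<^sup>*"
  using finite_acyclic_wf [OF assms(1,2)] assms(3)
proof (induction x rule: wf_induct_rule)
  case (less x)
  show ?case
  proof (cases "x \<in> Range A")
    case True
    then obtain y where "(y, x) \<in> A" by blast
    with less.IH [of y] show ?thesis by (meson DomainI rtrancl.rtrancl_into_rtrancl)
  qed (use less.prems in blast)
qed

text \<open>Backwards from \<open>z\<close> there is only one chain, and a point without predecessor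
  can only be its far end.\<close>

lemma reach_disjoint:
  assumes "single_valued (A\<inverse>)" "x \<notin> Range A" "x' \<notin> Range A" "(x, z) \<in> A\<^sup>*" "(x', z) \<in> A\<^sup>*"
  shows "x = x'"
proof -
  have "(z, x) \<in> (A\<inverse>)\<^sup>*" "(z, x') \<in> (A\<inverse>)\<^sup>*" using assms(4,5) by (simp_all add: rtrancl_converse)
  then have "(x, x') \<in> (A\<inverse>)\<^sup>* \<or> (x', x) \<in> (A\<inverse>)\<^sup>*" by (rule single_valued_confluent [OF assms(1)])
  then show ?thesis using assms(2,3) unfolding rtrancl_converse
    by (auto elim: rtranclE)
qed

section \<open>Orientation of a forest towards its roots\<close>

locale rooted_ugraph =
  fixes V :: "'a set" and E :: "'a set set" and \<rho> :: "'a \<Rightarrow> 'a"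
  assumes edges: "A \<in> E \<Longrightarrow> \<exists>u w. A = {u, w} \<and> u \<noteq> w \<and> u \<in> V \<and> w \<in> V"
    and acyclic: "acyclic_ugraph V E"
    and root_reachable: "u \<in> V \<Longrightarrow> \<exists>p. is_path (ugraph V E) u p (\<rho> u)"
    and root_edge: "{u, w} \<in> E \<Longrightarrow> \<rho> u = \<rho> w"
begin

abbreviation "U \<equiv> ugraph V E"

lemma edge: "{u, w} \<in> E \<Longrightarrow> u \<noteq> w \<and> u \<in> V \<and> w \<in> V"
  using edges [of "{u, w}"] by (auto simp: doubleton_eq_iff)

lemma path_iff: "is_path U u p w \<longleftrightarrow> u \<in> V \<and> (\<forall>(x, y)\<in>set p. {x, y} \<in> E) \<and> pcas u p w \<and> distinct (pawalk_verts u p)"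
  unfolding is_path_iff ugraph_def by auto

lemma path_Cons: "is_path U u ((u, w) # p) r \<longleftrightarrow> {u, w} \<in> E \<and> is_path U w p r \<and> u \<notin> set (pawalk_verts w p)"
  unfolding path_iff using edge by auto

definition oriented :: "('a \<times> 'a) set" where
  "oriented = {(u, w). \<exists>p. is_path U u ((u, w) # p) (\<rho> u)}"

lemma oriented_exists:
  assumes "u \<in> V" "u \<noteq> \<rho> u"
  shows "\<exists>w. (u, w) \<in> oriented"
proof -
  obtain p where p: "is_path U u p (\<rho> u)" using root_reachable [OF assms(1)] by blast
  then obtain e p' where "p = e # p'" using assms(2) by (cases p) (auto simp: path_iff)
  moreover have "fst e = u" using p calculation by (simp add: path_iff)
  ultimately have "is_path U u ((u, snd e) # p') (\<rho> u)" using p by (metis prod.collapse)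
  then show ?thesis unfolding oriented_def by blast
qed

lemma oriented_D:
  assumes "(u, w) \<in> oriented"
  shows "{u, w} \<in> E" "u \<noteq> \<rho> u"
proof -
  obtain p where "is_path U u ((u, w) # p) (\<rho> u)" using assms unfolding oriented_def by blast
  then have "{u, w} \<in> E" "is_path U w p (\<rho> u)" "u \<notin> set (pawalk_verts w p)"
    unfolding path_Cons by blast+
  then show "{u, w} \<in> E" "u \<noteq> \<rho> u" using pawalk_verts_end [of w p "\<rho> u"] unfolding path_iff by auto
qed

text \<open>After deletion of \<open>u\<close> both \<open>w\<close> and \<open>w'\<close> are still
  connected to \<open>r\<close>; in that smaller graph reachability is symmetric and transitive and
  yields a simple path.\<close>

lemma path_avoiding:
  assumes p: "is_path U w p r" "u \<notin> set (pawalk_verts w p)" and q: "is_path U w' q r" "u \<notin> set (pawalk_verts w' q)"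
  shows "\<exists>p'. is_path U w p' w' \<and> u \<notin> set (pawalk_verts w p')"
proof -
  let ?U' = "ugraph (V - {u}) {A \<in> E. u \<notin> A}"
  have wf: "wf_digraph (with_proj ?U')"
  proof
    fix e assume "e \<in> arcs (with_proj ?U')"
    then have "{fst e, snd e} \<in> E" "u \<noteq> fst e" "u \<noteq> snd e" by (auto simp: ugraph_def)
    then show "tail (with_proj ?U') e \<in> verts (with_proj ?U')" "head (with_proj ?U') e \<in> verts (with_proj ?U')"
      using edge [of "fst e" "snd e"] by (auto simp: ugraph_def)
  qed
  interpret U': wf_digraph "with_proj ?U'" by (rule wf)
  have path': "is_path ?U' x s y \<longleftrightarrow> is_path U x s y \<and> u \<notin> set (pawalk_verts x s)" for x s y
  proof
    assume *: "is_path ?U' x s y"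
    have "u \<notin> set (pawalk_verts x s)" if "x \<noteq> u" "\<forall>(x, y)\<in>set s. u \<noteq> x \<and> u \<noteq> y" for x s
      using that by (induction s arbitrary: x) auto
    then show "is_path U x s y \<and> u \<notin> set (pawalk_verts x s)"
      using * unfolding is_path_iff ugraph_def by fastforce
  next
    assume *: "is_path U x s y \<and> u \<notin> set (pawalk_verts x s)"
    then have "u \<noteq> fst e \<and> u \<noteq> snd e" if "e \<in> set s" for e
      using pawalk_verts_arc that unfolding is_path_iff by metis
    moreover have "x \<noteq> u" using * pawalk_verts_start unfolding is_path_iff by metis
    ultimately show "is_path ?U' x s y" using * unfolding is_path_iff ugraph_def by fastforce
  qed
  have sym: "symmetric (with_proj ?U')"
    by (auto simp: symmetric_def sym_def ugraph_def insert_commute)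
  have pq: "is_path ?U' w p r" "is_path ?U' w' q r" using path' p q by simp_all
  have "w \<rightarrow>\<^sup>*\<^bsub>with_proj ?U'\<^esub> r" unfolding U'.reachable_apath using pq(1) by (rule exI)
  moreover have "w' \<rightarrow>\<^sup>*\<^bsub>with_proj ?U'\<^esub> r" unfolding U'.reachable_apath using pq(2) by (rule exI)
  ultimately have "w \<rightarrow>\<^sup>*\<^bsub>with_proj ?U'\<^esub> w'"
    by (rule U'.reachable_trans [OF _ symmetric_reachable [OF sym]])
  then obtain p' where "is_path ?U' w p' w'" unfolding U'.reachable_apath ..
  then show ?thesis unfolding path' by (rule exI)
qed

text \<open>Two different first steps would close up to a cycle: from \<open>u\<close> to
  \<open>w\<close>, on to \<open>w'\<close> without meeting \<open>u\<close>, and back to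
  \<open>u\<close>.\<close>

lemma oriented_unique:
  assumes "(u, w) \<in> oriented" "(u, w') \<in> oriented"
  shows "w = w'"
proof (rule ccontr)
  assume "w \<noteq> w'"
  obtain p q where "{u, w} \<in> E" "is_path U w p (\<rho> u)" "u \<notin> set (pawalk_verts w p)"
    and q: "{u, w'} \<in> E" "is_path U w' q (\<rho> u)" "u \<notin> set (pawalk_verts w' q)"
    using assms unfolding oriented_def by (auto simp: path_Cons)
  moreover obtain p' where p': "is_path U w p' w'" "u \<notin> set (pawalk_verts w p')"
    using path_avoiding calculation by blast
  ultimately have "is_path U u ((u, w) # p') w'" by (simp add: path_Cons)
  moreover have "length ((u, w) # p') \<ge> 2" using p'(1) \<open>w \<noteq> w'\<close> by (cases p') (auto simp: path_iff)
  moreover have "{w', u} \<in> E" using q(1) by (simp add: insert_commute)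
  ultimately show False using acyclic unfolding acyclic_ugraph_def by blast
qed

text \<open>Follow a path from \<open>w\<close> to its root. If it avoids \<open>u\<close>, the edge
  can be put in front of it; if it meets \<open>u\<close>, acyclicity forces the edge to be its
  first step.\<close>

lemma oriented_edge:
  assumes "{u, w} \<in> E"
  shows "(u, w) \<in> oriented \<or> (w, u) \<in> oriented"
proof -
  have uw: "u \<noteq> w" "w \<in> V" "u \<in> V" using edge [OF assms] by auto
  obtain p where p: "is_path U w p (\<rho> w)" using root_reachable [OF uw(2)] by blast
  show ?thesis
  proof (cases "u \<in> set (pawalk_verts w p)")
    case False
    then have "is_path U u ((u, w) # p) (\<rho> u)" using p assms root_edge by (simp add: path_Cons)
    then show ?thesis unfolding oriented_def by blast
  next
    case True
    obtain p1 p2 where s: "p = p1 @ p2" "pcas w p1 u" "pcas u p2 (\<rho> w)" using p pawalk_split [OF _ True] unfolding path_iff by blast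
    obtain ys where "pawalk_verts w p = pawalk_verts w p1 @ ys" using pawalk_verts_prefix [OF s(2,3)] s(1) by blast
    then have "is_path U w p1 u" using p s unfolding path_iff by auto
    then have "\<not> length p1 \<ge> 2" using acyclic assms unfolding acyclic_ugraph_def by blast
    moreover have "p1 \<noteq> []" using s(2) uw(1) by auto
    ultimately obtain e where "p1 = [e]" by (cases p1; cases "tl p1") auto
    then have "p = (w, u) # p2" using s by (cases e) auto
    then show ?thesis using p unfolding oriented_def by blast
  qed
qed

lemma oriented_antisym:
  assumes "(u, w) \<in> oriented" "(w, u) \<in> oriented"
  shows False
proof -
  obtain p where p: "{u, w} \<in> E" "is_path U w p (\<rho> u)" "u \<notin> set (pawalk_verts w p)"
    using assms(1) unfolding oriented_def by (auto simp: path_Cons)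
  have r: "\<rho> w = \<rho> u" using root_edge p(1) by metis
  then have "p \<noteq> []" using oriented_D(2) [OF assms(2)] p(2) by (auto simp: path_iff)
  then obtain w' p' where p': "p = (w, w') # p'" using p(2) by (cases p) (auto simp: path_iff)
  then have "(w, w') \<in> oriented" using p(2) r unfolding oriented_def by auto
  then have "w' = u" using oriented_unique assms(2) by blast
  then show False using p(2,3) p' pawalk_verts_start [of w' p' "\<rho> u"] by (simp add: path_iff)
qed

end

section \<open>Forests given by a successor map with decreasing rank\<close>

lemma pawalk_nth_edge:
  "pcas u p w \<Longrightarrow> i < length p \<Longrightarrow> (pawalk_verts u p ! i, pawalk_verts u p ! Suc i) \<in> set p"
proof (induction p arbitrary: u i)
  case (Cons e p)
  show ?case
  proof (cases i)
    case 0
    have "pawalk_verts (snd e) p ! 0 = snd e" using Cons.prems(1) by (cases p) auto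
    then show ?thesis using 0 by (cases e) simp
  next
    case (Suc j)
    then show ?thesis using Cons.IH [of "snd e" j] Cons.prems by auto
  qed
qed simp

lemma pawalk_nth_ends:
  "pcas u p w \<Longrightarrow> length (pawalk_verts u p) = Suc (length p) \<and> pawalk_verts u p ! 0 = u \<and> pawalk_verts u p ! length p = w"
proof (induction p arbitrary: u)
  case (Cons e p)
  then show ?case by auto
qed simp

locale functional_forest =
  fixes V R :: "'a set" and nx :: "'a \<Rightarrow> 'a" and rk :: "'a \<Rightarrow> nat"
  assumes R_V: "R \<subseteq> V"
    and nx_V: "u \<in> V - R \<Longrightarrow> nx u \<in> V"
    and nx_rk: "u \<in> V - R \<Longrightarrow> rk (nx u) < rk u"
begin

definition E :: "'a set set" where
  "E = (\<lambda>u. {u, nx u}) ` (V - R)"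

definition step :: "'a \<Rightarrow> 'a" where
  "step u = (if u \<in> R then u else nx u)"

text \<open>\<open>step\<close> rests at the roots and the rank bounds the distance to them, so any
  larger number of iterations gives the same root.\<close>

definition rt :: "'a \<Rightarrow> 'a" where
  "rt u = (step ^^ rk u) u"

lemma step_iterate_R: "u \<in> R \<Longrightarrow> (step ^^ n) u = u"
  by (induction n) (simp_all add: step_def)

lemma rt_R: "u \<in> R \<Longrightarrow> rt u = u"
  by (simp add: rt_def step_iterate_R)

lemma step_iterate_Suc: "u \<notin> R \<Longrightarrow> (step ^^ Suc n) u = (step ^^ n) (nx u)"
  by (simp only: funpow_Suc_right o_apply) (simp add: step_def)

lemma iterate_rt:
  assumes "u \<in> V" "rk u \<le> n"
  shows "rt u \<in> R \<and> (step ^^ n) u = rt u"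
  using assms
proof (induction "rk u" arbitrary: u n rule: less_induct)
  case less
  show ?case
  proof (cases "u \<in> R")
    case True
    then show ?thesis using rt_R step_iterate_R by simp
  next
    case False
    then have u: "u \<in> V - R" using less.prems by simp
    have *: "(step ^^ m) u = rt (nx u) \<and> rt (nx u) \<in> R" if m: "rk u \<le> m" for m
    proof -
      obtain m' where m': "m = Suc m'" using m nx_rk [OF u] by (cases m) auto
      then show ?thesis
        using less.hyps [OF nx_rk [OF u] nx_V [OF u], of m'] m nx_rk [OF u] step_iterate_Suc [OF False] by simp
    qed
    then show ?thesis using less.prems(2) unfolding rt_def [of u] by simp
  qed
qed

lemma rt_in: "u \<in> V \<Longrightarrow> rt u \<in> R"
  using iterate_rt by blast

lemma rt_nx:
  assumes u: "u \<in> V - R"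
  shows "rt (nx u) = rt u"
proof -
  obtain m where m: "rk u = Suc m" using nx_rk [OF u] by (cases "rk u") auto
  have "rt u = (step ^^ m) (nx u)" using u m step_iterate_Suc [of u m] unfolding rt_def by simp
  also have "\<dots> = rt (nx u)" using iterate_rt [OF nx_V [OF u], of m] nx_rk [OF u] m by simp
  finally show ?thesis by simp
qed

lemma edge_cases: "{u, w} \<in> E \<Longrightarrow> u \<in> V - R \<and> w = nx u \<or> w \<in> V - R \<and> u = nx w"
  unfolding E_def by (auto simp: doubleton_eq_iff)

lemma edge_rt: "{u, w} \<in> E \<Longrightarrow> rt u = rt w"
  using edge_cases rt_nx by metis

text \<open>The rank bound keeps \<open>u\<close> off the path from its successor, which makes the
  longer path simple; the first step is recorded for the orientation.\<close>

lemma path_to_root: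
  assumes "u \<in> V"
  shows "\<exists>p. is_path (ugraph V E) u p (rt u) \<and> (\<forall>z \<in> set (pawalk_verts u p). rk z \<le> rk u) \<and>
    (u \<notin> R \<longrightarrow> (\<exists>p'. p = (u, nx u) # p'))"
  using assms
proof (induction "rk u" arbitrary: u rule: less_induct)
  case less
  show ?case
  proof (cases "u \<in> R")
    case True
    then show ?thesis using less.prems
      by (intro exI [of _ "[]"]) (simp add: is_path_iff ugraph_def rt_R)
  next
    case False
    then have u: "u \<in> V - R" using less.prems by simp
    obtain p where p: "is_path (ugraph V E) (nx u) p (rt u)" "\<forall>z \<in> set (pawalk_verts (nx u) p). rk z \<le> rk (nx u)"
      using less.hyps [OF nx_rk [OF u] nx_V [OF u]] rt_nx [OF u] by auto
    then have "u \<notin> set (pawalk_verts (nx u) p)" using nx_rk [OF u] by auto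
    moreover have "{u, nx u} \<in> E" using u unfolding E_def by blast
    ultimately have "is_path (ugraph V E) u ((u, nx u) # p) (rt u)"
      using p(1) less.prems unfolding is_path_iff ugraph_def by auto
    then show ?thesis using p(2) nx_rk [OF u] by (intro exI [of _ "(u, nx u) # p"]) auto
  qed
qed

text \<open>A vertex of maximal rank on a cycle would have two different successors.\<close>

lemma acyclic: "acyclic_ugraph V E"
  unfolding acyclic_ugraph_def
proof (intro notI, elim exE conjE)
  fix u p w assume p: "is_path (ugraph V E) u p w" and len: "2 \<le> length p" and wu: "{w, u} \<in> E"
  let ?x = "\<lambda>i. pawalk_verts u p ! i"
  have c: "pcas u p w" and d: "distinct (pawalk_verts u p)" and sub: "\<And>x y. (x, y) \<in> set p \<Longrightarrow> {x, y} \<in> E"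
    using p unfolding is_path_iff ugraph_def by auto
  note ends = pawalk_nth_ends [OF c]
  have inj: "?x i = ?x j \<longleftrightarrow> i = j" if "i \<le> length p" "j \<le> length p" for i j
    using d ends that by (simp add: nth_eq_iff_index_eq)
  have e: "{?x i, ?x (Suc i)} \<in> E" if "i < length p" for i
    using sub pawalk_nth_edge [OF c that] by blast
  have "\<exists>i \<le> length p. \<forall>j \<le> length p. rk (?x j) \<le> rk (?x i)"
  proof -
    let ?M = "Max ((\<lambda>j. rk (?x j)) ` {..length p})"
    have "?M \<in> (\<lambda>j. rk (?x j)) ` {..length p}" by (intro Max_in) auto
    then obtain i where "?M = rk (?x i)" "i \<in> {..length p}" by (rule imageE)
    moreover have "rk (?x j) \<le> ?M" if "j \<le> length p" for j using that by (intro Max_ge) auto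
    ultimately show ?thesis by auto
  qed
  then obtain i where i: "i \<le> length p" "\<And>j. j \<le> length p \<Longrightarrow> rk (?x j) \<le> rk (?x i)" by blast
  have nxi: "?x j = nx (?x i)" if "j \<le> length p" "{?x i, ?x j} \<in> E" for j
    using edge_cases [OF that(2)] i(2) [OF that(1)] nx_rk [of "?x j"] by auto
  \<comment> \<open>The cyclic neighbours of position \<open>i\<close>; they differ because the
    cycle has at least three vertices.\<close>
  define j where "j = (if i = 0 then length p else i - 1)"
  define k where "k = (if i = length p then 0 else Suc i)"
  have wu': "{?x (length p), ?x 0} \<in> E" using wu ends by simp
  have "{?x i, ?x j} \<in> E"
  proof (cases "i = 0")
    case True
    then show ?thesis using wu' by (simp add: j_def insert_commute)
  next
    case False
    then show ?thesis using e [of "i - 1"] i(1) by (simp add: j_def insert_commute)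
  qed
  moreover have "{?x i, ?x k} \<in> E"
    using wu' e [of i] i(1) by (auto simp: k_def)
  moreover have jk: "j \<le> length p" "k \<le> length p" "j \<noteq> k" using i(1) len by (auto simp: j_def k_def)
  ultimately have "?x j = ?x k" using nxi by metis
  then show False using inj jk by blast
qed

lemma reachable_rt:
  assumes "u \<rightarrow>\<^sup>*\<^bsub>with_proj (ugraph V E)\<^esub> w"
  shows "rt w = rt u"
  using reachable_rtranclI [OF assms]
proof (induction rule: rtrancl_induct)
  case (step y z)
  then show ?case using edge_rt [of y z] by (simp add: ugraph_def)
qed simp

lemma wf: "wf_digraph (with_proj (ugraph V E))"
proof
  fix e assume "e \<in> arcs (with_proj (ugraph V E))"
  then have "{fst e, snd e} \<in> E" by (auto simp: ugraph_def)
  then show "tail (with_proj (ugraph V E)) e \<in> verts (with_proj (ugraph V E))"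
    "head (with_proj (ugraph V E)) e \<in> verts (with_proj (ugraph V E))"
    using edge_cases [of "fst e" "snd e"] nx_V by (auto simp: ugraph_def)
qed

lemma comp_of_eq:
  assumes "u \<in> V"
  shows "comp_of V E u = {w \<in> V. rt w = rt u}"
proof -
  interpret G: wf_digraph "with_proj (ugraph V E)" by (rule wf)
  have sym: "symmetric (with_proj (ugraph V E))"
    by (auto simp: symmetric_def sym_def ugraph_def insert_commute)
  have reach: "w \<rightarrow>\<^sup>*\<^bsub>with_proj (ugraph V E)\<^esub> rt w" if "w \<in> V" for w
  proof -
    obtain p where "is_path (ugraph V E) w p (rt w)" using path_to_root [OF \<open>w \<in> V\<close>] by blast
    then show ?thesis unfolding G.reachable_apath ..
  qed
  show ?thesis
  proof (intro equalityI subsetI)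
    fix w assume "w \<in> comp_of V E u"
    then have *: "u \<rightarrow>\<^sup>*\<^bsub>with_proj (ugraph V E)\<^esub> w" by (simp add: comp_of_def)
    then have "w \<in> V" using G.reachable_in_verts(2) by (fastforce simp: ugraph_def)
    then show "w \<in> {w \<in> V. rt w = rt u}" using reachable_rt [OF *] by simp
  next
    fix w assume "w \<in> {w \<in> V. rt w = rt u}"
    then have "w \<rightarrow>\<^sup>*\<^bsub>with_proj (ugraph V E)\<^esub> rt u" using reach [of w] by simp
    then show "w \<in> comp_of V E u"
      unfolding comp_of_def mem_Collect_eq
      by (rule G.reachable_trans [OF reach [OF assms] symmetric_reachable [OF sym]])
  qed
qed

text \<open>Any vertex of a component gives its root. The restriction matches the convention that
  root maps are undefined outside the components.\<close>

definition root_of :: "'a set \<Rightarrow> 'a" where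
  "root_of = restrict (\<lambda>C. rt (SOME u. u \<in> C)) (conn_comps V E)"

lemma root_of_comp:
  assumes "u \<in> V"
  shows "root_of (comp_of V E u) = rt u"
proof -
  have "u \<in> comp_of V E u" using assms by (simp add: comp_of_eq)
  then have "(SOME w. w \<in> comp_of V E u) \<in> comp_of V E u" by (rule someI)
  then have "rt (SOME w. w \<in> comp_of V E u) = rt u" using assms by (simp add: comp_of_eq)
  then show ?thesis using assms by (simp add: root_of_def conn_comps_def)
qed

lemma root_of_in: "C \<in> conn_comps V E \<Longrightarrow> root_of C \<in> C \<inter> R"
  unfolding conn_comps_def using root_of_comp comp_of_eq rt_in rt_R R_V by fastforce

lemma root_of_image: "root_of ` conn_comps V E = R"
proof -
  have "root_of ` conn_comps V E = rt ` V"
    unfolding conn_comps_def image_image using root_of_comp by (intro image_cong refl) auto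
  also have "\<dots> = R" using rt_in rt_R R_V by force
  finally show ?thesis .
qed

end

section \<open>Forests, orientations and path tuples\<close>

context lozenge_triangle begin

text \<open>The strict bounds remove the three corners of the triangle, which belong to no
  lozenge.\<close>

lemma Vert_E:
  assumes "u \<in> Vert v t"
  obtains a b c where "u = pt a b c" "0 \<le> a" "0 \<le> b" "0 \<le> c"
    "a + b + c = int t - 2 \<or> a + b + c = int t - 1 \<or> a + b + c = int t \<and> a < int t \<and> b < int t \<and> c < int t"
proof -
  obtain L where L: "L \<in> lozenges_in v t" "u \<in> loz_verts L" using assms unfolding Vert_def by blast
  obtain a b c where c: "cell a b c" and Lc:
    "b_vert L = pt a b c \<and> d_vert L = pt a (b + 1) c \<and>
       ac_verts L = {pt (a + 1) (b + 1) c, pt a (b + 1) (c + 1)} \<or>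
     b_vert L = pt a b (c + 1) \<and> d_vert L = pt a b c \<and>
       ac_verts L = {pt (a + 1) b (c + 1), pt a (b + 1) (c + 1)} \<or>
     b_vert L = pt (a + 1) b (c + 1) \<and> d_vert L = pt (a + 1) (b + 1) c \<and>
       ac_verts L = {pt (a + 1) b c, pt a b c}"
    using lozenge_coords [OF L(1)] by blast
  have s: "a + b + c = int t - 2" "0 \<le> a" "0 \<le> b" "0 \<le> c" using c by (simp_all add: cell_def)
  have "u = b_vert L \<or> u = d_vert L \<or> u \<in> ac_verts L" using L loz_verts_eq by blast
  then have "u \<in> {pt a b c, pt (a + 1) b c, pt a (b + 1) c, pt a b (c + 1),
    pt (a + 1) (b + 1) c, pt (a + 1) b (c + 1), pt a (b + 1) (c + 1)}"
    using Lc by (elim disjE conjE) auto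
  then show thesis
    using that [of a b c] that [of "a + 1" b c] that [of a "b + 1" c] that [of a b "c + 1"]
      that [of "a + 1" "b + 1" c] that [of "a + 1" b "c + 1"] that [of a "b + 1" "c + 1"] s by auto
qed

text \<open>Each colour is a lower corner in one type of lozenge only: red in the second, blue in
  the first, green in the third. The condition says that the corresponding cell exists.\<close>

lemma d_vert_pt:
  assumes "0 \<le> a" "0 \<le> b" "0 \<le> c" "int t - 2 \<le> a + b + c" "a + b + c \<le> int t"
  shows "(\<exists>L\<in>lozenges_in v t. d_vert L = pt a b c) \<longleftrightarrow>
    a + b + c = int t - 2 \<or> a + b + c = int t - 1 \<and> 1 \<le> b \<or> a + b + c = int t \<and> 1 \<le> a \<and> 1 \<le> b"
proof
  assume "\<exists>L\<in>lozenges_in v t. d_vert L = pt a b c"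
  then obtain L where L: "L \<in> lozenges_in v t" "d_vert L = pt a b c" by blast
  obtain a' b' c' where c: "cell a' b' c'" and Lc: "d_vert L = pt a' (b' + 1) c' \<or> d_vert L = pt a' b' c' \<or>
    d_vert L = pt (a' + 1) (b' + 1) c'" using lozenge_coords [OF L(1)] by blast
  then show "a + b + c = int t - 2 \<or> a + b + c = int t - 1 \<and> 1 \<le> b \<or> a + b + c = int t \<and> 1 \<le> a \<and> 1 \<le> b"
    using assms unfolding L(2) cell_def by (elim disjE conjE) (simp_all add: pt_inj)
next
  assume "a + b + c = int t - 2 \<or> a + b + c = int t - 1 \<and> 1 \<le> b \<or> a + b + c = int t \<and> 1 \<le> a \<and> 1 \<le> b"
  then consider "cell a b c" | "cell a (b - 1) c" | "cell (a - 1) (b - 1) c"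
    using assms(1-3) unfolding cell_def by fastforce
  then show "\<exists>L\<in>lozenges_in v t. d_vert L = pt a b c"
  proof cases
    case 1
    then have "rhombus23 (pt a b c) \<in> lozenges_in v t" unfolding lozenges_in_eq by blast
    then show ?thesis using labels23(5) [OF 1] by blast
  next
    case 2
    then have "rhombus12 (pt a (b - 1) c) \<in> lozenges_in v t" unfolding lozenges_in_eq by blast
    then show ?thesis using labels12(5) [OF 2] by force
  next
    case 3
    then have "rhombus31 (pt (a - 1) (b - 1) c) \<in> lozenges_in v t" unfolding lozenges_in_eq by blast
    then show ?thesis using labels31(5) [OF 3] by force
  qed
qed

lemma c_pt_Vert:
  assumes "n \<in> {1..2 * t - 1}"
  shows "c_pt v t n \<in> Vert v t" "\<not> (\<exists>L\<in>lozenges_in v t. d_vert L = c_pt v t n)"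
proof -
  have n: "1 \<le> n" "n \<le> 2 * t - 1" using assms by auto
  define a c where "a = int t - int ((n + 1) div 2)" and "c = int (n div 2)"
  have eq: "c_pt v t n = pt a 0 c" by (simp add: c_pt_eq a_def c_def)
  have ac: "0 \<le> a" "0 \<le> c" using n by (auto simp: a_def c_def)
  have s: "even n \<and> a + c = int t \<and> 1 \<le> a \<and> 1 \<le> c \<or> a + c = int t - 1"
    using n by (cases "even n") (auto simp: a_def c_def elim!: evenE oddE)
  show "\<not> (\<exists>L\<in>lozenges_in v t. d_vert L = c_pt v t n)"
    unfolding eq using d_vert_pt [of a 0 c] ac s by auto
  from s have "cell (a - 1) 0 (c - 1) \<or> cell (a - 1) 0 c \<or> cell a 0 (c - 1)"
    using ac t_ge2 unfolding cell_def by auto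
  moreover have "c_pt v t n \<in> loz_verts (rhombus31 (pt (a - 1) 0 (c - 1)))"
    unfolding eq corners31 by simp
  moreover have "c_pt v t n \<in> loz_verts (rhombus31 (pt (a - 1) 0 c))" "c_pt v t n \<in> loz_verts (rhombus23 (pt a 0 (c - 1)))"
    unfolding eq corners31 corners23 by simp_all
  ultimately show "c_pt v t n \<in> Vert v t" using Vert_loz lozenges_in_eq by blast
qed

lemma b_pt_d_vert:
  assumes "n \<in> {1..t - 1}"
  shows "\<exists>L\<in>lozenges_in v t. d_vert L = b_pt v t n"
proof -
  have n: "1 \<le> n" "n \<le> t - 1" using assms by auto
  define a b where "a = int (n div 2)" and "b = int t - int ((n + 1) div 2)"
  have eq: "b_pt v t n = pt a b 0" by (simp add: b_pt_eq a_def b_def)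
  have ab: "0 \<le> a" "1 \<le> b" using n by (auto simp: a_def b_def)
  have s: "a + b = int t \<and> 1 \<le> a \<or> a + b = int t - 1"
    using n by (cases "even n") (auto simp: a_def b_def elim!: evenE oddE)
  show ?thesis unfolding eq using d_vert_pt [of a b 0] ab s by auto
qed

lemma b_pt_R0: "n \<in> {1..t - 1} \<Longrightarrow> b_pt v t n \<in> R0 v t"
  by (simp add: R0_def)

lemma R0_Vert: "R0 v t \<subseteq> Vert v t"
proof
  fix \<rho> assume "\<rho> \<in> R0 v t"
  then consider n where "n \<in> {1..2 * t - 1}" "\<rho> = c_pt v t n" | n where "n \<in> {1..t - 1}" "\<rho> = b_pt v t n"
    unfolding R0_def by blast
  then show "\<rho> \<in> Vert v t"
  proof cases
    case 1
    then show ?thesis using c_pt_Vert(1) by simp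
  next
    case 2
    then show ?thesis using b_pt_d_vert [OF 2(1)] d_vert_loz Vert_loz by metis
  qed
qed

lemma R0_boundary: "R0 v t \<subseteq> boundary v t"
  unfolding R0_def boundary_def by (auto intro!: imageI)

lemma a_pt_source:
  assumes "i \<in> {1..<t}"
  shows "a_pt v t (2 * i) \<in> Vert v t" "a_pt v t (2 * i) \<notin> R0 v t"
    "\<not> (\<exists>L\<in>lozenges_in v t. d_vert L = a_pt v t (2 * i))"
proof -
  have i: "1 \<le> int i" "int i < int t" using assms by auto
  have eq: "a_pt v t (2 * i) = pt 0 (int i) (int t - int i)" by (simp add: a_pt_eq)
  show "\<not> (\<exists>L\<in>lozenges_in v t. d_vert L = a_pt v t (2 * i))"
    unfolding eq using d_vert_pt [of 0 "int i" "int t - int i"] i by simp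
  have c: "cell 0 (int i - 1) (int t - int i - 1)" using i by (simp add: cell_def)
  then have "rhombus12 (pt 0 (int i - 1) (int t - int i - 1)) \<in> lozenges_in v t"
    unfolding lozenges_in_eq by blast
  moreover have "a_pt v t (2 * i) \<in> loz_verts (rhombus12 (pt 0 (int i - 1) (int t - int i - 1)))"
    unfolding eq corners12 by simp
  ultimately show "a_pt v t (2 * i) \<in> Vert v t" by (rule Vert_loz)
  show "a_pt v t (2 * i) \<notin> R0 v t"
  proof
    assume "a_pt v t (2 * i) \<in> R0 v t"
    then obtain a b c where "pt 0 (int i) (int t - int i) = pt a b c" "b = 0 \<or> c = 0"
      "a + b + c = int t \<or> a + b + c = int t - 1"
      unfolding eq by (rule R0_E)
    then show False using i by (subst (asm) pt_inj) auto
  qed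
qed

lemma source_a_pt:
  assumes "u \<in> Vert v t" "u \<notin> R0 v t" "\<not> (\<exists>L\<in>lozenges_in v t. d_vert L = u)"
  obtains i where "i \<in> {1..<t}" "u = a_pt v t (2 * i)"
proof -
  obtain a b c where u: "u = pt a b c" and abc: "0 \<le> a" "0 \<le> b" "0 \<le> c"
    and s: "a + b + c = int t - 2 \<or> a + b + c = int t - 1 \<or> a + b + c = int t \<and> a < int t \<and> b < int t \<and> c < int t"
    by (rule Vert_E [OF assms(1)])
  have nd: "\<not> (a + b + c = int t - 2 \<or> a + b + c = int t - 1 \<and> 1 \<le> b \<or> a + b + c = int t \<and> 1 \<le> a \<and> 1 \<le> b)"
    using assms(3) d_vert_pt [of a b c] abc s unfolding u by auto
  have "b \<noteq> 0"
  proof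
    assume b: "b = 0"
    \<comment> \<open>On the side b = 0 the boundary points of even index are green and those of odd
      index blue; in both cases c is \<open>n div 2\<close>.\<close>
    define n where "n = (if a + c = int t then 2 * nat c else 2 * nat c + 1)"
    have "n \<in> {1..2 * t - 1}" using abc s nd b by (auto simp: n_def)
    moreover have "c_pt v t n = u"
    proof (cases "a + c = int t")
      case True
      then show ?thesis using abc b by (simp add: c_pt_eq u n_def pt_eq_iff)
    next
      case False
      then have "a + c = int t - 1" using s nd b by auto
      then show ?thesis using abc b by (simp add: c_pt_eq u n_def pt_eq_iff)
    qed
    ultimately have "u \<in> R0 v t" unfolding R0_def by blast
    with assms(2) show False ..
  qed
  then have "a = 0" "b + c = int t" "1 \<le> b" "b < int t" using abc s nd by auto
  then have "nat b \<in> {1..<t}" "u = a_pt v t (2 * nat b)" by (auto simp: a_pt_eq u pt_eq_iff)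
  then show thesis by (rule that)
qed

lemma sink_b_pt:
  assumes "u \<in> R0 v t" "L \<in> lozenges_in v t" "d_vert L = u"
  obtains n where "n \<in> {1..t - 1}" "u = b_pt v t n"
  using assms c_pt_Vert(2) unfolding R0_def by blast

section \<open>Orientations and rooted forests\<close>

definition forest_edges :: "(lattice_point \<Rightarrow> space_point set) \<Rightarrow> lattice_point set set" where
  "forest_edges f = (\<lambda>u. {u, nxt f u}) ` (Vert v t - R0 v t)"

text \<open>The vertices whose iterated successors never meet a root form a closed set, which is
  empty by \<open>no_closed\<close>. The number of steps to the first root then serves as the
  rank.\<close>

lemma orientation_forest:
  assumes f: "orientation f"
  shows "\<exists>s. is_rooted_forest v t (forest_edges f, s) \<and> roots v t (forest_edges f, s) = R0 v t \<and>
    (\<forall>u \<in> Vert v t - R0 v t. (u, nxt f u) \<in> oriented_edges v t (forest_edges f, s))"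
proof -
  let ?V = "Vert v t" and ?R = "R0 v t"
  define J where "J = {u \<in> ?V. \<forall>k. (nxt f ^^ k) u \<notin> ?R}"
  have JN: "J \<subseteq> ?V - ?R" unfolding J_def using funpow_0 by (metis (mono_tags, lifting) DiffI mem_Collect_eq subsetI)
  have "nxt f u \<in> J" if "u \<in> J" for u
  proof -
    have "u \<in> ?V" "u \<notin> ?R" using that JN by auto
    then have "nxt f u \<in> ?V" by (rule orientationD(3) [OF f])
    moreover have "(nxt f ^^ k) (nxt f u) \<notin> ?R" for k
      using that unfolding J_def by (metis (mono_tags, lifting) funpow_Suc_right comp_apply mem_Collect_eq)
    ultimately show ?thesis unfolding J_def by simp
  qed
  then have "J = {}" using no_closed [OF f JN] by blast
  then have ex: "\<exists>k. (nxt f ^^ k) u \<in> ?R" if "u \<in> ?V" for u using that unfolding J_def by blast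
  define rk where "rk u = (LEAST k. (nxt f ^^ k) u \<in> ?R)" for u
  interpret F: functional_forest ?V ?R "nxt f" rk
  proof
    show "?R \<subseteq> ?V" by (rule R0_Vert)
  next
    fix u assume u: "u \<in> ?V - ?R"
    then show "nxt f u \<in> ?V" using orientationD(3) [OF f, of u] by simp
    have "\<exists>k. (nxt f ^^ k) u \<in> ?R" using ex [of u] u by simp
    then have rk: "(nxt f ^^ rk u) u \<in> ?R" unfolding rk_def by (rule LeastI_ex)
    then obtain m where m: "rk u = Suc m" using u by (cases "rk u") auto
    then have "(nxt f ^^ m) (nxt f u) \<in> ?R" using rk by (simp only: funpow_Suc_right o_apply)
    then have "rk (nxt f u) \<le> m" unfolding rk_def by (rule Least_le)
    then show "rk (nxt f u) < rk u" using m by simp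
  qed
  have E: "F.E = forest_edges f" by (simp add: F.E_def forest_edges_def)
  have diag: "{u, nxt f u} \<in> diagonals (f u)" "f u \<in> lozenges_in v t" if "u \<in> ?V - ?R" for u
    using that orientationD [OF f, of u] by auto
  have "is_forest v t (forest_edges f)"
    unfolding is_forest_def
  proof (intro conjI ballI)
    show "forest_edges f \<subseteq> (\<Union>L\<in>lozenges_in v t. diagonals L)"
      unfolding forest_edges_def using diag by blast
    show "acyclic_ugraph ?V (forest_edges f)" using F.acyclic unfolding E .
  next
    fix L assume L: "L \<in> lozenges_in v t"
    then obtain u where u: "u \<in> ?V - ?R" "f u = L"
      using f unfolding orientation_def bij_betw_def by (metis (no_types, lifting) imageE)
    show "\<exists>!A. A \<in> diagonals L \<and> A \<in> forest_edges f"
    proof (rule ex1I [of _ "{u, nxt f u}"])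
      show "{u, nxt f u} \<in> diagonals L \<and> {u, nxt f u} \<in> forest_edges f"
        using diag(1) [OF u(1)] u unfolding forest_edges_def by auto
    next
      fix A assume A: "A \<in> diagonals L \<and> A \<in> forest_edges f"
      then obtain w where w: "w \<in> ?V - ?R" "A = {w, nxt f w}" unfolding forest_edges_def by blast
      then have "f w = L" using diagonal_inj [OF diag(2) [OF w(1)] L] diag(1) [OF w(1)] A by blast
      then have "w = u" using orientation_inj [OF f w(1) u(1)] u(2) by simp
      then show "A = {u, nxt f u}" using w(2) by simp
    qed
  qed
  moreover have "F.root_of \<in> (\<Pi>\<^sub>E C\<in>conn_comps ?V (forest_edges f). C \<inter> boundary v t)"
  proof (rule PiE_I)
    fix C assume "C \<in> conn_comps ?V (forest_edges f)"
    then have "F.root_of C \<in> C \<inter> ?R" using F.root_of_in unfolding E by blast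
    then show "F.root_of C \<in> C \<inter> boundary v t" using R0_boundary by blast
  next
    fix C assume "C \<notin> conn_comps ?V (forest_edges f)"
    then show "F.root_of C = undefined" unfolding F.root_of_def E by simp
  qed
  moreover have "(u, nxt f u) \<in> oriented_edges v t (forest_edges f, F.root_of)" if u: "u \<in> ?V - ?R" for u
  proof -
    have uV: "u \<in> ?V" "u \<notin> ?R" using u by auto
    obtain p where "is_path (ugraph ?V (forest_edges f)) u ((u, nxt f u) # p) (F.rt u)"
      using F.path_to_root [OF uV(1)] uV(2) unfolding E by blast
    then show ?thesis using F.root_of_comp [OF uV(1)] unfolding E oriented_edges_def by auto
  qed
  ultimately show ?thesis
    unfolding is_rooted_forest_def roots_def using F.root_of_image unfolding E by auto
qed

lemma comp_of_eqI:
  assumes "wf_digraph (with_proj (ugraph V E))" "w \<in> comp_of V E u"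
  shows "comp_of V E w = comp_of V E u"
proof -
  interpret G: wf_digraph "with_proj (ugraph V E)" by fact
  have sym: "symmetric (with_proj (ugraph V E))"
    by (auto simp: symmetric_def sym_def ugraph_def insert_commute)
  have uw: "u \<rightarrow>\<^sup>*\<^bsub>with_proj (ugraph V E)\<^esub> w" using assms(2) by (simp add: comp_of_def)
  note wu = symmetric_reachable [OF sym uw]
  show ?thesis unfolding comp_of_def using G.reachable_trans [OF uw] G.reachable_trans [OF wu] by blast
qed

lemma forest_wf:
  assumes "is_forest v t E"
  shows "wf_digraph (with_proj (ugraph (Vert v t) E))"
proof
  fix e assume "e \<in> arcs (with_proj (ugraph (Vert v t) E))"
  then have "{fst e, snd e} \<in> E" by (auto simp: ugraph_def)
  then obtain L where L: "L \<in> lozenges_in v t" "{fst e, snd e} \<in> diagonals L"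
    using assms unfolding is_forest_def by blast
  show "tail (with_proj (ugraph (Vert v t) E)) e \<in> verts (with_proj (ugraph (Vert v t) E))"
    "head (with_proj (ugraph (Vert v t) E)) e \<in> verts (with_proj (ugraph (Vert v t) E))"
    using diagonal_vert [OF L] Vert_loz [OF L(1)] by (auto simp: ugraph_def)
qed

text \<open>\<open>f u\<close> is the lozenge of the edge leaving \<open>u\<close>. It is injective
  because a lozenge contains a single edge, oriented in only one direction, and surjective because
  every edge leaves some vertex.\<close>

lemma forest_orientation:
  assumes F: "is_rooted_forest v t (E, s)" and R: "roots v t (E, s) = R0 v t"
  shows "\<exists>f. orientation f \<and> E = forest_edges f \<and>
    oriented_edges v t (E, s) = (\<lambda>u. (u, nxt f u)) ` (Vert v t - R0 v t)"
proof -
  let ?V = "Vert v t" and ?R = "R0 v t"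
  have forest: "is_forest v t E" and s: "\<And>C. C \<in> conn_comps ?V E \<Longrightarrow> s C \<in> C"
    using F unfolding is_rooted_forest_def by auto
  have sub: "\<And>A. A \<in> E \<Longrightarrow> \<exists>L\<in>lozenges_in v t. A \<in> diagonals L"
    and one: "\<And>L. L \<in> lozenges_in v t \<Longrightarrow> \<exists>!A. A \<in> diagonals L \<and> A \<in> E"
    and ac: "acyclic_ugraph ?V E"
    using forest unfolding is_forest_def by blast+
  note wf = forest_wf [OF forest]
  interpret G: wf_digraph "with_proj (ugraph ?V E)" by (rule wf)
  define \<rho> where "\<rho> u = s (comp_of ?V E u)" for u
  have \<rho>_in: "\<rho> u \<in> comp_of ?V E u" if "u \<in> ?V" for u
    unfolding \<rho>_def using that by (intro s) (auto simp: conn_comps_def)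
  interpret rooted_ugraph ?V E \<rho>
  proof
    fix A assume "A \<in> E"
    then obtain L where L: "L \<in> lozenges_in v t" "A \<in> diagonals L" using sub by blast
    then obtain p q where pq: "ac_verts L = {p, q}" "X p < X q" by (rule_tac ac_vertsE)
    have "A = {b_vert L, d_vert L} \<or> A = {p, q}" using L(2) unfolding diagonals_eq [OF L(1)] pq(1) by blast
    moreover have "b_vert L \<noteq> d_vert L" using Y_b_d [OF L(1)] by auto
    moreover have "p \<noteq> q" using pq(2) by auto
    moreover have "b_vert L \<in> ?V" "d_vert L \<in> ?V" "p \<in> ?V" "q \<in> ?V"
      using Vert_loz [OF L(1)] loz_verts_eq [OF L(1)] pq(1) by auto
    ultimately show "\<exists>u w. A = {u, w} \<and> u \<noteq> w \<and> u \<in> ?V \<and> w \<in> ?V" by blast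
  next
    show "acyclic_ugraph ?V E" by (rule ac)
  next
    fix u assume "u \<in> ?V"
    then have "u \<rightarrow>\<^sup>*\<^bsub>with_proj (ugraph ?V E)\<^esub> \<rho> u" using \<rho>_in unfolding comp_of_def by blast
    then show "\<exists>p. is_path (ugraph ?V E) u p (\<rho> u)" unfolding G.reachable_apath .
  next
    fix u w assume "{u, w} \<in> E"
    then have "(u, w) \<in> arcs (with_proj (ugraph ?V E))" by (simp add: ugraph_def)
    then have "w \<in> comp_of ?V E u" unfolding comp_of_def
      using G.adj_in_verts by (simp add: G.reachable_adjI)
    then show "\<rho> u = \<rho> w" unfolding \<rho>_def using comp_of_eqI [OF wf] by simp
  qed
  have ori: "oriented_edges v t (E, s) = oriented"
    unfolding oriented_edges_def oriented_def \<rho>_def by simp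
  have R_eq: "?R = \<rho> ` ?V" using R unfolding roots_def \<rho>_def conn_comps_def image_image by simp
  have root_iff: "\<rho> u = u \<longleftrightarrow> u \<in> ?R" if "u \<in> ?V" for u
  proof
    assume "\<rho> u = u"
    then show "u \<in> ?R" unfolding R_eq using that by (intro image_eqI [of _ _ u]) simp_all
  next
    assume "u \<in> ?R"
    then obtain w where w: "u = \<rho> w" "w \<in> ?V" unfolding R_eq by (rule imageE)
    then show "\<rho> u = u" using comp_of_eqI [OF wf \<rho>_in [OF w(2)]] w(1) unfolding \<rho>_def by simp
  qed
  define nx where "nx u = (SOME w. (u, w) \<in> oriented)" for u
  have nx: "(u, nx u) \<in> oriented" if "u \<in> ?V - ?R" for u
    
  proof -
    have "u \<in> ?V" "u \<noteq> \<rho> u" using that root_iff [of u] by auto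
    then have "\<exists>w. (u, w) \<in> oriented" by (rule oriented_exists)
    then show ?thesis unfolding nx_def by (rule someI_ex)
  qed
  have ori_nx: "u \<in> ?V - ?R \<and> w = nx u" if "(u, w) \<in> oriented" for u w
  proof -
    have "u \<in> ?V" using oriented_D(1) [OF that] edge by blast
    then have u: "u \<in> ?V - ?R" using oriented_D(2) [OF that] root_iff [of u] by auto
    then show ?thesis using oriented_unique [OF that nx [OF u]] by blast
  qed
  define f where "f u = (SOME L. L \<in> lozenges_in v t \<and> {u, nx u} \<in> diagonals L)" for u
  have f: "f u \<in> lozenges_in v t" "{u, nx u} \<in> diagonals (f u)" "{u, nx u} \<in> E" if "u \<in> ?V - ?R" for u
  proof -
    show e: "{u, nx u} \<in> E" by (rule oriented_D(1) [OF nx [OF that]])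
    have "\<exists>L. L \<in> lozenges_in v t \<and> {u, nx u} \<in> diagonals L" using sub [OF e] by blast
    then have "f u \<in> lozenges_in v t \<and> {u, nx u} \<in> diagonals (f u)" unfolding f_def by (rule someI_ex)
    then show "f u \<in> lozenges_in v t" "{u, nx u} \<in> diagonals (f u)" by blast+
  qed
  have nxt: "nxt f u = nx u" if "u \<in> ?V - ?R" for u
    unfolding nxt_def by (rule opp_eqI [OF f(1,2) [OF that]])
  have tail: "\<exists>u \<in> ?V - ?R. A = {u, nx u}" if A: "A \<in> E" for A
  proof -
    obtain u w where uw: "A = {u, w}" using edges [OF A] by blast
    then have "(u, w) \<in> oriented \<or> (w, u) \<in> oriented" using oriented_edge A by blast
    then show ?thesis
    proof
      assume "(u, w) \<in> oriented"
      then show ?thesis using ori_nx uw by (intro bexI [of _ u]) simp_all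
    next
      assume "(w, u) \<in> oriented"
      then show ?thesis using ori_nx uw by (intro bexI [of _ w]) (auto simp: insert_commute)
    qed
  qed
  have "inj_on f (?V - ?R)"
  proof (rule inj_onI)
    fix u w assume uw: "u \<in> ?V - ?R" "w \<in> ?V - ?R" "f u = f w"
    have eq: "{u, nx u} = {w, nx w}"
      using one [OF f(1) [OF uw(1)]] f(2,3) [OF uw(1)] f(2,3) [OF uw(2)] uw(3) by auto
    show "u = w"
    proof (rule ccontr)
      assume "u \<noteq> w"
      then have "nx u = w" "nx w = u" using eq by (auto simp: doubleton_eq_iff)
      then show False using nx [OF uw(1)] nx [OF uw(2)] oriented_antisym [of u w] by simp
    qed
  qed
  moreover have "f ` (?V - ?R) = lozenges_in v t"
  proof (intro equalityI subsetI)
    fix L assume L: "L \<in> lozenges_in v t"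
    then obtain A where A: "A \<in> diagonals L" "A \<in> E" using one by blast
    then obtain u where u: "u \<in> ?V - ?R" "A = {u, nx u}" using tail by blast
    then have "f u = L" using diagonal_inj [OF f(1) [OF u(1)] L f(2) [OF u(1)]] A(1) by blast
    then show "L \<in> f ` (?V - ?R)" using u(1) by blast
  next
    fix L assume "L \<in> f ` (?V - ?R)"
    then obtain u where "L = f u" "u \<in> ?V - ?R" by (rule imageE)
    then show "L \<in> lozenges_in v t" using f(1) by simp
  qed
  moreover have "u \<in> loz_verts (f u)" if "u \<in> ?V - ?R" for u
    by (rule diagonal_vert(1) [OF f(1,2) [OF that]])
  ultimately have "orientation f" by (simp add: orientation_def bij_betw_def)
  moreover have "E = forest_edges f"
  proof (intro equalityI subsetI)
    fix A assume "A \<in> E"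
    then obtain u where u: "u \<in> ?V - ?R" "A = {u, nx u}" using tail by blast
    show "A \<in> forest_edges f"
      unfolding forest_edges_def u(2) nxt [OF u(1), symmetric] using u(1) by (rule imageI)
  next
    fix A assume "A \<in> forest_edges f"
    then obtain u where u: "A = {u, nxt f u}" "u \<in> ?V - ?R" unfolding forest_edges_def by (rule imageE)
    show "A \<in> E" unfolding u(1) nxt [OF u(2)] by (rule f(3) [OF u(2)])
  qed
  moreover have "oriented = (\<lambda>u. (u, nxt f u)) ` (?V - ?R)"
  proof (intro equalityI subsetI)
    fix e assume e: "e \<in> oriented"
    obtain u w where uw: "e = (u, w)" by (cases e)
    then have u: "u \<in> ?V - ?R" "w = nx u" using ori_nx e by blast+
    show "e \<in> (\<lambda>u. (u, nxt f u)) ` (?V - ?R)"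
      using u(1) by (intro image_eqI [of _ _ u]) (simp_all only: uw u(2) nxt)
  next
    fix e assume "e \<in> (\<lambda>u. (u, nxt f u)) ` (?V - ?R)"
    then obtain u where u: "e = (u, nxt f u)" "u \<in> ?V - ?R" by (rule imageE)
    show "e \<in> oriented" unfolding u(1) nxt [OF u(2)] by (rule nx [OF u(2)])
  qed
  ultimately show ?thesis unfolding ori by blast
qed

end

text \<open>A strictly decreasing selfmap of 1, ..., t - 1 has no slack: induction from the lower
  end gives one inequality, from the upper end the other.\<close>

lemma antitone_interval:
  fixes \<sigma> :: "nat \<Rightarrow> nat"
  assumes range: "\<And>i. i \<in> {1..<t} \<Longrightarrow> \<sigma> i \<in> {1..<t}"
    and anti: "\<And>i i'. i \<in> {1..<t} \<Longrightarrow> i' \<in> {1..<t} \<Longrightarrow> i < i' \<Longrightarrow> \<sigma> i' < \<sigma> i"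
    and i: "i \<in> {1..<t}"
  shows "\<sigma> i = t - i"
proof -
  have "\<sigma> j + j \<le> t" if "j \<in> {1..<t}" for j
    using that
  proof (induction j)
    case (Suc j)
    show ?case
    proof (cases "j = 0")
      case True
      then show ?thesis using range [OF Suc.prems] by auto
    next
      case False
      then show ?thesis using Suc anti [of j "Suc j"] by auto
    qed
  qed simp
  moreover have "t \<le> \<sigma> (t - k) + (t - k)" if "k \<in> {1..<t}" for k
    using that
  proof (induction k)
    case (Suc k)
    show ?case
    proof (cases "k = 0")
      case True
      have "t - 1 \<in> {1..<t}" using Suc.prems by auto
      then have "1 \<le> \<sigma> (t - 1)" using range by fastforce
      then show ?thesis using True by simp
    next
      case False
      then have "t \<le> \<sigma> (t - k) + (t - k)" using Suc by auto
      moreover have "\<sigma> (t - k) < \<sigma> (t - Suc k)" using False Suc.prems by (intro anti) auto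
      ultimately show ?thesis using Suc.prems by auto
    qed
  qed simp
  moreover have "t - i \<in> {1..<t}" "t - (t - i) = i" using i by auto
  ultimately have "\<sigma> i + i \<le> t" "t \<le> \<sigma> i + i" using i by metis+
  then show ?thesis by simp
qed

section \<open>Orientations and path tuples\<close>

context lozenge_triangle begin

lemma horizontal_step:
  assumes "L \<in> lozenges_in v t" "u \<in> loz_verts L" "u \<noteq> d_vert L" "Y (d_vert L) = Y u"
  shows "green u \<and> \<not> green (d_vert L)"
proof -
  have "u = b_vert L \<or> u \<in> ac_verts L" using assms(2,3) loz_verts_d [OF assms(1)] by blast
  then have "u \<in> ac_verts L" using assms(4) Y_b_d [OF assms(1)] by auto
  then show ?thesis using step_shape(2) [OF assms(1-3)] assms(4) green_ac [OF assms(1)] by simp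
qed

text \<open>Height dominates. A horizontal step leads from green to another colour, so the bonus of
  2 for green makes it a descent, and a centre lies just above its lower corner.\<close>

definition potential :: "net_vertex \<Rightarrow> int" where
  "potential y = (case y of Lattice u \<Rightarrow> 4 * Y u + 2 * of_bool (green u)
     | Center L \<Rightarrow> 4 * Y (d_vert L) + 2 * of_bool (green (d_vert L)) + 1)"

lemma net_acyclic: "acyclic (parcs net)"
proof (rule acyclicI_order [where f = potential])
  fix x y assume "(x, y) \<in> parcs net"
  then obtain L where L: "L \<in> lozenges_in v t"
    and "(\<exists>u. u \<in> loz_verts L \<and> u \<noteq> d_vert L \<and> (x, y) = (Lattice u, Center L)) \<or> (x, y) = (Center L, Lattice (d_vert L))"
    unfolding net_arcs by blast
  then consider u where "u \<in> loz_verts L" "u \<noteq> d_vert L" "x = Lattice u" "y = Center L"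
    | "x = Center L" "y = Lattice (d_vert L)" by blast
  then show "potential y < potential x"
  proof cases
    case 1
    have "Y (d_vert L) \<le> Y u" using step_shape(1) [OF L 1(1,2)] by auto
    then consider "Y (d_vert L) \<le> Y u - 1" | "Y (d_vert L) = Y u" by linarith
    then show ?thesis using horizontal_step [OF L 1(1,2)] by cases (auto simp: 1(3,4) potential_def of_bool_def)
  next
    case 2
    then show ?thesis by (simp add: potential_def)
  qed
qed

definition arcs_of :: "(lattice_point \<Rightarrow> space_point set) \<Rightarrow> (net_vertex \<times> net_vertex) set" where
  "arcs_of f = (\<Union>u \<in> {u \<in> Vert v t - R0 v t. u \<noteq> d_vert (f u)}.
     {(Lattice u, Center (f u)), (Center (f u), Lattice (d_vert (f u)))})"

lemma arcs_of_iff: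
  "(Lattice u, y) \<in> arcs_of f \<longleftrightarrow> u \<in> Vert v t - R0 v t \<and> u \<noteq> d_vert (f u) \<and> y = Center (f u)"
  "(Center L, y) \<in> arcs_of f \<longleftrightarrow> (\<exists>u \<in> Vert v t - R0 v t. u \<noteq> d_vert L \<and> f u = L \<and> y = Lattice (d_vert L))"
  "(y, Lattice w) \<in> arcs_of f \<longleftrightarrow> (\<exists>u \<in> Vert v t - R0 v t. u \<noteq> d_vert (f u) \<and> y = Center (f u) \<and> w = d_vert (f u))"
  "(y, Center L) \<in> arcs_of f \<longleftrightarrow> (\<exists>u \<in> Vert v t - R0 v t. u \<noteq> d_vert L \<and> f u = L \<and> y = Lattice u)"
  unfolding arcs_of_def by auto

lemma arcs_of_Center: "Center L \<in> Domain (arcs_of f) \<longleftrightarrow> Center L \<in> Range (arcs_of f)"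
  unfolding Domain_iff Range_iff arcs_of_iff by blast

text \<open>\<open>phi\<close> collects the arcs lozenge by lozenge, \<open>arcs_of\<close> vertex
  by vertex; they agree because an edge determines its lozenge.\<close>

lemma phi_eq_arcs_of:
  assumes f: "orientation f"
    and F: "oriented_edges v t F = (\<lambda>u. (u, nxt f u)) ` (Vert v t - R0 v t)"
  shows "phi v t F = arcs_of f"
proof -
  have D: "f u \<in> lozenges_in v t" "{u, nxt f u} \<in> diagonals (f u)" if "u \<in> Vert v t - R0 v t" for u
    using that orientationD [OF f, of u] by auto
  have "phi v t F = (\<Union>L\<in>lozenges_in v t. \<Union>u\<in>{u \<in> Vert v t - R0 v t. {u, nxt f u} \<in> diagonals L}.
    if u = d_vert L then {} else {(Lattice u, Center L), (Center L, Lattice (d_vert L))})"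
  proof -
    have "{(u, w) \<in> (\<lambda>u. (u, nxt f u)) ` (Vert v t - R0 v t). {u, w} \<in> diagonals L} =
      (\<lambda>u. (u, nxt f u)) ` {u \<in> Vert v t - R0 v t. {u, nxt f u} \<in> diagonals L}" for L by blast
    then show ?thesis unfolding phi_def F by (simp only: UN_simps(10) prod.case)
  qed
  also have "\<dots> = (\<Union>u\<in>Vert v t - R0 v t. if u = d_vert (f u) then {}
    else {(Lattice u, Center (f u)), (Center (f u), Lattice (d_vert (f u)))})" (is "?l = ?r")
  proof (intro equalityI subsetI)
    fix e assume "e \<in> ?l"
    then obtain L u where L: "L \<in> lozenges_in v t" and u: "u \<in> Vert v t - R0 v t" "{u, nxt f u} \<in> diagonals L"
      and e: "e \<in> (if u = d_vert L then {} else {(Lattice u, Center L), (Center L, Lattice (d_vert L))})" by blast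
    have "f u = L" by (rule diagonal_inj [OF D(1) [OF u(1)] L D(2) [OF u(1)] u(2)])
    then show "e \<in> ?r" using u(1) e by blast
  next
    fix e assume "e \<in> ?r"
    then obtain u where u: "u \<in> Vert v t - R0 v t"
      and e: "e \<in> (if u = d_vert (f u) then {} else {(Lattice u, Center (f u)), (Center (f u), Lattice (d_vert (f u)))})" by blast
    show "e \<in> ?l" using D [OF u] u e by blast
  qed
  also have "\<dots> = arcs_of f" unfolding arcs_of_def by auto
  finally show ?thesis .
qed

lemma arcs_of_inj:
  assumes f: "orientation f" and g: "orientation g" and eq: "arcs_of f = arcs_of g"
    and u: "u \<in> Vert v t - R0 v t"
  shows "f u = g u"
proof (cases "u = d_vert (f u)")
  case False
  then have "(Lattice u, Center (f u)) \<in> arcs_of g" using u unfolding eq [symmetric] arcs_of_iff by simp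
  then show ?thesis unfolding arcs_of_iff by simp
next
  case True
  have "u = d_vert (g u)"
  proof (rule ccontr)
    assume "u \<noteq> d_vert (g u)"
    then have "(Lattice u, Center (g u)) \<in> arcs_of f" using u unfolding eq arcs_of_iff by simp
    then show False using True unfolding arcs_of_iff by simp
  qed
  then show ?thesis using True u orientationD(1) [OF f, of u] orientationD(1) [OF g, of u]
    by (intro d_vert_inj) auto
qed

lemma arcs_of_net: "orientation f \<Longrightarrow> arcs_of f \<subseteq> parcs net"
proof
  fix e assume f: "orientation f" and "e \<in> arcs_of f"
  then obtain u where u: "u \<in> Vert v t - R0 v t" "u \<noteq> d_vert (f u)"
    and e: "e = (Lattice u, Center (f u)) \<or> e = (Center (f u), Lattice (d_vert (f u)))"
    unfolding arcs_of_def by blast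
  have "f u \<in> lozenges_in v t" "u \<in> loz_verts (f u)" using u(1) orientationD [OF f, of u] by auto
  then show "e \<in> parcs net" using e u(2) by (elim disjE) (simp_all add: net_arc_Lattice net_arc_Center)
qed

text \<open>A lower corner \<open>w\<close> of \<open>L\<close> is entered from the \<open>u\<close>
  with \<open>f u = L\<close>, unless u = w, and then no arc leaves \<open>w\<close>. So a source is
  not a lower corner at all.\<close>

lemma arcs_of_source:
  assumes f: "orientation f"
  shows "x \<in> Domain (arcs_of f) - Range (arcs_of f) \<longleftrightarrow> (\<exists>i \<in> {1..<t}. x = Lattice (a_pt v t (2 * i)))"
proof
  assume x: "x \<in> Domain (arcs_of f) - Range (arcs_of f)"
  have "\<exists>w. x = Lattice w"
  proof (cases x)
    case (Center L)
    with x show ?thesis using arcs_of_Center by blast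
  qed blast
  then obtain w where w: "x = Lattice w" by blast
  then have wN: "w \<in> Vert v t - R0 v t" "w \<noteq> d_vert (f w)" using x unfolding w by (auto simp: arcs_of_iff(1))
  have "\<not> (\<exists>L\<in>lozenges_in v t. d_vert L = w)"
  proof
    assume "\<exists>L\<in>lozenges_in v t. d_vert L = w"
    then obtain L where L: "L \<in> lozenges_in v t" "d_vert L = w" by blast
    then obtain u where u: "u \<in> Vert v t - R0 v t" "f u = L"
      using f unfolding orientation_def bij_betw_def by (metis (no_types, lifting) imageE)
    have "u \<noteq> d_vert L"
    proof
      assume "u = d_vert L"
      then show False using u L wN(2) by simp
    qed
    then have "(Center L, Lattice w) \<in> arcs_of f" using u L(2) unfolding arcs_of_iff(2) by auto
    then show False using x w by blast
  qed
  then show "\<exists>i \<in> {1..<t}. x = Lattice (a_pt v t (2 * i))"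
    using source_a_pt [of w] wN(1) w by (metis DiffD1 DiffD2)
next
  assume "\<exists>i \<in> {1..<t}. x = Lattice (a_pt v t (2 * i))"
  then obtain i where i: "i \<in> {1..<t}" "x = Lattice (a_pt v t (2 * i))" by blast
  let ?a = "a_pt v t (2 * i)"
  note a = a_pt_source [OF i(1)]
  have L: "f ?a \<in> lozenges_in v t" by (rule orientationD(1) [OF f a(1,2)])
  have "?a \<noteq> d_vert (f ?a)" using a(3) L by auto
  then have "(x, Center (f ?a)) \<in> arcs_of f" using a(1,2) unfolding i(2) arcs_of_iff(1) by simp
  moreover have "x \<notin> Range (arcs_of f)"
  proof
    assume "x \<in> Range (arcs_of f)"
    then obtain u where u: "u \<in> Vert v t - R0 v t" "?a = d_vert (f u)"
      unfolding i(2) by (auto simp: arcs_of_iff(3))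
    then have "f u \<in> lozenges_in v t" using orientationD(1) [OF f, of u] by simp
    then show False using a(3) u(2) by auto
  qed
  ultimately show "x \<in> Domain (arcs_of f) - Range (arcs_of f)" by blast
qed

lemma arcs_of_sink:
  assumes f: "orientation f" and y: "y \<in> Range (arcs_of f)" "y \<notin> Domain (arcs_of f)"
  shows "\<exists>n \<in> {1..<t}. y = Lattice (b_pt v t n)"
proof (cases y)
  case (Center L)
  then show ?thesis using y arcs_of_Center by blast
next
  case (Lattice w)
  then obtain u where u: "u \<in> Vert v t - R0 v t" "u \<noteq> d_vert (f u)" "w = d_vert (f u)"
    using y(1) by (auto simp: arcs_of_iff(3))
  have L: "f u \<in> lozenges_in v t" using u(1) orientationD(1) [OF f, of u] by simp
  have w: "w \<in> Vert v t" unfolding u(3) by (rule Vert_loz [OF L d_vert_loz [OF L]])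
  have "w \<in> R0 v t"
  proof (rule ccontr)
    assume "w \<notin> R0 v t"
    then have wN: "w \<in> Vert v t - R0 v t" using w by simp
    \<comment> \<open>A non-root without outgoing arc is the lower corner of its own lozenge. That
      is the lozenge through which it was entered, and \<open>f\<close> takes this value only
      once.\<close>
    then have "w = d_vert (f w)" using y(2) unfolding Lattice by (auto simp: arcs_of_iff(1))
    then have "f w = f u" using wN u(3) orientationD(1) [OF f, of w] by (intro d_vert_inj [OF _ L]) auto
    then have "w = u" by (rule orientation_inj [OF f wN u(1)])
    then show False using u(2,3) by simp
  qed
  then obtain n where "n \<in> {1..t - 1}" "w = b_pt v t n" by (rule sink_b_pt [OF _ L u(3) [symmetric]])
  then show ?thesis using t_ge2 Lattice by (intro bexI [of _ n]) auto
qed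

abbreviation starts :: "net_vertex list" where
  "starts \<equiv> map (\<lambda>i. Lattice (a_pt v t (2 * i))) [1..<t]"

abbreviation ends :: "net_vertex list" where
  "ends \<equiv> map (\<lambda>i. Lattice (b_pt v t (t - i))) [1..<t]"

text \<open>The arcs form an acyclic partial injection and hence split into disjoint maximal paths
  from sources to sinks. The index \<sigma> i of the sink reached is at first only known to lie
  between 1 and t - 1; \<open>noncrossing\<close> makes \<sigma> decreasing, which forces t -
  i.\<close>

lemma arcs_of_path_tuple:
  assumes f: "orientation f"
  shows "arcs_of f \<in> path_tuples (N_tilde x v t) starts ends"
proof -
  let ?A = "arcs_of f" and ?s = "\<lambda>i. Lattice (a_pt v t (2 * i))"
  have fin: "finite ?A" unfolding arcs_of_def using finite_Vert by auto
  have ac: "acyclic ?A" by (rule acyclic_subset [OF net_acyclic arcs_of_net [OF f]])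
  have sv: "single_valued ?A"
  proof (rule single_valuedI)
    fix y z z' assume "(y, z) \<in> ?A" "(y, z') \<in> ?A"
    then show "z = z'" by (cases y) (auto simp: arcs_of_iff(1,2))
  qed
  have sv': "single_valued (?A\<inverse>)"
  proof (rule single_valuedI)
    fix y z z' assume yz: "(y, z) \<in> ?A\<inverse>" "(y, z') \<in> ?A\<inverse>"
    show "z = z'"
    proof (cases y)
      case (Lattice w)
      then obtain u u' where u: "u \<in> Vert v t - R0 v t" "z = Center (f u)" "w = d_vert (f u)"
        and u': "u' \<in> Vert v t - R0 v t" "z' = Center (f u')" "w = d_vert (f u')"
        using yz by (auto simp: arcs_of_iff(3))
      have "f u \<in> lozenges_in v t" "f u' \<in> lozenges_in v t"
        using u(1) u'(1) orientationD(1) [OF f] by auto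
      moreover have "d_vert (f u) = d_vert (f u')" using u(3) u'(3) by (rule trans [OF sym])
      ultimately have "f u = f u'" by (rule d_vert_inj)
      then show ?thesis unfolding u(2) u'(2) by (rule arg_cong)
    next
      case (Center L)
      then have "(z, Center L) \<in> ?A" "(z', Center L) \<in> ?A" using yz by simp_all
      then obtain u u' where u: "u \<in> Vert v t - R0 v t" "f u = L" "z = Lattice u"
        and u': "u' \<in> Vert v t - R0 v t" "f u' = L" "z' = Lattice u'"
        unfolding arcs_of_iff(4) by (elim bexE conjE) (rule that)
      have "f u = f u'" unfolding u(2) u'(2) ..
      then have "u = u'" by (rule orientation_inj [OF f u(1) u'(1)])
      then show ?thesis unfolding u(3) u'(3) by (rule arg_cong)
    qed
  qed
  have wf: "snd e \<in> pverts net" if "e \<in> parcs net" for e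
    using net_wf that unfolding pair_wf_digraph_def by blast
  have src: "?s i \<in> Domain ?A" "?s i \<notin> Range ?A" if "i \<in> {1..<t}" for i
    using arcs_of_source [OF f, of "?s i"] that by blast+
  define Q where "Q i p n \<longleftrightarrow> n \<in> {1..<t} \<and> is_path net (?s i) p (Lattice (b_pt v t n)) \<and>
    set (pawalk_verts (?s i) p) = ?A\<^sup>* `` {?s i} \<and> set p = {e \<in> ?A. (?s i, fst e) \<in> ?A\<^sup>*}" for i p n
  have ex: "\<exists>p n. Q i p n" if i: "i \<in> {1..<t}" for i
  proof -
    have "?s i \<in> pverts net" unfolding net_verts using a_pt_source(1) [OF i] by simp
    then obtain p y where p: "is_path net (?s i) p y" "y \<notin> Domain ?A"
      "set (pawalk_verts (?s i) p) = ?A\<^sup>* `` {?s i}" "set p = {e \<in> ?A. (?s i, fst e) \<in> ?A\<^sup>*}"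
      using functional_path [OF fin ac sv arcs_of_net [OF f] _ wf] by blast
    have "y \<in> ?A\<^sup>* `` {?s i}"
      unfolding p(3) [symmetric] using p(1) pawalk_verts_end [of "?s i" p y] unfolding is_path_iff by simp
    moreover have "y \<noteq> ?s i" using p(2) src(1) [OF i] by auto
    ultimately have "y \<in> Range ?A" by (auto elim: rtranclE)
    then obtain n where "n \<in> {1..<t}" "y = Lattice (b_pt v t n)" using arcs_of_sink [OF f _ p(2)] by blast
    then show ?thesis using p unfolding Q_def by blast
  qed
  then have "\<forall>i\<in>{1..<t}. \<exists>p. \<exists>n. Q i p n" by blast
  from bchoice [OF this] obtain P where "\<forall>i\<in>{1..<t}. \<exists>n. Q i (P i) n" ..
  from bchoice [OF this] obtain \<sigma> where \<sigma>Q: "\<forall>i\<in>{1..<t}. Q i (P i) (\<sigma> i)" ..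
  have \<sigma>: "\<sigma> i \<in> {1..<t}"
    and path: "is_path net (?s i) (P i) (Lattice (b_pt v t (\<sigma> i)))"
    and verts: "set (pawalk_verts (?s i) (P i)) = ?A\<^sup>* `` {?s i}"
    and arcs: "set (P i) = {e \<in> ?A. (?s i, fst e) \<in> ?A\<^sup>*}" if "i \<in> {1..<t}" for i
    using bspec [OF \<sigma>Q that] unfolding Q_def by simp_all
  have dis: "path_verts net (?s i) (P i) \<inter> path_verts net (?s j) (P j) = {}"
    if "i \<in> {1..<t}" "j \<in> {1..<t}" "i \<noteq> j" for i j
  proof -
    have "?s i \<noteq> ?s j" using that(3) Y_a_pt [of i] Y_a_pt [of j] by auto
    then show ?thesis unfolding awalk_verts_with_proj_eq verts [OF that(1)] verts [OF that(2)]
      using reach_disjoint [OF sv' src(2) [OF that(1)] src(2) [OF that(2)]] by auto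
  qed
  have \<sigma>_eq: "\<sigma> i = t - i" if "i \<in> {1..<t}" for i
  proof (rule antitone_interval [OF \<sigma> _ that])
    fix i i' assume i: "i \<in> {1..<t}" "i' \<in> {1..<t}" "i < i'"
    show "\<sigma> i' < \<sigma> i"
      using noncrossing [OF path [OF i(1)] path [OF i(2)] dis [OF i(1,2)] i(3)] i(3) \<sigma> [OF i(2)] by auto
  qed
  let ?ps = "map P [1..<t]"
  have nth: "starts ! k = ?s (Suc k)" "ends ! k = Lattice (b_pt v t (t - Suc k))" "?ps ! k = P (Suc k)"
    "Suc k \<in> {1..<t}" if "k < length ?ps" for k
    using that by simp_all
  have "?A = \<Union> (set ` set ?ps)"
  proof (intro equalityI subsetI)
    fix e assume e: "e \<in> ?A"
    then have "fst e \<in> Domain ?A" by (cases e) auto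
    then obtain u where u: "u \<in> Domain ?A - Range ?A" "(u, fst e) \<in> ?A\<^sup>*" using source_exists [OF fin ac] by blast
    then obtain i where i: "i \<in> {1..<t}" "u = ?s i" using arcs_of_source [OF f] by blast
    then have "e \<in> set (P i)" using arcs [OF i(1)] e u(2) by simp
    then show "e \<in> \<Union> (set ` set ?ps)" using i(1) by auto
  next
    fix e assume "e \<in> \<Union> (set ` set ?ps)"
    then obtain i where "i \<in> {1..<t}" "e \<in> set (P i)" by auto
    then show "e \<in> ?A" using arcs by blast
  qed
  moreover have "is_path net (starts ! k) (?ps ! k) (ends ! k)" if "k < length ?ps" for k
    using path [OF nth(4) [OF that]] \<sigma>_eq [OF nth(4) [OF that]] nth(1-3) [OF that] by simp
  moreover have "path_verts net (starts ! k) (?ps ! k) \<inter> path_verts net (starts ! l) (?ps ! l) = {}"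
    if "k < length ?ps" "l < length ?ps" "k \<noteq> l" for k l
    using dis [OF nth(4) [OF that(1)] nth(4) [OF that(2)]] that(3) nth(1,3) [OF that(1)] nth(1,3) [OF that(2)] by simp
  ultimately show ?thesis
    unfolding path_tuples_def net_graph_N_tilde mem_Collect_eq by (intro exI [of _ ?ps]) simp
qed

lemma path_tuple_orientation:
  assumes A: "A \<in> path_tuples (N_tilde x v t) starts ends"
  shows "\<exists>f. orientation f \<and> arcs_of f = A"
proof -
  let ?N = "Vert v t - R0 v t"
  let ?s = "\<lambda>k. Lattice (a_pt v t (2 * Suc k))" and ?e = "\<lambda>k. Lattice (b_pt v t (t - Suc k))"
  obtain ps where ps: "A = \<Union> (set ` set ps)" "length starts = length ends" "length ps = length starts"
    "\<forall>k<length ps. is_path net (starts ! k) (ps ! k) (ends ! k)"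
    "\<forall>k<length ps. \<forall>l<length ps. k \<noteq> l \<longrightarrow>
       path_verts net (starts ! k) (ps ! k) \<inter> path_verts net (starts ! l) (ps ! l) = {}"
    using A unfolding path_tuples_def net_graph_N_tilde mem_Collect_eq by blast
  have len: "length ps = t - 1" using ps(3) by simp
  have nth: "starts ! k = ?s k" "ends ! k = ?e k" "Suc k \<in> {1..<t}" "t - Suc k \<in> {1..t - 1}"
    if "k < t - 1" for k using that by (simp_all, arith+)
  define W where "W k = path_verts net (?s k) (ps ! k)" for k
  have path: "is_path net (?s k) (ps ! k) (?e k)" if "k < t - 1" for k
    using ps(4) len that nth(1,2) [OF that] by simp
  have dis: "k = l" if "k < t - 1" "l < t - 1" "z \<in> W k" "z \<in> W l" for k l z
    using ps(5) [rule_format, of k l] len that nth(1) [OF that(1)] nth(1) [OF that(2)] unfolding W_def by auto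
  have Afst: "fst ` set (ps ! k) = W k - {?e k}" and Asnd: "snd ` set (ps ! k) = W k - {?s k}"
    and injfst: "inj_on fst (set (ps ! k))" and injsnd: "inj_on snd (set (ps ! k))"
    and ends_W: "?s k \<in> W k" "?e k \<in> W k"
    if "k < t - 1" for k
  proof -
    interpret G: pair_wf_digraph net by (rule net_wf)
    show "fst ` set (ps ! k) = W k - {?e k}" "inj_on fst (set (ps ! k))"
      using G.apath_bij_betw(1) [OF path [OF that]] unfolding W_def bij_betw_def by simp_all
    show "snd ` set (ps ! k) = W k - {?s k}" "inj_on snd (set (ps ! k))"
      using G.apath_bij_betw(2) [OF path [OF that]] unfolding W_def bij_betw_def by simp_all
    show "?s k \<in> W k" "?e k \<in> W k" using net_path_ends [OF path [OF that]] unfolding W_def .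
  qed
  have inA: "\<exists>k < t - 1. e \<in> set (ps ! k)" if "e \<in> A" for e
  proof -
    note asm = that
    obtain p where "p \<in> set ps" "e \<in> set p" using asm unfolding ps(1) by blast
    then show ?thesis using len unfolding in_set_conv_nth [of p] by auto
  qed
  have subA: "e \<in> A" if "e \<in> set (ps ! k)" "k < t - 1" for e k
  proof -
    have "ps ! k \<in> set ps" using that(2) len by simp
    then show ?thesis using that(1) unfolding ps(1) by blast
  qed
  have net: "A \<subseteq> parcs net"
    using inA net_path_arcs [OF path] by blast
  have W_fst: "fst e \<in> W k" and W_snd: "snd e \<in> W k" if "e \<in> set (ps ! k)" "k < t - 1" for e k
    using Afst [OF that(2)] Asnd [OF that(2)] that(1) by blast+
  have same: "e \<in> set (ps ! k)" if "e \<in> A" "k < t - 1" "fst e \<in> W k \<or> snd e \<in> W k" for e k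
  proof -
    note asm = that
    obtain l where l: "l < t - 1" "e \<in> set (ps ! l)" using inA asm(1) by blast
    then have "k = l" using that W_fst W_snd dis by blast
    then show ?thesis using l by simp
  qed
  have out_unique: "y = y'" if "(z, y) \<in> A" "(z, y') \<in> A" for z y y'
  proof -
    note asm = that
    obtain k where k: "k < t - 1" "(z, y) \<in> set (ps ! k)" using inA asm(1) by blast
    then have "(z, y') \<in> set (ps ! k)" using W_fst [OF k(2,1)] by (intro same [OF that(2)]) auto
    then show ?thesis using injfst [OF k(1)] k(2) unfolding inj_on_def by fastforce
  qed
  have in_unique: "y = y'" if "(y, z) \<in> A" "(y', z) \<in> A" for z y y'
  proof -
    note asm = that
    obtain k where k: "k < t - 1" "(y, z) \<in> set (ps ! k)" using inA asm(1) by blast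
    then have "(y', z) \<in> set (ps ! k)" using W_snd [OF k(2,1)] by (intro same [OF that(2)]) auto
    then show ?thesis using injsnd [OF k(1)] k(2) unfolding inj_on_def by fastforce
  qed
  have out: "z \<in> Domain A" if "z \<in> W k" "k < t - 1" "z \<noteq> ?e k" for z k
  proof -
    have "z \<in> fst ` set (ps ! k)" using Afst [OF that(2)] that(1,3) by blast
    then obtain e where "z = fst e" "e \<in> set (ps ! k)" by (rule imageE)
    then show ?thesis using subA [OF _ that(2)] by (cases e) auto
  qed
  have inn: "z \<in> Range A" if "z \<in> W k" "k < t - 1" "z \<noteq> ?s k" for z k
  proof -
    have "z \<in> snd ` set (ps ! k)" using Asnd [OF that(2)] that(1,3) by blast
    then obtain e where "z = snd e" "e \<in> set (ps ! k)" by (rule imageE)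
    then show ?thesis using subA [OF _ that(2)] by (cases e) auto
  qed
  have s_e: "?s k \<noteq> ?e k" if "k < t - 1" for k
    using a_pt_source(2) [OF nth(3) [OF that]] b_pt_R0 [OF nth(4) [OF that]] by auto
  have Range_Domain: "z \<in> Domain A \<or> (\<exists>n \<in> {1..t - 1}. z = Lattice (b_pt v t n))" if "z \<in> Range A" for z
  proof -
    note asm = that
    obtain y where "(y, z) \<in> A" using asm by blast
    then obtain k where k: "k < t - 1" "(y, z) \<in> set (ps ! k)" using inA by blast
    then have "z \<in> W k" using W_snd by force
    then show ?thesis using out k(1) nth(4) [OF k(1)] by blast
  qed
  have Domain_Range: "z \<in> Range A \<or> (\<exists>i \<in> {1..<t}. z = Lattice (a_pt v t (2 * i)))" if "z \<in> Domain A" for z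
  proof -
    note asm = that
    obtain y where "(z, y) \<in> A" using asm by blast
    then obtain k where k: "k < t - 1" "(z, y) \<in> set (ps ! k)" using inA by blast
    then have "z \<in> W k" using W_fst by force
    then show ?thesis using inn k(1) nth(3) [OF k(1)] by blast
  qed
  have a_out: "Lattice (a_pt v t (2 * i)) \<in> Domain A" if "i \<in> {1..<t}" for i
  proof -
    have k: "i - 1 < t - 1" "Suc (i - 1) = i" using that by auto
    show ?thesis using out [OF ends_W(1) [OF k(1)] k(1) s_e [OF k(1)]] unfolding k(2) .
  qed
  have b_in: "Lattice (b_pt v t n) \<in> Range A" "Lattice (b_pt v t n) \<notin> Domain A" if "n \<in> {1..t - 1}" for n
  proof -
    define k where "k = t - Suc n"
    have k: "k < t - 1" "t - Suc k = n" using that by (auto simp: k_def)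
    show "Lattice (b_pt v t n) \<in> Range A"
      using inn [OF ends_W(2) [OF k(1)] k(1) s_e [OF k(1), symmetric]] unfolding k(2) .
    show "Lattice (b_pt v t n) \<notin> Domain A"
    proof
      assume "Lattice (b_pt v t n) \<in> Domain A"
      then obtain y where y: "(?e k, y) \<in> A" unfolding k(2) by blast
      then have "(?e k, y) \<in> set (ps ! k)" using ends_W(2) [OF k(1)] by (intro same [OF y k(1)]) simp
      then show False using Afst [OF k(1)] by force
    qed
  qed
  have arcL: "\<exists>L. y = Center L \<and> L \<in> lozenges_in v t \<and> u \<in> loz_verts L \<and> u \<noteq> d_vert L"
    if "(Lattice u, y) \<in> A" for u y
    using net that net_arc_Lattice by blast
  have arcC: "y = Lattice (d_vert L) \<and> L \<in> lozenges_in v t" if "(Center L, y) \<in> A" for L y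
    using net that net_arc_Center by blast
  have arc_C: "\<exists>u. y = Lattice u" if "(y, Center L) \<in> A" for y L
  proof (cases y)
    case (Center M)
    then show ?thesis using arcC [of M "Center L"] that by simp
  qed blast
  have arc_L: "\<exists>L. y = Center L \<and> u = d_vert L \<and> L \<in> lozenges_in v t" if "(y, Lattice u) \<in> A" for y u
  proof (cases y)
    case (Lattice w)
    then show ?thesis using arcL [of w "Lattice u"] that by simp
  next
    case (Center L)
    then show ?thesis using arcC [of L "Lattice u"] that by simp
  qed
  have through: "(Center L, Lattice (d_vert L)) \<in> A" if "(Lattice u, Center L) \<in> A" for u L
  proof -
    have "Center L \<in> Domain A" using Range_Domain [of "Center L"] that by auto
    then show ?thesis using arcC by blast
  qed
  have tail_N: "u \<in> ?N" if "Lattice u \<in> Domain A" for u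
  proof -
    note asm = that
    obtain y where y: "(Lattice u, y) \<in> A" using asm by blast
    have "u \<in> Vert v t" using arcL [OF y] Vert_loz by blast
    moreover have "u \<notin> R0 v t"
    proof
      assume R: "u \<in> R0 v t"
      from Domain_Range [OF that] show False
      proof
        assume "Lattice u \<in> Range A"
        then obtain L where "L \<in> lozenges_in v t" "d_vert L = u" using arc_L by blast
        then obtain n where "n \<in> {1..t - 1}" "u = b_pt v t n" by (rule sink_b_pt [OF R])
        then show False using b_in(2) that by blast
      qed (use a_pt_source(2) R in auto)
    qed
    ultimately show ?thesis by blast
  qed
  define f where "f u = (if Lattice u \<in> Domain A then SOME L. (Lattice u, Center L) \<in> A
    else SOME L. L \<in> lozenges_in v t \<and> d_vert L = u)" for u
  have f_on: "(Lattice u, Center (f u)) \<in> A" if "Lattice u \<in> Domain A" for u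
  proof -
    have "\<exists>L. (Lattice u, Center L) \<in> A" using that arcL by blast
    then have "(Lattice u, Center (SOME L. (Lattice u, Center L) \<in> A)) \<in> A" by (rule someI_ex)
    then show ?thesis using that unfolding f_def by simp
  qed
  have f_off: "f u \<in> lozenges_in v t \<and> d_vert (f u) = u" if "u \<in> ?N" "Lattice u \<notin> Domain A" for u
  proof -
    note asm = that
    have "\<exists>L. L \<in> lozenges_in v t \<and> d_vert L = u"
    proof (rule ccontr)
      assume "\<not> ?thesis"
      then obtain i where "i \<in> {1..<t}" "u = a_pt v t (2 * i)" using source_a_pt [of u] asm(1) by blast
      then show False using a_out that(2) by blast
    qed
    then have "(SOME L. L \<in> lozenges_in v t \<and> d_vert L = u) \<in> lozenges_in v t \<and>
      d_vert (SOME L. L \<in> lozenges_in v t \<and> d_vert L = u) = u" by (rule someI_ex)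
    then show ?thesis using that(2) unfolding f_def by simp
  qed
  have f_loz: "f u \<in> lozenges_in v t \<and> u \<in> loz_verts (f u)" if "u \<in> ?N" for u
  proof (cases "Lattice u \<in> Domain A")
    case True
    then show ?thesis using arcL [OF f_on [OF True]] by simp
  next
    case False
    then show ?thesis using f_off [OF that False] d_vert_loz [of "f u"] by simp
  qed
  \<comment> \<open>A lozenge traversed by a path is never a default choice: its lower corner either
    has an outgoing arc or is the end of a path, hence a root.\<close>
  have mixed: False if "(Lattice u, Center L) \<in> A" "d_vert L = w" "w \<in> ?N" "Lattice w \<notin> Domain A" for u w L
  proof -
    note asm = that
    have "Lattice w \<in> Range A" using through [OF that(1)] that(2) by blast
    then obtain n where "n \<in> {1..t - 1}" "w = b_pt v t n" using Range_Domain asm(4) by blast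
    then show False using b_pt_R0 that(3) by blast
  qed
  have "inj_on f ?N"
  proof (rule inj_onI)
    fix u w assume u: "u \<in> ?N" and w: "w \<in> ?N" and eq: "f u = f w"
    consider "Lattice u \<in> Domain A" "Lattice w \<in> Domain A" | "Lattice u \<in> Domain A" "Lattice w \<notin> Domain A"
      | "Lattice u \<notin> Domain A" "Lattice w \<in> Domain A" | "Lattice u \<notin> Domain A" "Lattice w \<notin> Domain A" by blast
    then show "u = w"
    proof cases
      case 1
      then show ?thesis using in_unique [of "Lattice u" "Center (f u)" "Lattice w"] f_on [of u] f_on [of w] eq by simp
    next
      case 2
      then show ?thesis using mixed [OF f_on [of u] _ w] f_off [OF w] eq by simp
    next
      case 3
      then show ?thesis using mixed [OF f_on [of w] _ u] f_off [OF u] eq by simp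
    next
      case 4
      then have "d_vert (f u) = u" "d_vert (f w) = w" using f_off [OF u] f_off [OF w] by blast+
      then show ?thesis unfolding eq by (rule trans [OF sym])
    qed
  qed
  moreover have "L \<in> f ` ?N" if L: "L \<in> lozenges_in v t" for L
  proof (cases "Center L \<in> Range A")
    case True
    then obtain u where u: "(Lattice u, Center L) \<in> A" using arc_C by blast
    then have D: "Lattice u \<in> Domain A" by blast
    have "f u = L" using out_unique [OF f_on [OF D] u] by simp
    then show ?thesis using tail_N [OF D] by blast
  next
    case False
    let ?u = "d_vert L"
    \<comment> \<open>A lower corner can be entered only through the centre of its own lozenge. If
      no path uses that centre, the corner lies on no path, and the lozenge is its default
      choice.\<close>
    have not_in: "Lattice ?u \<notin> Range A"
    proof
      assume "Lattice ?u \<in> Range A"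
      then obtain M where M: "(Center M, Lattice ?u) \<in> A" "?u = d_vert M" "M \<in> lozenges_in v t" using arc_L by blast
      then have "L = M" by (intro d_vert_inj [OF L])
      then have "Center L \<in> Domain A" using M(1) by blast
      then show False using Domain_Range False by blast
    qed
    have "?u \<notin> R0 v t"
    proof
      assume "?u \<in> R0 v t"
      then obtain n where "n \<in> {1..t - 1}" "?u = b_pt v t n" by (rule sink_b_pt [OF _ L refl])
      then show False using b_in(1) not_in by simp
    qed
    then have N: "?u \<in> ?N" using Vert_loz [OF L d_vert_loz [OF L]] by simp
    have "Lattice ?u \<notin> Domain A"
    proof
      assume "Lattice ?u \<in> Domain A"
      then obtain i where "i \<in> {1..<t}" "?u = a_pt v t (2 * i)" using Domain_Range not_in by blast
      then show False using a_pt_source(3) L by blast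
    qed
    then have "f ?u = L" using f_off [OF N] L by (intro d_vert_inj) auto
    then show ?thesis using N by blast
  qed
  ultimately have "bij_betw f ?N (lozenges_in v t)"
    unfolding bij_betw_def using f_loz by blast
  then have "orientation f" unfolding orientation_def using f_loz by blast
  moreover have "arcs_of f = A"
  proof (intro equalityI subsetI)
    fix e assume "e \<in> arcs_of f"
    then obtain u where u: "u \<in> ?N" "u \<noteq> d_vert (f u)"
      and e: "e = (Lattice u, Center (f u)) \<or> e = (Center (f u), Lattice (d_vert (f u)))"
      unfolding arcs_of_def by blast
    have "Lattice u \<in> Domain A" using f_off [OF u(1)] u(2) by auto
    then show "e \<in> A" using e f_on through by blast
  next
    have main: "(Lattice u, Center L) \<in> arcs_of f \<and> (Center L, Lattice (d_vert L)) \<in> arcs_of f"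
      if uL: "(Lattice u, Center L) \<in> A" for u L
    proof -
      have D: "Lattice u \<in> Domain A" using uL by blast
      have "f u = L" using out_unique [OF f_on [OF D] uL] by simp
      moreover have "u \<noteq> d_vert L" using arcL [OF uL] by simp
      ultimately show ?thesis using tail_N [OF D] unfolding arcs_of_iff by blast
    qed
    fix e assume e: "e \<in> A"
    obtain y z where yz: "e = (y, z)" by (cases e)
    show "e \<in> arcs_of f"
    proof (cases y)
      case (Lattice u)
      then obtain L where "z = Center L" using arcL e yz by blast
      then show ?thesis using main e yz Lattice by blast
    next
      case (Center L)
      then have z: "z = Lattice (d_vert L)" using arcC e yz by blast
      have "Center L \<in> Range A" using Domain_Range [of "Center L"] e yz Center by auto
      then obtain u where "(Lattice u, Center L) \<in> A" using arc_C by blast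
      then show ?thesis using main yz Center z by blast
    qed
  qed
  ultimately show ?thesis by blast
qed

text \<open>Components are disjoint, so each contains exactly one element of the common root set,
  and this must be its root.\<close>

lemma rooted_forest_eq:
  assumes F: "is_rooted_forest v t (E, s)" "roots v t (E, s) = R0 v t"
    and F': "is_rooted_forest v t (E, s')" "roots v t (E, s') = R0 v t"
  shows "s = s'"
proof -
  let ?C = "conn_comps (Vert v t) E"
  have wf: "wf_digraph (with_proj (ugraph (Vert v t) E))"
    using F(1) forest_wf unfolding is_rooted_forest_def by auto
  have s: "s \<in> extensional ?C" "\<And>C. C \<in> ?C \<Longrightarrow> s C \<in> C" "s ` ?C = R0 v t"
    and s': "s' \<in> extensional ?C" "\<And>C. C \<in> ?C \<Longrightarrow> s' C \<in> C" "s' ` ?C = R0 v t"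
    using F F' unfolding is_rooted_forest_def roots_def PiE_def by auto
  have disj: "C = D" if C: "C \<in> ?C" and D: "D \<in> ?C" and u: "u \<in> C" "u \<in> D" for C D u
  proof -
    obtain x y where "C = comp_of (Vert v t) E x" "D = comp_of (Vert v t) E y"
      using C D unfolding conn_comps_def by blast
    then show ?thesis using comp_of_eqI [OF wf, of u x] comp_of_eqI [OF wf, of u y] u by simp
  qed
  show ?thesis
  proof (rule extensionalityI [OF s(1) s'(1)])
    fix C assume C: "C \<in> ?C"
    have "s C \<in> s' ` ?C" unfolding s'(3) s(3) [symmetric] using C by (rule imageI)
    then obtain D where D: "s C = s' D" "D \<in> ?C" by (rule imageE)
    then have "C = D" using disj [OF C D(2) s(2) [OF C]] s'(2) [OF D(2)] by simp
    then show "s C = s' C" using D(1) by simp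
  qed
qed

lemma phi_bij_betw:
  "bij_betw (phi v t) {F. is_rooted_forest v t F \<and> roots v t F = R0 v t}
     (path_tuples (N_tilde x v t) starts ends)"
proof (rule bij_betw_imageI)
  let ?F = "{F. is_rooted_forest v t F \<and> roots v t F = R0 v t}"
  have repr: "\<exists>f E s. F = (E, s) \<and> orientation f \<and> E = forest_edges f \<and> phi v t F = arcs_of f" if mem: "F \<in> ?F" for F
  proof -
    obtain E s where F: "F = (E, s)" by (cases F)
    then obtain f where f: "orientation f" "E = forest_edges f"
      "oriented_edges v t (E, s) = (\<lambda>u. (u, nxt f u)) ` (Vert v t - R0 v t)"
      using forest_orientation [of E s] mem by auto
    have "phi v t F = arcs_of f" unfolding F by (rule phi_eq_arcs_of [OF f(1,3)])
    with F f(1,2) show ?thesis by (intro exI conjI)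
  qed
  show "inj_on (phi v t) ?F"
  proof (rule inj_onI)
    fix F F' assume F: "F \<in> ?F" and F': "F' \<in> ?F" and eq: "phi v t F = phi v t F'"
    obtain f E s where f: "F = (E, s)" "orientation f" "E = forest_edges f" "phi v t F = arcs_of f"
      using repr [OF F] by blast
    obtain f' E' s' where f': "F' = (E', s')" "orientation f'" "E' = forest_edges f'" "phi v t F' = arcs_of f'"
      using repr [OF F'] by blast
    have "f u = f' u" if "u \<in> Vert v t - R0 v t" for u
      using arcs_of_inj [OF f(2) f'(2) _ that] eq f(4) f'(4) by simp
    then have "forest_edges f = forest_edges f'"
      unfolding forest_edges_def nxt_def by (intro image_cong refl) simp
    then have "E = E'" using f(3) f'(3) by simp
    then show "F = F'" using rooted_forest_eq [of E s s'] F F' f(1) f'(1) by simp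
  qed
  show "phi v t ` ?F = path_tuples (N_tilde x v t) starts ends"
  proof (intro equalityI subsetI)
    fix A assume "A \<in> phi v t ` ?F"
    then obtain F where F: "A = phi v t F" "F \<in> ?F" by (rule imageE)
    then obtain f where "orientation f" "A = arcs_of f" using repr [OF F(2)] by auto
    then show "A \<in> path_tuples (N_tilde x v t) starts ends" using arcs_of_path_tuple by simp
  next
    fix A assume "A \<in> path_tuples (N_tilde x v t) starts ends"
    then obtain f where f: "orientation f" "arcs_of f = A" using path_tuple_orientation by blast
    obtain s where s: "is_rooted_forest v t (forest_edges f, s)" "roots v t (forest_edges f, s) = R0 v t"
      "\<forall>u \<in> Vert v t - R0 v t. (u, nxt f u) \<in> oriented_edges v t (forest_edges f, s)"
      using orientation_forest [OF f(1)] by blast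
    \<comment> \<open>\<open>orientation_forest\<close> only says that the pairs given by
      \<open>f\<close> are oriented edges. Equality comes from an orientation \<open>g\<close>
      extracted from the forest, whose successors must then agree with those of
      \<open>f\<close>.\<close>
    obtain g where g: "orientation g"
      "oriented_edges v t (forest_edges f, s) = (\<lambda>u. (u, nxt g u)) ` (Vert v t - R0 v t)"
      using forest_orientation [OF s(1,2)] by blast
    have "nxt f u = nxt g u" if "u \<in> Vert v t - R0 v t" for u
      using s(3) that unfolding g(2) by auto
    then have "oriented_edges v t (forest_edges f, s) = (\<lambda>u. (u, nxt f u)) ` (Vert v t - R0 v t)"
      unfolding g(2) by (intro image_cong refl) simp
    then have "phi v t (forest_edges f, s) = A" using phi_eq_arcs_of [OF f(1)] f(2) by simp
    then show "A \<in> phi v t ` ?F" using s(1,2) by (intro image_eqI [of _ _ "(forest_edges f, s)"]) simp_all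
  qed
qed

end

theorem theorem4p11:
  fixes v :: lattice_point and t :: nat and x :: "lattice_point \<Rightarrow> 'k::field"
  assumes "v \<in> P0" and "t \<ge> 2" and "(int t + 1) mod 3 = color v"
  shows "bij_betw (phi v t)
           {F. is_rooted_forest v t F \<and> roots v t F = R0 v t}
           (path_tuples (N_tilde x v t)
              (map (\<lambda>i. Lattice (a_pt v t (2 * i))) [1..<t])
              (map (\<lambda>i. Lattice (b_pt v t (t - i))) [1..<t]))"
proof -
  interpret lozenge_triangle v t using assms by unfold_locales
  show ?thesis by (rule phi_bij_betw)
qed

end
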